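(* Let $(\mathfrak{g}=\mathfrak{g}_{\overline 0}\oplus\mathfrak{g}_{\overline 1},B)$ be a solvable complex quadratic Lie superalgebra of dimension $8$ whose even part $\mathfrak{g}_{\overline 0}$ is $6$-dimensional and indecomposable (as a quadratic Lie algebra with the form $B|_{\mathfrak{g}_{\overline 0}\times\mathfrak{g}_{\overline 0}}$). (i) If $\mathfrak{g}$ is decomposable, then $\mathfrak{g}$ is isomorphic to the orthogonal direct sum $\mathfrak{g}_{\overline 0}\overset{\perp}{\oplus}\mathfrak{g}_{\overline 1}$, where $\mathfrak{g}_{\overline 0}$ is isometrically isomorphic to one of the quadratic Lie algebras $\mathfrak{g}_{6,1}$, $\mathfrak{g}_{6,2}(\lambda)$ ($\lambda\in\mathbb{C}\setminus\{0\}$), $\mathfrak{g}_{6,3}$, $\mathfrak{g}_{\overline 1}$ is a symplectic vector space of dimension $2$, and $[\mathfrak{g}_{\overline 0},\mathfrak{g}_{\overline 1}]=\{0\}$. (ii) If $\mathfrak{g}$ is indecomposable, then $\mathfrak{g}$ is isometrically isomorphic to one of the quadratic Lie superalgebras $\mathfrak{g}_{8,2,1}^{s}(\lambda,\mu,\nu)$, $\mathfrak{g}_{8,2,2}^{s}(\lambda,\mu)$, $\mathfrak{g}_{8,2,3}^{s}(\lambda)$, $\mathfrak{g}_{8,2,4}^{s}(\lambda,\mu)$, $\mathfrak{g}_{8,2,5}^{s}(\lambda)$, $\mathfrak{g}_{8,2,6}^{s}(\lambda,\mu)$ (with $\lambda=1$), $\mathfrak{g}_{8,2,7}^{s}$,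 $\mathfrak{g}_{8,2,8}^{s}(\lambda)$, $\mathfrak{g}_{8,2,9}^{s}$, for some values of the parameters in the ranges specified in the definitions of these superalgebras.
   Context: All vector spaces are finite-dimensional over $\mathbb{C}$. A quadratic Lie superalgebra $(\mathfrak{g},B)$ is a Lie superalgebra $\mathfrak{g}=\mathfrak{g}_{\overline 0}\oplus\mathfrak{g}_{\overline 1}$ (bracket with $[X,Y]=-(-1)^{xy}[Y,X]$ for $X\in\mathfrak{g}_x,Y\in\mathfrak{g}_y$ and the super Jacobi identity) with a non-degenerate bilinear form $B$ that is supersymmetric ($B(X,Y)=(-1)^{xy}B(Y,X)$), invariant ($B([X,Y],Z)=B(X,[Y,Z])$) and even ($B(\mathfrak{g}_{\overline 0},\mathfrak{g}_{\overline 1})=0$). A quadratic Lie algebra is the case $\mathfrak{g}_{\overline 1}=0$. Two quadratic Lie superalgebras are isometrically isomorphic (i-isomorphic) if there is a Lie superalgebra isomorphism between them preserving the forms. A graded ideal is non-degenerate if $B$ restricted to it is non-degenerate; $(\mathfrak{g},B)$ is decomposable if it has a non-degenerate graded ideal other than $\{0\}$ and $\mathfrak{g}$ (equivalently, it is an orthogonal direct sum of two nonzero graded ideals), and indecomposable otherwise. In the lists of brackets defining the algebras $\mathfrak{g}_{6,\cdot}$ and $\mathfrak{g}_{8,2,\cdot}^{s}$, brackets not listed and not obtained from listed ones by (super) skew-symmetry are zero. Six-dimensional quadratic Lie algebras, with basis $\{Z_1,Z_2,Z_3,X_1,X_2,X_3\}$ and $B(X_i,Z_j)=\delta_{ij}$,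 $B(X_i,X_j)=B(Z_i,Z_j)=0$: - $\mathfrak{g}_{6,1}$: $[X_1,X_2]=Z_3$, $[X_2,X_3]=Z_1$, $[X_3,X_1]=Z_2$. - $\mathfrak{g}_{6,2}(\lambda)$, $\lambda\in\mathbb{C}\setminus\{0\}$: $[X_3,Z_1]=Z_1$, $[X_3,Z_2]=\lambda Z_2$, $[X_3,X_1]=-X_1$, $[X_3,X_2]=-\lambda X_2$, $[Z_1,X_1]=Z_3$, $[Z_2,X_2]=\lambda Z_3$. - $\mathfrak{g}_{6,3}$: $[X_3,Z_1]=Z_1$, $[X_3,Z_2]=Z_1+Z_2$, $[X_3,X_1]=-X_1-X_2$, $[X_3,X_2]=-X_2$, $[Z_1,X_1]=[Z_2,X_1]=[Z_2,X_2]=Z_3$. Eight-dimensional quadratic Lie superalgebras: the even part is one of the six-dimensional quadratic Lie algebras $\mathfrak{g}_{6,1}$, $\mathfrak{g}_{6,2}(\lambda)$, $\mathfrak{g}_{6,3}$ (as indicated in each case), with its brackets and form; the odd part is $\mathrm{span}\{Y_{\overline 1},T_{\overline 1}\}$ with $B(Y_{\overline 1},T_{\overline 1})=1=-B(T_{\overline 1},Y_{\overline 1})$, $B(Y_{\overline 1},Y_{\overline 1})=B(T_{\overline 1},T_{\overline 1})=0$. The brackets involving odd elements are: - $\mathfrak{g}_{8,2,1}^{s}(\lambda,\mu,\nu)$, $\lambda,\mu,\nu\in\mathbb{C}$ not all zero; even part $\mathfrak{g}_{6,1}$: $[X_1,Y_{\overline 1}]=\lambda Y_{\overline 1}$, $[X_1,T_{\overline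 1}]=-\lambda T_{\overline 1}$, $[X_2,Y_{\overline 1}]=\mu Y_{\overline 1}$, $[X_2,T_{\overline 1}]=-\mu T_{\overline 1}$, $[X_3,Y_{\overline 1}]=\nu Y_{\overline 1}$, $[X_3,T_{\overline 1}]=-\nu T_{\overline 1}$, $[Y_{\overline 1},T_{\overline 1}]=\lambda Z_1+\mu Z_2+\nu Z_3$. - $\mathfrak{g}_{8,2,2}^{s}(\lambda,\mu)$, $\lambda,\mu\in\mathbb{C}$; even part $\mathfrak{g}_{6,1}$: $[X_1,T_{\overline 1}]=\lambda Y_{\overline 1}$, $[X_2,T_{\overline 1}]=\mu Y_{\overline 1}$, $[X_3,T_{\overline 1}]=Y_{\overline 1}$, $[T_{\overline 1},T_{\overline 1}]=\lambda Z_1+\mu Z_2+Z_3$. - $\mathfrak{g}_{8,2,3}^{s}(\lambda)$, $\lambda\neq 0$; even part $\mathfrak{g}_{6,2}(\lambda)$: $[X_3,T_{\overline 1}]=Y_{\overline 1}$, $[T_{\overline 1},T_{\overline 1}]=Z_3$. - $\mathfrak{g}_{8,2,4}^{s}(\lambda,\mu)$, $\lambda\neq0$, $\mu\neq 0$; even part $\mathfrak{g}_{6,2}(\lambda)$: $[X_3,Y_{\overline 1}]=\mu Y_{\overline 1}$, $[X_3,T_{\overline 1}]=-\mu T_{\overline 1}$, $[Y_{\overline 1},T_{\overline 1}]=\mu Z_3$. - $\mathfrak{g}_{8,2,5}^{s}(\lambda)$, $\lambda\neq0$; even part $\mathfrak{g}_{6,2}(\lambda)$: $[X_3,Y_{\overline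 1}]=\tfrac12Y_{\overline 1}$, $[X_3,T_{\overline 1}]=-\tfrac12T_{\overline 1}$, $[Z_1,T_{\overline 1}]=Y_{\overline 1}$, $[Y_{\overline 1},T_{\overline 1}]=\tfrac12 Z_3$, $[T_{\overline 1},T_{\overline 1}]=X_1$. - $\mathfrak{g}_{8,2,6}^{s}(\lambda,\mu)$, $\lambda=1$, $\mu\neq0$; even part $\mathfrak{g}_{6,2}(1)$: $[X_3,Y_{\overline 1}]=\tfrac12Y_{\overline 1}$, $[X_3,T_{\overline 1}]=-\tfrac12T_{\overline 1}$, $[Z_1,T_{\overline 1}]=Y_{\overline 1}$, $[Z_2,T_{\overline 1}]=\mu Y_{\overline 1}$, $[Y_{\overline 1},T_{\overline 1}]=\tfrac12 Z_3$, $[T_{\overline 1},T_{\overline 1}]=X_1+\mu X_2$. - $\mathfrak{g}_{8,2,7}^{s}$; even part $\mathfrak{g}_{6,3}$: $[X_3,T_{\overline 1}]=Y_{\overline 1}$, $[T_{\overline 1},T_{\overline 1}]=Z_3$. - $\mathfrak{g}_{8,2,8}^{s}(\lambda)$, $\lambda\neq0$; even part $\mathfrak{g}_{6,3}$: $[X_3,Y_{\overline 1}]=\lambda Y_{\overline 1}$, $[X_3,T_{\overline 1}]=-\lambda T_{\overline 1}$, $[Y_{\overline 1},T_{\overline 1}]=\lambda Z_3$. - $\mathfrak{g}_{8,2,9}^{s}$; even part $\mathfrak{g}_{6,3}$: $[X_3,Y_{\overline 1}]=\tfrac12Y_{\overline 1}$, $[X_3,T_{\overline 1}]=-\tfrac12T_{\overline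 1}$, $[Z_2,T_{\overline 1}]=Y_{\overline 1}$, $[Y_{\overline 1},T_{\overline 1}]=\tfrac12 Z_3$, $[T_{\overline 1},T_{\overline 1}]=X_2$. *)

theory Defs
  imports "HOL-Analysis.Analysis"
begin

section \<open>Quadratic Lie superalgebras\<close>

text \<open>The vector space underlying a structure is the sum of its even and its odd part, inside an
  ambient complex vector space. Everything below is relativised to these parts, so that the
  even part of a superalgebra is again a structure of the same kind, on the same ambient type.\<close>

record 'a qsuper =
  scal :: "complex \<Rightarrow> 'a \<Rightarrow> 'a"
  even_part :: "'a set"
  odd_part :: "'a set"
  brk :: "'a \<Rightarrow> 'a \<Rightarrow> 'a"
  form :: "'a \<Rightarrow> 'a \<Rightarrow> complex"

definition whole :: "'a::ab_group_add qsuper \<Rightarrow> 'a set" where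
  "whole G = {x + y | x y. x \<in> even_part G \<and> y \<in> odd_part G}"

text \<open>Homogeneous components, with degrees read modulo 2.\<close>

definition hpart :: "'a qsuper \<Rightarrow> nat \<Rightarrow> 'a set" where
  "hpart G p = (if even p then even_part G else odd_part G)"

definition nondegenerate_on :: "'a::ab_group_add qsuper \<Rightarrow> 'a set \<Rightarrow> bool" where
  "nondegenerate_on G V \<longleftrightarrow> (\<forall>x\<in>V. (\<forall>y\<in>V. form G x y = 0) \<longrightarrow> x = 0)"

locale quadratic_lie_superalgebra = vector_space "scal G"
  for G :: "'a::ab_group_add qsuper" +
  assumes even_subspace: "subspace (even_part G)"
    and odd_subspace: "subspace (odd_part G)"
    and direct: "even_part G \<inter> odd_part G = {0}"
    and finite_dim: "\<exists>S. finite S \<and> span S = whole G"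
    and brk_add_left: "\<lbrakk>x \<in> whole G; y \<in> whole G; z \<in> whole G\<rbrakk>
          \<Longrightarrow> brk G (x + y) z = brk G x z + brk G y z"
    and brk_add_right: "\<lbrakk>x \<in> whole G; y \<in> whole G; z \<in> whole G\<rbrakk>
          \<Longrightarrow> brk G x (y + z) = brk G x y + brk G x z"
    and brk_scal_left: "\<lbrakk>x \<in> whole G; y \<in> whole G\<rbrakk>
          \<Longrightarrow> brk G (scal G c x) y = scal G c (brk G x y)"
    and brk_scal_right: "\<lbrakk>x \<in> whole G; y \<in> whole G\<rbrakk>
          \<Longrightarrow> brk G x (scal G c y) = scal G c (brk G x y)"
    and brk_graded: "\<lbrakk>x \<in> hpart G p; y \<in> hpart G q\<rbrakk> \<Longrightarrow> brk G x y \<in> hpart G (p + q)"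
    and brk_skew: "\<lbrakk>x \<in> hpart G p; y \<in> hpart G q\<rbrakk>
          \<Longrightarrow> brk G x y = - scal G ((-1) ^ (p * q)) (brk G y x)"
    and jacobi: "\<lbrakk>x \<in> hpart G p; y \<in> hpart G q; z \<in> hpart G r\<rbrakk>
          \<Longrightarrow> brk G x (brk G y z)
              = brk G (brk G x y) z + scal G ((-1) ^ (p * q)) (brk G y (brk G x z))"
    and form_add_left: "\<lbrakk>x \<in> whole G; y \<in> whole G; z \<in> whole G\<rbrakk>
          \<Longrightarrow> form G (x + y) z = form G x z + form G y z"
    and form_add_right: "\<lbrakk>x \<in> whole G; y \<in> whole G; z \<in> whole G\<rbrakk>
          \<Longrightarrow> form G x (y + z) = form G x y + form G x z"
    and form_scal_left: "\<lbrakk>x \<in> whole G; y \<in> whole G\<rbrakk>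
          \<Longrightarrow> form G (scal G c x) y = c * form G x y"
    and form_scal_right: "\<lbrakk>x \<in> whole G; y \<in> whole G\<rbrakk>
          \<Longrightarrow> form G x (scal G c y) = c * form G x y"
    and form_supersym: "\<lbrakk>x \<in> hpart G p; y \<in> hpart G q\<rbrakk>
          \<Longrightarrow> form G x y = (-1) ^ (p * q) * form G y x"
    and form_invariant: "\<lbrakk>x \<in> whole G; y \<in> whole G; z \<in> whole G\<rbrakk>
          \<Longrightarrow> form G (brk G x y) z = form G x (brk G y z)"
    and form_even: "\<lbrakk>x \<in> even_part G; y \<in> odd_part G\<rbrakk> \<Longrightarrow> form G x y = 0"
    and form_nondegenerate: "nondegenerate_on G (whole G)"

definition even_algebra :: "'a::ab_group_add qsuper \<Rightarrow> 'a qsuper" where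
  "even_algebra G = G\<lparr>odd_part := {0}\<rparr>"

definition sdim :: "'a::ab_group_add qsuper \<Rightarrow> 'a set \<Rightarrow> nat" where
  "sdim G V = vector_space.dim (scal G) V"

definition derived :: "'a::ab_group_add qsuper \<Rightarrow> 'a set \<Rightarrow> 'a set" where
  "derived G V = module.span (scal G) {brk G x y | x y. x \<in> V \<and> y \<in> V}"

definition solvable :: "'a::ab_group_add qsuper \<Rightarrow> bool" where
  "solvable G \<longleftrightarrow> (\<exists>k. (derived G ^^ k) (whole G) = {0})"

definition graded_ideal :: "'a::ab_group_add qsuper \<Rightarrow> 'a set \<Rightarrow> bool" where
  "graded_ideal G I \<longleftrightarrow>
     module.subspace (scal G) I \<and> I \<subseteq> whole G \<and>
     (\<forall>x\<in>I. \<exists>a\<in>I \<inter> even_part G. \<exists>b\<in>I \<inter> odd_part G. x = a + b) \<and>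
     (\<forall>x\<in>whole G. \<forall>y\<in>I. brk G x y \<in> I \<and> brk G y x \<in> I)"

definition decomposable :: "'a::ab_group_add qsuper \<Rightarrow> bool" where
  "decomposable G \<longleftrightarrow>
     (\<exists>I. graded_ideal G I \<and> nondegenerate_on G I \<and> I \<noteq> {0} \<and> I \<noteq> whole G)"

abbreviation indecomposable :: "'a::ab_group_add qsuper \<Rightarrow> bool" where
  "indecomposable G \<equiv> \<not> decomposable G"

definition orthogonal_direct_sum :: "'a::ab_group_add qsuper \<Rightarrow> 'a set \<Rightarrow> 'a set \<Rightarrow> bool" where
  "orthogonal_direct_sum G I J \<longleftrightarrow>
     graded_ideal G I \<and> graded_ideal G J \<and>
     I \<inter> J = {0} \<and> whole G = {x + y | x y. x \<in> I \<and> y \<in> J} \<and>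
     (\<forall>x\<in>I. \<forall>y\<in>J. form G x y = 0 \<and> form G y x = 0)"

definition symplectic_on :: "'a::ab_group_add qsuper \<Rightarrow> 'a set \<Rightarrow> bool" where
  "symplectic_on G V \<longleftrightarrow>
     module.subspace (scal G) V \<and>
     (\<forall>x\<in>V. \<forall>y\<in>V. \<forall>z\<in>V. form G (x + y) z = form G x z + form G y z \<and>
        form G x (y + z) = form G x y + form G x z) \<and>
     (\<forall>c. \<forall>x\<in>V. \<forall>y\<in>V. form G (scal G c x) y = c * form G x y \<and>
        form G x (scal G c y) = c * form G x y) \<and>
     (\<forall>x\<in>V. form G x x = 0) \<and> nondegenerate_on G V"

definition i_isomorphism ::
  "'a::ab_group_add qsuper \<Rightarrow> 'b::ab_group_add qsuper \<Rightarrow> ('a \<Rightarrow> 'b) \<Rightarrow> bool" where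
  "i_isomorphism G H f \<longleftrightarrow>
     bij_betw f (whole G) (whole H) \<and>
     f ` even_part G = even_part H \<and> f ` odd_part G = odd_part H \<and>
     (\<forall>x\<in>whole G. \<forall>y\<in>whole G. f (x + y) = f x + f y) \<and>
     (\<forall>c. \<forall>x\<in>whole G. f (scal G c x) = scal H c (f x)) \<and>
     (\<forall>x\<in>whole G. \<forall>y\<in>whole G. f (brk G x y) = brk H (f x) (f y)) \<and>
     (\<forall>x\<in>whole G. \<forall>y\<in>whole G. form H (f x) (f y) = form G x y)"

definition i_isomorphic :: "'a::ab_group_add qsuper \<Rightarrow> 'b::ab_group_add qsuper \<Rightarrow> bool" where
  "i_isomorphic G H \<longleftrightarrow> (\<exists>f. i_isomorphism G H f)"


section \<open>The algebras of dimension six and eight\<close>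

text \<open>All of them live in the space with basis \<open>Z1, Z2, Z3, X1, X2, X3\<close> (even) and
  \<open>Y1, T1\<close> (odd); the six-dimensional ones occupy the span of the even basis vectors.\<close>

datatype gen = Z1 | Z2 | Z3 | X1 | X2 | X3 | Y1 | T1

lemma UNIV_gen: "UNIV = {Z1, Z2, Z3, X1, X2, X3, Y1, T1}"
proof -
  have "x \<in> {Z1, Z2, Z3, X1, X2, X3, Y1, T1}" for x
    by (cases x) auto
  then show ?thesis by blast
qed

instance gen :: finite
  by standard (simp add: UNIV_gen)

type_synonym vec8 = "complex ^ gen"

abbreviation bv :: "gen \<Rightarrow> vec8" where
  "bv i \<equiv> axis i 1"

fun gdeg :: "gen \<Rightarrow> nat" where
  "gdeg Y1 = 1"
| "gdeg T1 = 1"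
| "gdeg _ = 0"

definition even_space :: "vec8 set" where
  "even_space = vec.span {bv Z1, bv Z2, bv Z3, bv X1, bv X2, bv X3}"

definition odd_space :: "vec8 set" where
  "odd_space = vec.span {bv Y1, bv T1}"

definition std_form :: "vec8 \<Rightarrow> vec8 \<Rightarrow> complex" where
  "std_form x y =
     x $ X1 * y $ Z1 + x $ Z1 * y $ X1 + x $ X2 * y $ Z2 + x $ Z2 * y $ X2 +
     x $ X3 * y $ Z3 + x $ Z3 * y $ X3 + x $ Y1 * y $ T1 - x $ T1 * y $ Y1"

text \<open>An entry \<open>(i, j, v)\<close> of a table states \<open>[bv i, bv j] = v\<close>. The bilinear bracket below adds
  the value of \<open>[bv j, bv i]\<close> forced by super skew-symmetry; all remaining brackets of basis vectors
  vanish. A pair \<open>{i, j}\<close> must occur at most once in a table, and a diagonal entry \<open>(i, i, v)\<close>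
  only for odd \<open>i\<close>.\<close>

definition table_brk :: "(gen \<times> gen \<times> vec8) list \<Rightarrow> vec8 \<Rightarrow> vec8 \<Rightarrow> vec8" where
  "table_brk L x y =
     (\<Sum>(i, j, v)\<leftarrow>L.
        (x $ i * y $ j - (if i = j then 0 else (-1) ^ (gdeg i * gdeg j) * (x $ j * y $ i))) *s v)"

definition alg6 :: "(gen \<times> gen \<times> vec8) list \<Rightarrow> vec8 qsuper" where
  "alg6 L = \<lparr>scal = (*s), even_part = even_space, odd_part = {0},
             brk = table_brk L, form = std_form\<rparr>"

definition alg8 :: "(gen \<times> gen \<times> vec8) list \<Rightarrow> vec8 qsuper" where
  "alg8 L = \<lparr>scal = (*s), even_part = even_space, odd_part = odd_space,
             brk = table_brk L, form = std_form\<rparr>"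

definition table61 :: "(gen \<times> gen \<times> vec8) list" where
  "table61 = [(X1, X2, bv Z3), (X2, X3, bv Z1), (X3, X1, bv Z2)]"

definition table62 :: "complex \<Rightarrow> (gen \<times> gen \<times> vec8) list" where
  "table62 l =
     [(X3, Z1, bv Z1), (X3, Z2, l *s bv Z2), (X3, X1, - bv X1), (X3, X2, - (l *s bv X2)),
      (Z1, X1, bv Z3), (Z2, X2, l *s bv Z3)]"

definition table63 :: "(gen \<times> gen \<times> vec8) list" where
  "table63 =
     [(X3, Z1, bv Z1), (X3, Z2, bv Z1 + bv Z2), (X3, X1, - bv X1 - bv X2), (X3, X2, - bv X2),
      (Z1, X1, bv Z3), (Z2, X1, bv Z3), (Z2, X2, bv Z3)]"

definition g61 :: "vec8 qsuper" where "g61 = alg6 table61"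
definition g62 :: "complex \<Rightarrow> vec8 qsuper" where "g62 l = alg6 (table62 l)"
definition g63 :: "vec8 qsuper" where "g63 = alg6 table63"

definition g821 :: "complex \<Rightarrow> complex \<Rightarrow> complex \<Rightarrow> vec8 qsuper" where
  "g821 l m n = alg8 (table61 @
     [(X1, Y1, l *s bv Y1), (X1, T1, - (l *s bv T1)),
      (X2, Y1, m *s bv Y1), (X2, T1, - (m *s bv T1)),
      (X3, Y1, n *s bv Y1), (X3, T1, - (n *s bv T1)),
      (Y1, T1, l *s bv Z1 + m *s bv Z2 + n *s bv Z3)])"

definition g822 :: "complex \<Rightarrow> complex \<Rightarrow> vec8 qsuper" where
  "g822 l m = alg8 (table61 @
     [(X1, T1, l *s bv Y1), (X2, T1, m *s bv Y1), (X3, T1, bv Y1),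
      (T1, T1, l *s bv Z1 + m *s bv Z2 + bv Z3)])"

definition g823 :: "complex \<Rightarrow> vec8 qsuper" where
  "g823 l = alg8 (table62 l @ [(X3, T1, bv Y1), (T1, T1, bv Z3)])"

definition g824 :: "complex \<Rightarrow> complex \<Rightarrow> vec8 qsuper" where
  "g824 l m = alg8 (table62 l @
     [(X3, Y1, m *s bv Y1), (X3, T1, - (m *s bv T1)), (Y1, T1, m *s bv Z3)])"

definition g825 :: "complex \<Rightarrow> vec8 qsuper" where
  "g825 l = alg8 (table62 l @
     [(X3, Y1, (1/2) *s bv Y1), (X3, T1, - ((1/2) *s bv T1)), (Z1, T1, bv Y1),
      (Y1, T1, (1/2) *s bv Z3), (T1, T1, bv X1)])"

definition g826 :: "complex \<Rightarrow> complex \<Rightarrow> vec8 qsuper" where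
  "g826 l m = alg8 (table62 l @
     [(X3, Y1, (1/2) *s bv Y1), (X3, T1, - ((1/2) *s bv T1)),
      (Z1, T1, bv Y1), (Z2, T1, m *s bv Y1),
      (Y1, T1, (1/2) *s bv Z3), (T1, T1, bv X1 + m *s bv X2)])"

definition g827 :: "vec8 qsuper" where
  "g827 = alg8 (table63 @ [(X3, T1, bv Y1), (T1, T1, bv Z3)])"

definition g828 :: "complex \<Rightarrow> vec8 qsuper" where
  "g828 l = alg8 (table63 @
     [(X3, Y1, l *s bv Y1), (X3, T1, - (l *s bv T1)), (Y1, T1, l *s bv Z3)])"

definition g829 :: "vec8 qsuper" where
  "g829 = alg8 (table63 @
     [(X3, Y1, (1/2) *s bv Y1), (X3, T1, - ((1/2) *s bv T1)), (Z2, T1, bv Y1),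
      (Y1, T1, (1/2) *s bv Z3), (T1, T1, bv X2)])"

end

(*
  The even part is a six-dimensional quadratic Lie algebra with isotropic nonzero center. Pick a central
  z, a dual isotropic vector v and let W be the orthogonal complement of z and v. If the center is
  larger than the line of z, the alternating form B([x, y], w) lives on a four-dimensional quotient, so
  it has a kernel, and this forces g61. Otherwise [W, W] lies in the line of z, and the algebra
  is determined by the skew operator A = ad v on W, which is injective and therefore has a nonzero
  eigenvalue; this gives g62 or g63.

  The action on the odd plane is encoded by the three brackets of two odd basis vectors. Solvability
  makes them linearly dependent, whence an odd Y with [Y, Y] = 0. For a dual vector T put a = [Y, T] and
  b = [T, T]. Then a is central and [x, b] = 2 (B(x, b) a - B(x, a) b). If a and b are dependent, one
  of them can be made zero and the other is used as z above. If they are independent, take z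
  proportional to a; then b is, up to a multiple of a, an eigenvector of A, and it can be chosen as a
  member of the adapted basis of the even part. In this way g826 reduces to g825.
*)
theory Submission
  imports Defs "HOL-Computational_Algebra.Fundamental_Theorem_Algebra"
begin

section \<open>Quadratic Lie algebras of dimension six\<close>

text \<open>The center of the even part is isotropic because a non-isotropic central vector would
  span a nondegenerate ideal; in dimension six, indecomposability enters in this form
  (\<open>center_isotropic\<close>). The center is nonzero because it is the orthogonal complement
  of the derived algebra, which is proper by solvability. A hyperbolic pair \<open>z\<close>,
  \<open>v\<close> may be replaced by \<open>c z\<close>, \<open>v / c\<close> without changing W.
  This freedom is spent on making an eigenvalue of \<open>ad v\<close> equal to -1, so the scale of
  \<open>Z3\<close> is fixed, and the ratio of a to \<open>Z3\<close> reappears as the parameter of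
  g824 and g828. If a and b are independent, this ratio is forced: for \<open>v\<close> dual to a
  one has [v, b] = -2 b modulo a, hence \<open>Z3 = 2 a\<close>, which is the origin of the constant
  1/2 in g825 and g829. With even part g61 there is no eigenvalue to normalize, \<open>Z3\<close>
  can be a or b itself, and the members reached are g821(0, 0, 1) and g822(0, 0).\<close>

locale quadratic_lie =
  fixes br :: "complex^'n \<Rightarrow> complex^'n \<Rightarrow> complex^'n" and B :: "complex^'n \<Rightarrow> complex^'n \<Rightarrow> complex"
  assumes card_n: "CARD('n) = 6"
    and br_add1: "br (x + y) w = br x w + br y w"
    and br_scale1: "br (c *s x) w = c *s br x w"
    and br_skew: "br x y = - br y x"
    and br_jacobi: "br x (br y w) = br (br x y) w + br y (br x w)"
    and B_add1: "B (x + y) w = B x w + B y w"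
    and B_scale1: "B (c *s x) w = c * B x w"
    and B_sym: "B x y = B y x"
    and B_invariant: "B (br x y) w = B x (br y w)"
    and B_nondegenerate: "(\<And>y. B x y = 0) \<Longrightarrow> x = 0"
    and center_isotropic: "(\<And>y. br x y = 0) \<Longrightarrow> B x x = 0"
begin

lemma br_add2: "br w (x + y) = br w x + br w y"
  using br_skew[of w] br_add1 by (metis minus_add_distrib)

lemma br_scale2: "br w (c *s x) = c *s br w x"
  using br_skew[of w] br_scale1 by (metis vector_smult_rneg)

lemma br_minus: "br (- x) w = - br x w" "br w (- x) = - br w x"
  using br_scale1[of "-1" x w] br_scale2[of w "-1" x] by (simp_all flip: vector_sneg_minus1)

lemma br_zero: "br 0 w = 0" "br w 0 = 0"
  using br_scale1[of 0 0 w] br_scale2[of w 0 0] by simp_all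

lemma br_diff: "br (x - y) w = br x w - br y w" "br w (x - y) = br w x - br w y"
  using br_add1[of x "-y" w] br_add2[of w x "-y"] by (simp_all add: br_minus)

lemma br_self: "br x x = 0"
proof -
  have "(br x x) $ i = - (br x x) $ i" for i
    using arg_cong[OF br_skew[of x x], of "\<lambda>u. u $ i"] by simp
  then show ?thesis by (simp add: vec_eq_iff)
qed

lemma B_add2: "B w (x + y) = B w x + B w y"
  using B_add1 B_sym by metis

lemma B_scale2: "B w (c *s x) = c * B w x"
  using B_scale1 B_sym by metis

lemma B_minus: "B (- x) w = - B x w" "B w (- x) = - B w x"
  using B_scale1[of "-1" x w] B_scale2[of w "-1" x] by (simp_all flip: vector_sneg_minus1)

lemma B_zero: "B 0 w = 0" "B w 0 = 0"
  using B_scale1[of 0 0 w] B_scale2[of w 0 0] by simp_all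

lemma B_diff: "B (x - y) w = B x w - B y w" "B w (x - y) = B w x - B w y"
  using B_add1[of x "-y" w] B_add2[of w x "-y"] by (simp_all add: B_minus)

lemmas bilin = br_add1 br_add2 br_scale1 br_scale2 br_minus br_zero br_diff
  B_add1 B_add2 B_scale1 B_scale2 B_minus B_zero B_diff

section \<open>The alternating trilinear form \<open>B (br x y) w\<close>\<close>

lemma triple_swap: "B (br y x) w = - B (br x y) w"
  by (subst br_skew) (simp add: bilin)

lemma triple_cycle: "B (br x y) w = B (br y w) x"
  by (metis B_invariant B_sym)

lemma triple_repeat: "B (br x x) w = 0" "B (br x y) x = 0" "B (br y x) x = 0"
proof -
  show 1: "B (br x x) w = 0" for w by (simp add: br_self bilin)
  show "B (br x y) x = 0" using triple_cycle[of x x y] triple_cycle[of x y x] 1 by simp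
  then show "B (br y x) x = 0" by (simp add: triple_swap[of y x])
qed

lemma B_br_skew: "B (br u x) w = - B x (br u w)"
  using triple_swap[of x u w] B_invariant[of x u w] by simp

lemma triple_derivation: "B (br (br u x) y) w + B (br x (br u y)) w + B (br x y) (br u w) = 0"
  using br_jacobi[of u x y] B_br_skew[of u "br x y" w] by (simp add: bilin)

definition central :: "complex^'n \<Rightarrow> bool" where
  "central x \<longleftrightarrow> (\<forall>y. br x y = 0)"

lemma central_right: "central x \<Longrightarrow> br y x = 0"
  by (metis central_def br_skew neg_0_equal_iff_equal)

text \<open>Polarization of \<open>center_isotropic\<close>, applied to the central vector
  \<open>x + y\<close>.\<close>

lemma central_orthogonal:
  assumes "central x" "central y"
  shows "B x y = 0"
proof -
  have "B x x = 0" "B y y = 0" "B (x + y) (x + y) = 0"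
    using assms by (intro center_isotropic; simp add: central_def br_add1)+
  then show ?thesis by (simp add: bilin B_sym[of y x])
qed

section \<open>Hyperbolic pairs and bases adapted to them\<close>

definition nondeg :: "(complex^'n) set \<Rightarrow> bool" where
  "nondeg S \<longleftrightarrow> vec.subspace S \<and> (\<forall>x\<in>S. (\<forall>y\<in>S. B x y = 0) \<longrightarrow> x = 0)"

definition hyp :: "complex^'n \<Rightarrow> complex^'n \<Rightarrow> bool" where
  "hyp p q \<longleftrightarrow> B p p = 0 \<and> B q q = 0 \<and> B p q = 1 \<and> B q p = 1"

definition perp2 :: "(complex^'n) set \<Rightarrow> complex^'n \<Rightarrow> complex^'n \<Rightarrow> (complex^'n) set" where
  "perp2 S p q = {x \<in> S. B x p = 0 \<and> B x q = 0}"

lemma nondeg_UNIV: "nondeg UNIV"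
  unfolding nondeg_def using B_nondegenerate by auto

lemma nondeg_partner:
  assumes "nondeg S" "p \<in> S" "p \<noteq> 0" "B p p = 0"
  obtains q where "q \<in> S" "hyp p q"
proof -
  have S: "vec.subspace S" using assms by (simp add: nondeg_def)
  obtain y where y: "y \<in> S" "B p y \<noteq> 0"
    using assms unfolding nondeg_def by blast
  define u where "u = (1 / B p y) *s y"
  have u: "u \<in> S" "B p u = 1"
    using y S by (auto simp: u_def bilin vec.subspace_scale)
  \<comment> \<open>Since \<open>B p p = 0\<close> and \<open>B p u = 1\<close>, this multiple of
    \<open>p\<close> removes \<open>B u u\<close> and leaves the pairing with \<open>p\<close>
    unchanged.\<close>
  define q where "q = u - (B u u / 2) *s p"
  have "q \<in> S" using S u assms by (auto simp: q_def intro!: vec.subspace_diff vec.subspace_scale)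
  moreover have "hyp p q"
    using u assms by (simp add: hyp_def q_def bilin B_sym[of u p])
  ultimately show ?thesis using that by blast
qed

lemma nondeg_perp2:
  assumes "nondeg S" "p \<in> S" "q \<in> S" "hyp p q"
  shows "nondeg (perp2 S p q)" "vec.dim S = vec.dim (perp2 S p q) + 2"
proof -
  let ?S = "perp2 S p q"
  have S: "vec.subspace S" using assms by (simp add: nondeg_def)
  note h = assms(4)[unfolded hyp_def]
  have sub: "vec.subspace ?S"
    using S by (auto simp: vec.subspace_def perp2_def bilin)
  \<comment> \<open>The projection along the hyperbolic plane: a vector of the complement pairs with
    \<open>y\<close> as it pairs with \<open>P y\<close>, so nondegeneracy is inherited.\<close>
  define P where "P x = x - B x q *s p - B x p *s q" for x
  have P: "P x \<in> ?S" if "x \<in> S" for x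
    using that assms S h
    by (auto simp: P_def perp2_def bilin intro!: vec.subspace_diff vec.subspace_scale)
  show "nondeg ?S"
    unfolding nondeg_def
  proof (intro conjI ballI impI sub)
    fix x assume x: "x \<in> ?S" "\<forall>y\<in>?S. B x y = 0"
    have "B x y = 0" if "y \<in> S" for y
    proof -
      have "B x (P y) = 0" using x P that by blast
      then show ?thesis using x by (simp add: P_def bilin perp2_def)
    qed
    then show "x = 0" using x assms(1) by (auto simp: perp2_def nondeg_def)
  qed
  have q: "q \<notin> vec.span ?S"
    using sub h by (auto simp: perp2_def vec.span_eq_iff[THEN iffD2])
  have p: "p \<notin> vec.span (insert q ?S)"
  proof
    assume "p \<in> vec.span (insert q ?S)"
    then obtain k where "p - k *s q \<in> ?S"
      using sub by (auto simp: vec.span_insert vec.span_eq_iff[THEN iffD2])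
    then show False using h by (simp add: perp2_def bilin)
  qed
  have eq: "vec.span (insert p (insert q ?S)) = S"
  proof (intro equalityI subsetI)
    fix x assume "x \<in> vec.span (insert p (insert q ?S))"
    moreover have "vec.span (insert p (insert q ?S)) \<subseteq> S"
      using assms S by (intro vec.span_minimal) (auto simp: perp2_def)
    ultimately show "x \<in> S" by blast
  next
    fix x assume "x \<in> S"
    then have "P x \<in> vec.span (insert p (insert q ?S))" using P by (simp add: vec.span_base)
    then have "P x + B x q *s p + B x p *s q \<in> vec.span (insert p (insert q ?S))"
      by (intro vec.span_add vec.span_scale) (auto intro: vec.span_base)
    then show "x \<in> vec.span (insert p (insert q ?S))" by (simp add: P_def)
  qed
  have "vec.dim S = vec.dim (insert p (insert q ?S))"
    using eq by (metis vec.dim_span)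
  also have "\<dots> = vec.dim ?S + 2"
    using p q by (simp add: vec.dim_insert)
  finally show "vec.dim S = vec.dim ?S + 2" .
qed

text \<open>An isotropic vector exists because the field is algebraically closed: for orthogonal
  non-isotropic \<open>x\<close> and \<open>u\<close>, solve \<open>B x x + c^2 B u u = 0\<close>
  for \<open>c\<close> and take \<open>x + c u\<close>. Then \<open>nondeg_partner\<close> completes
  the pair.\<close>

lemma nondeg_hyp_exists:
  assumes "nondeg S" "vec.dim S \<ge> 2"
  obtains p q where "p \<in> S" "q \<in> S" "hyp p q"
proof -
  have S: "vec.subspace S" using assms by (simp add: nondeg_def)
  have "\<exists>p\<in>S. p \<noteq> 0 \<and> B p p = 0"
  proof -
    have "vec.dim S \<noteq> 0" using assms(2) by linarith
    then have "\<not> S \<subseteq> {0}" using vec.dim_eq_0[of S] by simp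
    then obtain x where x: "x \<in> S" "x \<noteq> 0" by blast
    show ?thesis
    proof (cases "B x x = 0")
      case False
      have "\<not> S \<subseteq> vec.span {x}"
      proof
        assume "S \<subseteq> vec.span {x}"
        then have "vec.dim S \<le> card {x}" by (intro vec.dim_le_card) auto
        then show False using assms(2) by simp
      qed
      then obtain y where y: "y \<in> S" "y \<notin> vec.span {x}" by blast
      define u where "u = y - (B x y / B x x) *s x"
      have u: "u \<in> S" using x y S by (auto simp: u_def intro!: vec.subspace_diff vec.subspace_scale)
      have xu: "B x u = 0" using False by (simp add: u_def bilin)
      have u0: "u \<noteq> 0"
        using y vec.span_scale[OF vec.span_base[of x "{x}"]]
        by (metis eq_iff_diff_eq_0 insertI1 u_def)
      show ?thesis
      proof (cases "B u u = 0")
        case True then show ?thesis using u u0 by blast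
      next
        case False2: False
        define c where "c = csqrt (- B x x / B u u)"
        have c: "c * c = - B x x / B u u" by (metis c_def power2_csqrt power2_eq_square)
        let ?p = "x + c *s u"
        have "B ?p ?p = B x x + (c * c) * B u u" using xu by (simp add: bilin B_sym[of u x])
        then have "B ?p ?p = 0" using c False2 by simp
        moreover have "?p \<in> S" using x u S by (auto intro!: vec.subspace_add vec.subspace_scale)
        moreover have "?p \<noteq> 0"
        proof
          assume "?p = 0"
          then have "B x ?p = 0" by (simp add: bilin)
          then show False using xu False by (simp add: bilin)
        qed
        ultimately show ?thesis by blast
      qed
    qed (use x in blast)
  qed
  then obtain p where p: "p \<in> S" "p \<noteq> 0" "B p p = 0" by blast
  then show ?thesis using nondeg_partner[OF assms(1)] that by metis
qed

lemma dim_UNIV_6: "vec.dim (UNIV :: (complex^'n) set) = 6"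
  using vec_dim_card card_n by metis

text \<open>Three mutually orthogonal hyperbolic pairs, nested in the way in which
  \<open>nondeg_perp2\<close> counts dimensions. The last two pairs span the complement of
  \<open>z\<close> and \<open>v\<close>.\<close>

definition hbasis where
  "hbasis z v p q r s \<longleftrightarrow> hyp z v \<and> hyp p q \<and> hyp r s
    \<and> p \<in> perp2 UNIV z v \<and> q \<in> perp2 UNIV z v
    \<and> r \<in> perp2 (perp2 UNIV z v) p q \<and> s \<in> perp2 (perp2 UNIV z v) p q"

lemma hbasis_values:
  assumes "hbasis z v p q r s"
  shows "B z z = 0" "B z v = 1" "B z p = 0" "B z q = 0" "B z r = 0" "B z s = 0"
    "B v z = 1" "B v v = 0" "B v p = 0" "B v q = 0" "B v r = 0" "B v s = 0"
    "B p z = 0" "B p v = 0" "B p p = 0" "B p q = 1" "B p r = 0" "B p s = 0"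
    "B q z = 0" "B q v = 0" "B q p = 1" "B q q = 0" "B q r = 0" "B q s = 0"
    "B r z = 0" "B r v = 0" "B r p = 0" "B r q = 0" "B r r = 0" "B r s = 1"
    "B s z = 0" "B s v = 0" "B s p = 0" "B s q = 0" "B s r = 1" "B s s = 0"
  using assms by (simp_all add: hbasis_def hyp_def perp2_def B_sym)

lemma hbasis_extend1:
  assumes "hyp z v" "hyp p q" "p \<in> perp2 UNIV z v" "q \<in> perp2 UNIV z v"
  obtains r s where "hbasis z v p q r s"
proof -
  note 1 = nondeg_perp2[OF nondeg_UNIV UNIV_I UNIV_I assms(1)]
  note 2 = nondeg_perp2[OF 1(1) assms(3,4,2)]
  have "vec.dim (perp2 (perp2 UNIV z v) p q) \<ge> 2"
    using 1(2) 2(2) dim_UNIV_6 by linarith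
  then show ?thesis using nondeg_hyp_exists[OF 2(1)] assms that unfolding hbasis_def by metis
qed

lemma hbasis_extend2:
  assumes "hyp z v"
  obtains p q r s where "hbasis z v p q r s"
proof -
  note 1 = nondeg_perp2[OF nondeg_UNIV UNIV_I UNIV_I assms(1)]
  have "vec.dim (perp2 UNIV z v) \<ge> 2"
    using 1(2) dim_UNIV_6 by linarith
  then show ?thesis using nondeg_hyp_exists[OF 1(1)] assms that hbasis_extend1 by metis
qed

text \<open>The complement of the three planes has dimension 6 - 2 - 2 - 2 = 0. Through this fact
  every identity between vectors is checked as six scalar identities.\<close>

lemma hbasis_orthogonal_eq_0:
  assumes "hbasis z v p q r s" "B x z = 0" "B x v = 0" "B x p = 0" "B x q = 0" "B x r = 0" "B x s = 0"
  shows "x = 0"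
proof -
  note h = assms(1)[unfolded hbasis_def]
  note 1 = nondeg_perp2[OF nondeg_UNIV UNIV_I UNIV_I, of z v]
  note 2 = nondeg_perp2[OF 1(1), of p q]
  note 3 = nondeg_perp2[OF 2(1), of r s]
  let ?S = "perp2 (perp2 (perp2 UNIV z v) p q) r s"
  have "vec.dim ?S = 0" using 1(2) 2(2) 3(2) h dim_UNIV_6 by simp
  then have "?S \<subseteq> {0}" using vec.dim_eq_0 by blast
  moreover have "x \<in> ?S" using assms by (simp add: perp2_def)
  ultimately show ?thesis by blast
qed

lemma hbasis_eqI:
  assumes "hbasis z v p q r s" "B x z = B y z" "B x v = B y v" "B x p = B y p" "B x q = B y q"
    "B x r = B y r" "B x s = B y s"
  shows "x = y"
  using hbasis_orthogonal_eq_0[OF assms(1), of "x - y"] assms(2-) by (simp add: bilin)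

text \<open>\<open>ad x\<close> is skew for \<open>B\<close>, so the pairings of
  \<open>br x y\<close> with the basis are, up to sign, pairings of \<open>y\<close> with the six
  vanishing brackets.\<close>

lemma hbasis_centralI:
  assumes "hbasis z v p q r s" "br x z = 0" "br x v = 0" "br x p = 0" "br x q = 0" "br x r = 0" "br x s = 0"
  shows "central x"
  unfolding central_def
proof
  fix y
  show "br x y = 0"
    by (rule hbasis_orthogonal_eq_0[OF assms(1)]) (simp_all add: B_br_skew assms bilin)
qed

end

section \<open>Realizing the bracket tables; center of dimension at least two\<close>

definition even_gens :: "gen set" where
  "even_gens = {Z1, Z2, Z3, X1, X2, X3}"

context quadratic_lie
begin

definition realizes :: "(gen \<times> gen \<times> vec8) list \<Rightarrow> (gen \<Rightarrow> complex^'n) \<Rightarrow> bool" where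
  "realizes L e \<longleftrightarrow> (\<forall>i\<in>even_gens. \<forall>j\<in>even_gens.
     B (e i) (e j) = std_form (bv i) (bv j) \<and>
     br (e i) (e j) = (\<Sum>k\<in>even_gens. table_brk L (bv i) (bv j) $ k *s e k))"

lemma triple_perms:
  assumes "B (br x y) w = c"
  shows "B (br x y) w = c" "B (br y w) x = c" "B (br w x) y = c"
    "B (br y x) w = - c" "B (br w y) x = - c" "B (br x w) y = - c"
  using assms triple_cycle[of x y w] triple_cycle[of y w x]
    triple_swap[of y x w] triple_swap[of w y x] triple_swap[of x w y] by auto

lemma triple_central: "central z \<Longrightarrow> B (br x y) z = 0"
  by (metis B_br_skew B_zero(1) add.inverse_neutral central_right B_zero(2))

lemma realizes_table61:
  assumes hb: "hbasis z v k k' p q"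
    and br: "br v k' = x *s p" "br k' q = x *s z" "br q v = x *s k"
    and c: "central z" "central k" "central p" and x: "x \<noteq> 0"
  shows "\<exists>e. realizes table61 e \<and> e Z3 = z"
proof -
  \<comment> \<open>The factors \<open>- x\<close> and \<open>- 1/x\<close> keep \<open>p\<close>
    and \<open>q\<close> dual to each other while absorbing the sign and the scalar in the three
    brackets.\<close>
  define e where "e = (\<lambda>i. case i of Z1 \<Rightarrow> - (x *s p) | Z2 \<Rightarrow> k | Z3 \<Rightarrow> z | X1 \<Rightarrow> - ((1/x) *s q) | X2 \<Rightarrow> k' | X3 \<Rightarrow> v | _ \<Rightarrow> 0)"
  have br': "br k' v = - (x *s p)" "br q k' = - (x *s z)" "br v q = - (x *s k)"
    using br br_skew by metis+
  have c': "br z w = 0" "br k w = 0" "br p w = 0" "br w z = 0" "br w k = 0" "br w p = 0" for w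
    using c central_right by (simp_all add: central_def)
  show ?thesis
    using x
    by (intro exI[of _ e])
      (simp add: e_def realizes_def even_gens_def table61_def table_brk_def std_form_def axis_def
        br br' c' br_self bilin hbasis_values[OF hb])
qed

text \<open>The second conclusion, two-step nilpotency, serves in
  \<open>quadratic_lie_dim6_eigenvector\<close>: it is incompatible with an \<open>ad v\<close>
  having a nonzero eigenvalue.\<close>

lemma two_dim_center:
  assumes z: "central z" "z \<noteq> 0" and k: "central k" "\<And>c. k \<noteq> c *s z"
  shows "\<exists>e. realizes table61 e \<and> e Z3 = z" "central (br x' y')"
proof -
  obtain v where zv: "hyp z v"
    using nondeg_partner[OF nondeg_UNIV] z central_orthogonal by blast
  \<comment> \<open>The correction makes the second central vector orthogonal to \<open>v\<close>,
    so that it lies in the complement of the pair \<open>z\<close>, \<open>v\<close>.\<close>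
  define k1 where "k1 = k - B k v *s z"
  have ck1: "central k1" using k z by (simp add: k1_def central_def bilin)
  have k10: "k1 \<noteq> 0" using k(2) by (auto simp: k1_def)
  have "k1 \<in> perp2 UNIV z v"
    using zv ck1 z central_orthogonal[of k1 z] by (auto simp: perp2_def hyp_def k1_def bilin)
  then obtain k' where k': "k' \<in> perp2 UNIV z v" "hyp k1 k'" and k1p: "k1 \<in> perp2 UNIV z v"
    using nondeg_partner[OF nondeg_perp2(1)[OF nondeg_UNIV UNIV_I UNIV_I zv]] k10 ck1 central_orthogonal
    by metis
  obtain p0 q0 where hb0: "hbasis z v k1 k' p0 q0"
    using hbasis_extend1[OF zv k'(2) k1p k'(1)] by blast
  have key: "B (br k' p) q = 0 \<and> B (br v p) q = 0 \<and> B (br v k') q * B (br v k') p = 0 \<and> (B (br v k') q \<noteq> 0 \<or> B (br v k') p \<noteq> 0)"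
    if hb: "hbasis z v k1 k' p q" for p q
  proof -
    obtain t s x y where tsxy: "B (br k' p) q = t" "B (br v p) q = s" "B (br v k') q = x" "B (br v k') p = y" by blast
    note T = triple_perms[OF tsxy(1)] triple_perms[OF tsxy(2)] triple_perms[OF tsxy(3)] triple_perms[OF tsxy(4)]
    note C = triple_central[OF z(1)] triple_central[OF ck1] central_right[OF z(1)] central_right[OF ck1]
      z(1)[unfolded central_def, rule_format] ck1[unfolded central_def, rule_format]
    \<comment> \<open>An alternating 3-form on the span of \<open>v\<close>, \<open>k'\<close>,
      \<open>p\<close>, \<open>q\<close> is a volume form contracted with a vector; \<open>u\<close>
      is this vector and is therefore central. Its pairings with the central \<open>z\<close> and
      \<open>k1\<close> give \<open>t = s = 0\<close>, and then \<open>B u u = - 2 x y\<close> gives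
      \<open>x y = 0\<close>.\<close>
    define u where "u = t *s v - s *s k' + x *s p - y *s q"
    have cu: "central u"
      by (rule hbasis_centralI[OF hb]; rule hbasis_orthogonal_eq_0[OF hb];
          simp add: u_def bilin T C triple_repeat hbasis_values[OF hb])
    have "B u z = 0" "B u k1 = 0" "B u u = 0"
      using cu z ck1 central_orthogonal by auto
    then have ts: "t = 0" "s = 0" and xy: "x * y = 0"
      by (auto simp: u_def bilin hbasis_values[OF hb])
    moreover have "x \<noteq> 0 \<or> y \<noteq> 0"
    proof (rule ccontr)
      assume "\<not> (x \<noteq> 0 \<or> y \<noteq> 0)"
      then have 0: "x = 0" "y = 0" by auto
      have "central v"
        by (rule hbasis_centralI[OF hb]; rule hbasis_orthogonal_eq_0[OF hb];
            simp add: bilin T C ts 0 triple_repeat hbasis_values[OF hb])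
      then show False using central_orthogonal[OF z(1), of v] hbasis_values(2)[OF hb] by simp
    qed
    ultimately show ?thesis using tsxy by auto
  qed
  \<comment> \<open>Exchanging \<open>p0\<close> and \<open>q0\<close> exchanges the two values of
    which exactly one is zero, so the vanishing one may be attached to \<open>p\<close>. Then
    \<open>u\<close> is a multiple of \<open>p\<close>, and \<open>p\<close> becomes a third central
    vector.\<close>
  have swap: "hbasis z v k1 k' q0 p0" using hb0 by (auto simp: hbasis_def hyp_def)
  obtain p q where hb: "hbasis z v k1 k' p q" and y0: "B (br v k') p = 0" and x0: "B (br v k') q \<noteq> 0"
    using key[OF hb0] key[OF swap] hb0 swap by (metis mult_eq_0_iff)
  define x where "x = B (br v k') q"
  have tsx: "B (br k' p) q = 0" "B (br v p) q = 0" "B (br v k') q = x"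
    using key[OF hb] by (auto simp: x_def)
  note T = triple_perms[OF tsx(1)] triple_perms[OF tsx(2)] triple_perms[OF tsx(3)] triple_perms[OF y0]
  note C = triple_central[OF z(1)] triple_central[OF ck1] central_right[OF z(1)] central_right[OF ck1]
    z(1)[unfolded central_def, rule_format] ck1[unfolded central_def, rule_format]
  have cp: "central p"
    by (rule hbasis_centralI[OF hb]; rule hbasis_orthogonal_eq_0[OF hb];
        simp add: bilin T C triple_repeat hbasis_values[OF hb])
  have "br v k' = x *s p" "br k' q = x *s z" "br q v = x *s k1"
    by (rule hbasis_eqI[OF hb]; simp add: bilin T C triple_repeat hbasis_values[OF hb])+
  then show "\<exists>e. realizes table61 e \<and> e Z3 = z"
    using realizes_table61[OF hb] z(1) ck1 cp x0 by (simp add: x_def)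
  have "br x y = B (br x y) v *s z + B (br x y) k' *s k1 + B (br x y) q *s p" for x y
    by (rule hbasis_eqI[OF hb]) (simp_all add: bilin hbasis_values[OF hb] triple_central z(1) ck1 cp)
  moreover have "central (c1 *s z + c2 *s k1 + c3 *s p)" for c1 c2 c3
    using z(1) ck1 cp by (simp add: central_def bilin)
  ultimately show "central (br x' y')" by metis
qed

text \<open>The alternating form \<open>B [x, y] w\<close> on the four-dimensional space orthogonal to \<open>z\<close> and \<open>v\<close>
  is the contraction of a volume form with a vector \<open>k\<close>. As \<open>ad v\<close> is a derivation of trace zero,
  it annihilates \<open>k\<close>, which is therefore central.\<close>

lemma center_dim1_triple_zero:
  assumes z: "central z" and Z: "\<forall>k. central k \<longrightarrow> (\<exists>c. k = c *s z)"
    and hb: "hbasis z v p q r s"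
  shows "B (br r q) s = 0" "B (br p q) s = 0" "B (br p r) s = 0" "B (br p r) q = 0"
proof -
  obtain j1 j2 j3 j4 where j: "B (br r q) s = j1" "B (br p q) s = j2" "B (br p r) s = j3" "B (br p r) q = j4" by blast
  note H = hbasis_values[OF hb]
  note J = triple_perms[OF j(1)] triple_perms[OF j(2)] triple_perms[OF j(3)] triple_perms[OF j(4)]
  note C = triple_central[OF z(1)] central_right[OF z(1)] z(1)[unfolded central_def, rule_format]
  obtain a11 a12 a21 a22 c d where a: "B (br v p) q = a11" "B (br v p) s = a12" "B (br v p) r = c"
    "B (br v r) q = a21" "B (br v r) s = a22" "B (br v q) s = d" by blast
  note A = triple_perms[OF a(1)] triple_perms[OF a(2)] triple_perms[OF a(3)] triple_perms[OF a(4)]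
    triple_perms[OF a(5)] triple_perms[OF a(6)]
  have Av: "br v p = a11 *s p + a12 *s r + c *s s" "br v r = a21 *s p + a22 *s r - c *s q"
    "br v q = - (a11 *s q) - a21 *s s + d *s r" "br v s = - (a12 *s q) - a22 *s s - d *s p"
    by (rule hbasis_eqI[OF hb]; simp add: bilin A C H triple_repeat)+
  \<comment> \<open>One instance for each triple of basis vectors of W: together they say that the
    derivation \<open>ad v\<close> annihilates the restricted 3-form, which in coordinates is
    \<open>br v k = 0\<close>.\<close>
  note D = triple_derivation[of v r q s] triple_derivation[of v p q s] triple_derivation[of v p r s]
    triple_derivation[of v p r q]
  define k where "k = j1 *s p - j2 *s r + j3 *s q - j4 *s s"
  have Ak: "br v k = 0"
    using D
    by (intro hbasis_orthogonal_eq_0[OF hb])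
      (simp_all add: k_def Av bilin J A C H triple_repeat algebra_simps)
  have "br k v = 0" using Ak br_skew[of k v] by simp
  moreover have kv: "B (br k x) v = 0" for x
    using triple_cycle[of k x v] triple_cycle[of x v k] Ak \<open>br k v = 0\<close> triple_swap[of v k x] triple_swap[of x k v]
    by (metis B_zero(1) triple_cycle)
  moreover have "br k e = 0" if "e \<in> {z, p, q, r, s}" for e
    by (rule hbasis_orthogonal_eq_0[OF hb]; (rule kv | use that in \<open>auto simp: k_def bilin J C H triple_repeat\<close>))
  ultimately have "central k"
    by (intro hbasis_centralI[OF hb]) auto
  then obtain e where "k = e *s z" using Z by blast
  \<comment> \<open>\<open>z\<close> is orthogonal to the last four basis vectors, while the
    pairings of \<open>k\<close> with them are, up to sign, its coefficients \<open>j1\<close>, ...,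
    \<open>j4\<close>.\<close>
  then have "B k q = 0" "B k s = 0" "B k p = 0" "B k r = 0" by (simp_all add: bilin H)
  then show "B (br r q) s = 0" "B (br p q) s = 0" "B (br p r) s = 0" "B (br p r) q = 0"
    by (simp_all add: k_def bilin H j)
qed

end

section \<open>Eigenvectors in an invariant subspace\<close>

definition poly_apply :: "('a::comm_ring_1^'n \<Rightarrow> 'a^'n) \<Rightarrow> 'a poly \<Rightarrow> 'a^'n \<Rightarrow> 'a^'n" where
  "poly_apply f p x = fold_coeffs (\<lambda>a y. a *s x + f y) p 0"

lemma poly_apply_pCons:
  assumes "f 0 = 0"
  shows "poly_apply f (pCons a p) x = a *s x + f (poly_apply f p x)"
  using assms by (cases "p = 0 \<and> a = 0") (auto simp: poly_apply_def fun_eq_iff)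

lemma poly_apply_add:
  assumes f: "f 0 = 0" "\<And>x y. f (x + y) = f x + f y"
  shows "poly_apply f (p + q) x = poly_apply f p x + poly_apply f q x"
proof (induction p q rule: poly_induct2)
  case 0 then show ?case by (simp add: poly_apply_def)
next
  case (pCons a p b q)
  then show ?case using f by (simp add: poly_apply_pCons vec.scale_left_distrib)
qed

lemma poly_apply_smult:
  assumes f: "f 0 = 0" "\<And>c x. f (c *s x) = c *s f x"
  shows "poly_apply f (smult c p) x = c *s poly_apply f p x"
proof (induction p)
  case 0 then show ?case by (simp add: poly_apply_def)
next
  case (pCons a p)
  then show ?case using f by (simp add: poly_apply_pCons vec.scale_right_distrib)
qed

lemma poly_apply_monom:
  assumes f: "f 0 = 0" "\<And>c x. f (c *s x) = c *s f x"
  shows "poly_apply f (monom c k) x = c *s (f ^^ k) x"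
proof (induction k)
  case 0 then show ?case using f by (simp add: monom_0 poly_apply_pCons) (simp add: poly_apply_def f)
next
  case (Suc k) then show ?case using f by (simp add: monom_Suc poly_apply_pCons)
qed

text \<open>Take a nonzero polynomial \<open>p\<close> of least degree with
  \<open>p(f) x0 = 0\<close>, and a root \<open>c\<close> of it. If \<open>p = (X - c) q\<close>,
  then \<open>q(f) x0\<close> is nonzero by minimality, is killed by \<open>f - c\<close>, and lies
  in \<open>S\<close> because \<open>S\<close> is invariant.\<close>

lemma invariant_subspace_eigenvector:
  fixes f :: "complex^'n \<Rightarrow> complex^'n"
  assumes lin: "Vector_Spaces.linear (*s) (*s) f"
    and S: "vec.subspace S" "\<And>x. x \<in> S \<Longrightarrow> f x \<in> S" "x0 \<in> S" "x0 \<noteq> 0"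
  obtains c x where "x \<in> S" "x \<noteq> 0" "f x = c *s x"
proof -
  interpret f: Vector_Spaces.linear "(*s)" "(*s)" f by fact
  note f0 = f.zero and fa = f.add and fs = f.scale
  have inS: "poly_apply f p x0 \<in> S" for p
  proof (induction p)
    case 0 then show ?case using S(1) by (simp add: poly_apply_def vec.subspace_0)
  next
    case (pCons a p)
    then show ?case using S f0 by (simp add: poly_apply_pCons vec.subspace_add vec.subspace_scale)
  qed
  have "\<exists>p. p \<noteq> 0 \<and> poly_apply f p x0 = 0"
  \<comment> \<open>Linear dependence is a property of sets, so coinciding iterates need a case of
    their own; there a difference of two monomials annihilates \<open>x0\<close>. Distinct iterates
    are more vectors than the dimension allows.\<close>
  proof (cases "inj_on (\<lambda>k. (f ^^ k) x0) {..CARD('n)}")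
    case False
    then obtain i j where ij: "i \<noteq> j" "(f ^^ i) x0 = (f ^^ j) x0" by (auto simp: inj_on_def)
    let ?p = "monom 1 i + monom (-1) j :: complex poly"
    have "coeff ?p i \<noteq> 0" using ij by simp
    then have "?p \<noteq> 0" by fastforce
    moreover have "poly_apply f ?p x0 = 0"
      using ij f0 fa fs by (simp add: poly_apply_add poly_apply_monom)
    ultimately show ?thesis by blast
  next
    case True
    let ?g = "\<lambda>k. (f ^^ k) x0" and ?T = "(\<lambda>k. (f ^^ k) x0) ` {..CARD('n)}"
    have "card ?T = Suc (CARD('n))" using True by (simp add: card_image)
    moreover have "vec.dim ?T \<le> CARD('n)"
      using vec.dim_subset_UNIV[of ?T] by (metis vec.dim_UNIV vec.dimension_def vec_dim_card)
    ultimately have "vec.dependent ?T"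
      using vec.dim_eq_card_independent[of ?T] by fastforce
    then obtain u where u: "\<exists>v\<in>?T. u v \<noteq> 0" "(\<Sum>v\<in>?T. u v *s v) = 0"
      by (auto simp: vec.dependent_finite)
    define p where "p = (\<Sum>k\<le>CARD('n). monom (u (?g k)) k)"
    have pa: "poly_apply f (\<Sum>k\<in>K. monom (u (?g k)) k) x0 = (\<Sum>k\<in>K. u (?g k) *s ?g k)"
      if "finite K" for K
      using that
    proof (induction K)
      case empty then show ?case by (simp add: poly_apply_def)
    next
      case (insert k K) then show ?case using f0 fa fs by (simp add: poly_apply_add poly_apply_monom)
    qed
    have "poly_apply f p x0 = 0"
      using u(2) True by (simp add: p_def pa sum.reindex)
    moreover obtain k where k: "k \<le> CARD('n)" "u (?g k) \<noteq> 0" using u(1) by auto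
    have "coeff p k = u (?g k)"
      using k(1) by (simp add: p_def coeff_sum)
    then have "p \<noteq> 0" using k by auto
    ultimately show ?thesis by blast
  qed
  then obtain p where p: "p \<noteq> 0" "poly_apply f p x0 = 0"
    and min: "\<And>q. q \<noteq> 0 \<Longrightarrow> poly_apply f q x0 = 0 \<Longrightarrow> degree p \<le> degree q"
    using ex_has_least_nat[of "\<lambda>p. p \<noteq> 0 \<and> poly_apply f p x0 = 0" _ degree] by blast
  have "degree p \<noteq> 0"
  proof
    assume "degree p = 0"
    then obtain a where "p = [:a:]" by (rule degree_eq_zeroE)
    then show False using p S(4) f0 by (auto simp: poly_apply_pCons) (auto simp: poly_apply_def f0)
  qed
  then have "\<not> constant (poly p)" by (simp add: constant_degree)
  then obtain c where "poly p c = 0" using fundamental_theorem_of_algebra by blast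
  then obtain q where q: "p = [:- c, 1:] * q" by (metis dvdE poly_eq_0_iff_dvd)
  have q0: "q \<noteq> 0" using p q by auto
  have "degree p = degree [:- c, 1:] + degree q"
    unfolding q by (rule degree_mult_eq) (use q0 in auto)
  then have "degree q < degree p" by simp
  then have y: "poly_apply f q x0 \<noteq> 0" using min[OF q0] by force
  have "p = pCons 0 q + smult (- c) q" using q by simp
  then have "f (poly_apply f q x0) + (- c) *s poly_apply f q x0 = 0"
    using p(2)
    by (simp only: poly_apply_add[of f, OF f0 fa] poly_apply_smult[of f, OF f0 fs] poly_apply_pCons[of f, OF f0]
        vec.scale_zero_left add_0_left)
  then have "f (poly_apply f q x0) = c *s poly_apply f q x0" by simp
  then show ?thesis using that inS y by blast
qed

section \<open>Center of dimension one\<close>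

context quadratic_lie
begin

lemma linear_br: "Vector_Spaces.linear (*s) (*s) (br v)"
  by unfold_locales (simp_all add: bilin)

text \<open>By \<open>center_dim1_triple_zero\<close> the bracket is orthogonal to \<open>z\<close>
  and to all of W, hence a multiple of \<open>z\<close>. The coefficient is its pairing with
  \<open>v\<close>, rewritten by cyclic symmetry.\<close>

lemma center_dim1_bracket:
  assumes z: "central z" and Z: "\<forall>k. central k \<longrightarrow> (\<exists>c. k = c *s z)"
    and zv: "hyp z v" and x: "x \<in> perp2 UNIV z v" and y: "y \<in> perp2 UNIV z v"
  shows "br x y = B (br v x) y *s z"
proof -
  obtain p q r s where hb: "hbasis z v p q r s" using hbasis_extend2[OF zv] .
  note H = hbasis_values[OF hb]
  note J0 = center_dim1_triple_zero[OF z Z hb]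
  note J = triple_perms[OF J0(1)] triple_perms[OF J0(2)] triple_perms[OF J0(3)] triple_perms[OF J0(4)]
  have ex: "u = B u q *s p + B u p *s q + B u s *s r + B u r *s s" if "u \<in> perp2 UNIV z v" for u
    by (rule hbasis_eqI[OF hb]) (use that in \<open>simp_all add: perp2_def bilin H\<close>)
  have J': "B (br a b) c = 0" if "a \<in> {p, q, r, s}" "b \<in> {p, q, r, s}" "c \<in> {p, q, r, s}" for a b c
    using that by (elim insertE emptyE; simp add: J triple_repeat)
  have "B (br x y) c = 0" if "c \<in> {p, q, r, s}" for c
    by (subst ex[OF x], subst ex[OF y]) (use that in \<open>simp add: bilin J'\<close>)
  then show ?thesis
    by (intro hbasis_eqI[OF hb])
      (simp_all add: bilin H triple_central[OF z] triple_cycle[of x y v] triple_cycle[of v x y])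
qed

lemma center_dim1_normalize:
  assumes z: "central z" "z \<noteq> 0" and Z: "\<forall>k. central k \<longrightarrow> (\<exists>c. k = c *s z)"
  obtains c v q where "c \<noteq> 0" "hyp (c *s z) v" "q \<noteq> 0" "br v q = - q"
proof -
  obtain v where zv: "hyp z v"
    using nondeg_partner[OF nondeg_UNIV] z central_orthogonal by blast
  obtain p q r s where hb: "hbasis z v p q r s" using hbasis_extend2[OF zv] .
  let ?W = "perp2 UNIV z v"
  have "vec.subspace ?W" by (auto simp: vec.subspace_def perp2_def bilin)
  moreover have inv: "\<And>x. x \<in> ?W \<Longrightarrow> br v x \<in> ?W"
    by (simp add: perp2_def triple_central[OF z(1)] triple_repeat)
  moreover have "p \<in> ?W" using hb by (simp add: hbasis_def)
  moreover have "p \<noteq> 0" using hbasis_values(16)[OF hb] by (auto simp: bilin)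
  ultimately obtain c w where w: "w \<in> ?W" "w \<noteq> 0" "br v w = c *s w"
    by (rule invariant_subspace_eigenvector[OF linear_br])
  \<comment> \<open>An eigenvector for 0 would commute with W by \<open>center_dim1_bracket\<close>
    and also with \<open>v\<close> and \<open>z\<close>. It would then be a multiple of
    \<open>z\<close> orthogonal to \<open>v\<close>, hence 0.\<close>
  have "c \<noteq> 0"
  proof
    assume "c = 0"
    then have vw: "br v w = 0" using w by simp
    then have "br w v = 0" using br_skew[of w v] by simp
    moreover have "br w x = 0" if "x \<in> ?W" for x
      using center_dim1_bracket[OF z(1) Z zv w(1) that] by (simp add: vw bilin)
    moreover have "br w z = 0" using central_right z by blast
    ultimately have "central w" using hb by (intro hbasis_centralI[OF hb]) (auto simp: hbasis_def perp2_def)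
    then obtain e where e: "w = e *s z" using Z by blast
    then have "B w v = e" using zv by (simp add: bilin hyp_def)
    then show False using w e by (simp add: perp2_def)
  qed
  \<comment> \<open>Scaling the two vectors by \<open>- c\<close> and \<open>- 1/c\<close> keeps the
    pair hyperbolic and turns the eigenvalue \<open>c\<close> into -1.\<close>
  show ?thesis
  proof (rule that[of "- c" "- (1/c) *s v" w])
    show "hyp (- c *s z) (- (1 / c) *s v)" using zv \<open>c \<noteq> 0\<close> by (simp add: hyp_def bilin)
    show "br (- (1 / c) *s v) w = - w" using w \<open>c \<noteq> 0\<close> by (simp add: bilin)
  qed (use \<open>c \<noteq> 0\<close> w in auto)
qed


text \<open>Since \<open>ad v\<close> is skew, \<open>-1\<close> being an eigenvalue forces \<open>1\<close> to be one. The two alternatives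
  below arise according to whether some eigenvector for \<open>1\<close> pairs nontrivially with \<open>q\<close>.\<close>

lemma center_dim1_classification:
  assumes z: "central z" and Z: "\<forall>k. central k \<longrightarrow> (\<exists>c. k = c *s z)"
    and zv: "hyp z v" and q: "q \<noteq> 0" "br v q = - q"
  shows "(\<exists>l e. l \<noteq> 0 \<and> realizes (table62 l) e \<and> e Z3 = z \<and> e X3 = v \<and> e X1 = q) \<or>
    (\<exists>e. realizes table63 e \<and> e Z3 = z \<and> e X3 = v \<and> e X2 = q)"
proof -
  let ?W = "perp2 UNIV z v"
  have nW: "nondeg ?W" by (rule nondeg_perp2(1)[OF nondeg_UNIV UNIV_I UNIV_I zv])
  \<comment> \<open>\<open>br v x\<close> is orthogonal to \<open>z\<close>, \<open>v\<close> and
    \<open>x\<close>; dividing by the eigenvalue transfers this to \<open>x\<close>.\<close>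
  have eig: "x \<in> ?W \<and> B x x = 0" if "br v x = c *s x" "c \<noteq> 0" for c x
  proof -
    have "B (br v x) z = 0" "B (br v x) v = 0" "B (br v x) x = 0"
      by (simp_all add: triple_central[OF z(1)] triple_repeat)
    then show ?thesis using that by (simp add: perp2_def bilin)
  qed
  have qW: "q \<in> ?W" and qq: "B q q = 0" using eig[of q "-1"] q by auto
  note C = central_right[OF z] z[unfolded central_def, rule_format]
  note brW = center_dim1_bracket[OF z Z zv]
  \<comment> \<open>A vector of W killed by \<open>ad v\<close> commutes with W by
    \<open>brW\<close>, so it is central, and a multiple of \<open>z\<close> orthogonal to
    \<open>v\<close> vanishes.\<close>
  have kerW: "x = 0" if x: "x \<in> ?W" "br v x = 0" for x
  proof -
    obtain p q r s where hb: "hbasis z v p q r s" using hbasis_extend2[OF zv] .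
    have "br x v = 0" using x br_skew[of x v] by simp
    moreover have "br x y = 0" if "y \<in> ?W" for y
      using brW[OF x(1) that] by (simp add: x bilin)
    ultimately have "central x" using hb by (intro hbasis_centralI[OF hb]) (auto simp: hbasis_def perp2_def C)
    then obtain e where e: "x = e *s z" using Z by blast
    then have "B x v = e" using zv by (simp add: bilin hyp_def)
    then show ?thesis using x e by (simp add: perp2_def)
  qed
  have "\<exists>p. p \<noteq> 0 \<and> br v p = p"
  proof (rule ccontr)
    assume no: "\<not> ?thesis"
    let ?f = "\<lambda>x. br v x - x"
    have lf: "Vector_Spaces.linear (*s) (*s) ?f" by unfold_locales (simp_all add: bilin algebra_simps)
    have "inj ?f"
    proof (rule injI)
      fix x y assume "?f x = ?f y"
      then have "br v (x - y) = x - y" by (simp add: bilin algebra_simps)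
      then have "x - y = 0" using no by blast
      then show "x = y" by simp
    qed
    then have "surj ?f" by (rule vec.linear_inj_imp_surj[OF lf])
    \<comment> \<open>By skewness the eigenvector \<open>q\<close> for -1 is orthogonal to the range
      of \<open>ad v - 1\<close>, which would be everything.\<close>
    have "B q y = 0" for y
    proof -
      obtain x where "y = ?f x" using \<open>surj ?f\<close> by blast
      then show ?thesis using B_br_skew[of v q x] q by (simp add: bilin)
    qed
    then show False using q B_nondegenerate by blast
  qed
  then obtain p0 where p0: "p0 \<noteq> 0" "br v p0 = p0" by blast
  show ?thesis
  proof (cases "\<exists>p. br v p = p \<and> B p q \<noteq> 0")
    case True
    then obtain p1 where p1: "br v p1 = p1" "B p1 q \<noteq> 0" by blast
    define p where "p = (1 / B p1 q) *s p1"
    have p: "br v p = p" "B p q = 1" using p1 by (auto simp: p_def bilin)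
    have pW: "p \<in> ?W" and pp: "B p p = 0" using eig[of p 1] p by auto
    have "hyp p q" using p pp qq by (simp add: hyp_def B_sym)
    then obtain r s where hb: "hbasis z v p q r s"
      using hbasis_extend1[OF zv _ pW qW] by blast
    note H = hbasis_values[OF hb]
    have rW: "r \<in> ?W" and sW: "s \<in> ?W" using hb by (auto simp: hbasis_def perp2_def)
    define l where "l = B (br v r) s"
    \<comment> \<open>\<open>ad v\<close> preserves the plane of \<open>p\<close> and
      \<open>q\<close>, hence by skewness also the plane of \<open>r\<close> and \<open>s\<close>. A
      skew operator on a hyperbolic plane is diagonal in the isotropic basis, with opposite
      eigenvalues \<open>l\<close> and \<open>- l\<close>.\<close>
    have pr: "B (br v r) p = 0" "B (br v r) q = 0" "B (br v s) p = 0" "B (br v s) q = 0"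
      by (simp_all add: B_br_skew p q H bilin)
    have "B (br v s) r = - l" using B_br_skew[of v s r] by (simp add: l_def B_sym)
    then have rs: "br v r = l *s r" "br v s = - (l *s s)"
      by (intro hbasis_eqI[OF hb]; simp add: H bilin triple_central[OF z] triple_repeat pr l_def)+
    have l0: "l \<noteq> 0" using kerW[OF rW] rs H(30) by (auto simp: bilin)
    note br = p(1) q(2) rs
    have br': "br p v = - p" "br q v = q" "br r v = - (l *s r)" "br s v = l *s s"
      using br br_skew by (metis minus_minus)+
    have W: "br p q = z" "br p r = 0" "br p s = 0" "br q p = - z" "br q r = 0" "br q s = 0"
      "br r p = 0" "br r q = 0" "br r s = l *s z" "br s p = 0" "br s q = 0" "br s r = - (l *s z)"
      by (simp_all add: brW pW qW rW sW br H bilin)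
    define e where "e = (\<lambda>i. case i of Z1 \<Rightarrow> p | Z2 \<Rightarrow> r | Z3 \<Rightarrow> z | X1 \<Rightarrow> q | X2 \<Rightarrow> s | X3 \<Rightarrow> v | _ \<Rightarrow> 0)"
    have "realizes (table62 l) e"
      by (simp add: e_def realizes_def even_gens_def table62_def table_brk_def std_form_def axis_def
          br br' W C br_self bilin H)
    then show ?thesis using l0 by (intro disjI1 exI[of _ l] exI[of _ e]) (simp add: e_def)
  next
    case False
    then have F: "B p q = 0" if "br v p = p" for p using that by blast
    have pW: "p0 \<in> ?W" and pp: "B p0 p0 = 0" using eig[of p0 1] p0 by auto
    obtain p' where p': "p' \<in> ?W" "hyp p0 p'" using nondeg_partner[OF nW pW p0(1) pp] by blast
    let ?W2 = "perp2 ?W p0 p'"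
    have nW2: "nondeg ?W2" by (rule nondeg_perp2(1)[OF nW pW p'])
    have pq: "B p0 q = 0" "B q p0 = 0" using F[OF p0(2)] by (auto simp: B_sym)
    note h = p'(2)[unfolded hyp_def]
    \<comment> \<open>\<open>q\<close> must stay in the final basis, but it need not be orthogonal
      to \<open>p'\<close>. Its projection \<open>q2\<close> serves to find the partner
      \<open>q'\<close>; afterwards \<open>p'\<close> is corrected to \<open>p''\<close> instead,
      which makes \<open>p0\<close>, \<open>p''\<close> and \<open>q\<close>, \<open>q'\<close>
      orthogonal pairs.\<close>
    define q2 where "q2 = q - B q p' *s p0"
    have q2W: "q2 \<in> ?W2" using qW pW p' pq h by (simp add: q2_def perp2_def bilin)
    have q2q2: "B q2 q2 = 0" using qq pq pp by (simp add: q2_def bilin)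
    have q20: "q2 \<noteq> 0"
    proof
      assume "q2 = 0"
      then have qe: "q = B q p' *s p0" by (simp add: q2_def)
      then have "br v q = q" using p0(2) br_scale2 by metis
      then have "q + q = 0" using q by (metis add.right_inverse)
      then show False using q by (simp add: vec_eq_iff)
    qed
    obtain q' where q': "q' \<in> ?W2" "hyp q2 q'" using nondeg_partner[OF nW2 q2W q20 q2q2] by blast
    define p'' where "p'' = p' - B q p' *s q'"
    have q'p: "B q' p0 = 0" "B p0 q' = 0" "B q' p' = 0" "B p' q' = 0"
      using q'(1) by (auto simp: perp2_def B_sym)
    have qq': "B q q' = 1" "B q' q = 1"
      using q'(2) q'p by (auto simp: q2_def hyp_def bilin B_sym)
    have "hyp p0 p''" using h q'p q'(2) by (simp add: hyp_def p''_def bilin)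
    moreover have "hyp q q'" using qq qq' q'(2) by (simp add: hyp_def)
    moreover have "p'' \<in> ?W" using p' q' by (simp add: perp2_def p''_def bilin)
    moreover have "q' \<in> perp2 ?W p0 p''" using q' q'p by (simp add: perp2_def p''_def bilin hyp_def)
    moreover have "q \<in> perp2 ?W p0 p''" using qW pq qq' by (simp add: perp2_def p''_def bilin B_sym)
    ultimately have hb: "hbasis z v p0 p'' q q'" using zv pW by (simp add: hbasis_def)
    note H = hbasis_values[OF hb]
    define x where "x = B (br v p'') q'"
    have pr: "B (br v p'') p0 = - 1" "B (br v p'') q = 0" "B (br v q') p0 = 0" "B (br v q') q = 1"
      by (simp_all add: B_br_skew p0 q H bilin)
    have prx: "B (br v q') p'' = - x"
      unfolding x_def by (metis B_br_skew B_sym)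
    have rs: "br v p'' = x *s q - p''" "br v q' = q' - x *s p0"
      by (rule hbasis_eqI[OF hb]; simp add: H bilin triple_central[OF z] triple_repeat pr prx x_def[symmetric])+
    \<comment> \<open>With \<open>x = 0\<close> the vector \<open>q'\<close> would be an eigenvector
      for 1 pairing nontrivially with \<open>q\<close>, which this case excludes.\<close>
    have x0: "x \<noteq> 0"
    proof
      assume "x = 0"
      then have "br v q' = q'" using rs by simp
      then show False using F[of q'] qq' by simp
    qed
    have p''W: "p'' \<in> ?W" and q'W: "q' \<in> ?W" using hb by (auto simp: hbasis_def perp2_def)
    note br = p0(2) q(2) rs
    have br': "br p0 v = - p0" "br q v = q" "br p'' v = - (x *s q - p'')" "br q' v = - (q' - x *s p0)"
      using br br_skew by (metis minus_minus)+
    have W: "br p0 p'' = z" "br p0 q = 0" "br p0 q' = 0" "br p'' p0 = - z" "br p'' q = 0" "br p'' q' = x *s z"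
      "br q p0 = 0" "br q p'' = 0" "br q q' = - z" "br q' p0 = 0" "br q' q = z" "br q' p'' = - (x *s z)"
      by (simp_all add: brW pW qW p''W q'W br H bilin)
    \<comment> \<open>Scaling the dual pair \<open>p0\<close>, \<open>p''\<close> by
      \<open>- x\<close> and \<open>- 1/x\<close> normalizes the off-diagonal entry of the Jordan
      blocks to the one in \<open>table63\<close>.\<close>
    define e where "e = (\<lambda>i. case i of Z1 \<Rightarrow> - (x *s p0) | Z2 \<Rightarrow> q' | Z3 \<Rightarrow> z
      | X1 \<Rightarrow> - ((1/x) *s p'') | X2 \<Rightarrow> q | X3 \<Rightarrow> v | _ \<Rightarrow> 0)"
    have "realizes table63 e"
      using x0
      by (simp add: e_def realizes_def even_gens_def table63_def table_brk_def std_form_def axis_def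
          br br' W C br_self bilin H vec.scale_right_diff_distrib)
    then show ?thesis by (intro disjI2 exI[of _ e]) (simp add: e_def)
  qed
qed


section \<open>Duality with respect to \<open>B\<close>, the center and solvability\<close>

lemma B_represents:
  assumes g: "\<And>x y. g (x + y) = g x + g y" "\<And>c x. g (c *s x) = c * g x"
  shows "\<exists>x. \<forall>y. B x y = g y"
proof -
  \<comment> \<open>The coordinates of the functional \<open>B x\<close>. Nondegeneracy makes this
    map injective, so by equality of dimensions every functional is attained.\<close>
  let ?f = "\<lambda>x. (\<chi> i. B x (axis i 1)) :: complex^'n"
  have exp: "y = (\<Sum>i\<in>UNIV. y $ i *s axis i 1)" for y :: "complex^'n"
    by (simp add: vec_eq_iff axis_def if_distrib cong: if_cong)
  have sum: "h y = (\<Sum>i\<in>UNIV. y $ i * h (axis i 1))"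
    if h: "\<And>x y. h (x + y) = h x + h y" "\<And>c x. h (c *s x) = c * h x" for h :: "complex^'n \<Rightarrow> complex" and y
  proof -
    have h0: "h 0 = 0" using h(2)[of 0 0] by simp
    have "h (\<Sum>i\<in>I. y $ i *s axis i 1) = (\<Sum>i\<in>I. y $ i * h (axis i 1))" if "finite I" for I
      using that by (induction I) (simp_all add: h h0)
    from this[of UNIV] exp[of y] show ?thesis by simp
  qed
  have lf: "Vector_Spaces.linear (*s) (*s) ?f"
    by unfold_locales (simp_all add: vec_eq_iff bilin algebra_simps)
  have "inj ?f"
  proof (rule injI)
    fix x y assume "?f x = ?f y"
    then have "B (x - y) (axis i 1) = 0" for i by (simp add: vec_eq_iff bilin)
    then have "B (x - y) w = 0" for w by (subst sum[of "B (x - y)"]) (simp_all add: bilin)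
    then have "x - y = 0" using B_nondegenerate by blast
    then show "x = y" by simp
  qed
  then have "surj ?f" by (rule vec.linear_inj_imp_surj[OF lf])
  then obtain x where "(\<chi> i. g (axis i 1)) = ?f x" by (rule surjE)
  then have x: "B x (axis i 1) = g (axis i 1)" for i by (simp add: vec_eq_iff)
  have "B x y = g y" for y
    by (subst sum[of "B x"], simp_all add: bilin, subst sum[of g], simp_all add: g x)
  then show ?thesis by blast
qed

text \<open>A functional that is 1 at \<open>a\<close> and 0 on a basis of \<open>S\<close> exists
  by extension from an independent set; \<open>B_represents\<close> turns it into a vector.\<close>

lemma B_separates:
  assumes S: "vec.subspace S" "a \<notin> S"
  shows "\<exists>x. (\<forall>y\<in>S. B x y = 0) \<and> B x a = 1"
proof -
  interpret vp: vector_space_pair "(*s) :: complex \<Rightarrow> complex^'n \<Rightarrow> complex^'n" "(*) :: complex \<Rightarrow> complex \<Rightarrow> complex"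
    by (intro vector_space_pair.intro vec.vector_space_axioms vector_space_over_itself.vector_space_axioms)
  obtain C where C: "C \<subseteq> S" "vec.independent C" "S \<subseteq> vec.span C"
    by (rule vec.basis_exists)
  have "vec.span C \<subseteq> S" using C S by (simp add: vec.span_minimal)
  then have "a \<notin> vec.span C" using S by blast
  then have "vec.independent (insert a C)" using C by (simp add: vec.independent_insert vec.span_base)
  then obtain g where g: "Vector_Spaces.linear (*s) (*) g" "\<forall>x\<in>insert a C. g x = (if x = a then 1 else 0)"
    using vp.linear_independent_extend[of "insert a C" "\<lambda>x. if x = a then 1 else 0"] by blast
  interpret g: Vector_Spaces.linear "(*s)" "(*)" g by fact
  obtain x where x: "\<And>y. B x y = g y"
    using B_represents[of g, OF g.add g.scale] by blast
  have "C \<subseteq> {y. g y = 0}" using g(2) C(1) S(2) by auto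
  moreover have "vec.subspace {y. g y = 0}"
    by (auto simp: vec.subspace_def g.add g.scale)
  ultimately have "vec.span C \<subseteq> {y. g y = 0}" by (rule vec.span_minimal)
  then show ?thesis using C(3) x g(2) by (intro exI[of _ x]) auto
qed

text \<open>The hypothesis keeps \<open>w\<close> outside the span of \<open>u\<close> and
  \<open>v\<close>; these may themselves be dependent.\<close>

lemma B_dual:
  assumes "\<And>c1 c2 c3. c1 *s u + c2 *s v + c3 *s w = 0 \<Longrightarrow> c3 = 0"
  shows "\<exists>x. B x u = 0 \<and> B x v = 0 \<and> B x w = 1"
proof -
  have "w \<notin> vec.span {u, v}"
  proof
    assume "w \<in> vec.span {u, v}"
    then obtain k where "w - k *s u \<in> vec.span {v}" unfolding vec.span_insert[of u] by blast
    then obtain d where "w - k *s u = d *s v" unfolding vec.span_singleton by blast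
    then have "(- k) *s u + (- d) *s v + 1 *s w = 0" by (simp add: vec_eq_iff algebra_simps)
    then show False using assms[of "- k" "- d" 1] by simp
  qed
  then have "\<exists>x. (\<forall>y\<in>vec.span {u, v}. B x y = 0) \<and> B x w = 1"
    by (rule B_separates[OF vec.subspace_span])
  then show ?thesis by (auto intro: vec.span_base)
qed

text \<open>A vector orthogonal to all brackets is central by invariance. With trivial center the
  brackets would therefore span everything, and no \<open>D k\<close> could shrink.\<close>

lemma center_nontrivial:
  assumes D: "D 0 = UNIV" "\<And>k. vec.subspace (D k)" "\<And>k x y. x \<in> D k \<Longrightarrow> y \<in> D k \<Longrightarrow> br x y \<in> D (Suc k)"
    and K: "D K = {0}"
  shows "\<exists>z. z \<noteq> 0 \<and> central z"
proof (rule ccontr)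
  assume no: "\<not> ?thesis"
  let ?S = "vec.span {br x y | x y. True}"
  have full: "?S = UNIV"
  proof (rule ccontr)
    assume "?S \<noteq> UNIV"
    then obtain a where "a \<notin> ?S" by blast
    then obtain x where x: "\<forall>y\<in>?S. B x y = 0" "B x a = 1"
      using B_separates[OF vec.subspace_span] by blast
    have "br x y = 0" for y
    proof (rule B_nondegenerate)
      fix w
      have "br y w \<in> ?S" by (rule vec.span_base) blast
      then show "B (br x y) w = 0" using x(1) by (simp add: B_invariant)
    qed
    then have "central x" by (simp add: central_def)
    moreover have "x \<noteq> 0" using x(2) by (auto simp: bilin)
    ultimately show False using no by blast
  qed
  have "D k = UNIV" for k
  proof (induction k)
    case (Suc k)
    have "?S \<subseteq> D (Suc k)"
      by (rule vec.span_minimal) (use D Suc in auto)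
    then show ?case using full by blast
  qed (use D in simp)
  then have U0: "(UNIV :: (complex^'n) set) = {0}" using K by metis
  have "(1 :: complex^'n) = 0" using U0 by blast
  then show False by simp
qed

text \<open>If \<open>U\<close>, \<open>M\<close>, \<open>N\<close> were independent, the hypothesis would describe a surjection onto
  \<open>sl\<^sub>2\<close>; then every term of the derived series contains preimages of a standard triple.\<close>

lemma solvable_dependent_triple:
  assumes act: "\<And>x. br x U = 2 *s (B x M *s U - B x U *s M)"
      "\<And>x. br x M = B x N *s U - B x U *s N"
      "\<And>x. br x N = 2 *s (B x N *s M - B x M *s N)"
    and D: "D 0 = UNIV" "\<And>k. vec.subspace (D k)" "\<And>k x y. x \<in> D k \<Longrightarrow> y \<in> D k \<Longrightarrow> br x y \<in> D (Suc k)"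
    and K: "D K = {0}"
  shows "\<exists>c1 c2 c3. (c1, c2, c3) \<noteq> (0, 0, 0) \<and> c1 *s U + c2 *s M + c3 *s N = 0"
proof (rule ccontr)
  assume no: "\<not> ?thesis"
  have no': "c1 = 0 \<and> c2 = 0 \<and> c3 = 0" if "c1 *s U + c2 *s M + c3 *s N = 0" for c1 c2 c3
  proof (rule ccontr)
    assume "\<not> ?thesis"
    then have "(c1, c2, c3) \<noteq> (0, 0, 0)" by simp
    then show False using no that by blast
  qed
  have U: "\<exists>x. B x M = 0 \<and> B x N = 0 \<and> B x U = 1"
  proof (rule B_dual)
    fix c1 c2 c3 assume "c1 *s M + c2 *s N + c3 *s U = 0"
    then have "c3 *s U + c1 *s M + c2 *s N = 0" by (metis add.assoc add.commute)
    then show "c3 = 0" using no' by blast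
  qed
  have M: "\<exists>x. B x U = 0 \<and> B x N = 0 \<and> B x M = 1"
  proof (rule B_dual)
    fix c1 c2 c3 assume "c1 *s U + c2 *s N + c3 *s M = 0"
    then have "c1 *s U + c3 *s M + c2 *s N = 0" by (metis add.assoc add.commute)
    then show "c3 = 0" using no' by blast
  qed
  have N: "\<exists>x. B x U = 0 \<and> B x M = 0 \<and> B x N = 1"
    by (rule B_dual) (use no' in blast)
  \<comment> \<open>The three pairings are, up to sign, the matrix entries of the action of
    \<open>x\<close> on the odd plane. The triples (0, 1, 0), (0, 0, 1), (1, 0, 0) belong to
    standard generators of \<open>sl\<^sub>2\<close>.\<close>
  define P where "P x a b c \<longleftrightarrow> B x U = a \<and> B x M = b \<and> B x N = c" for x a b c
  have "\<exists>h e f. h \<in> D k \<and> e \<in> D k \<and> f \<in> D k \<and> P h 0 1 0 \<and> P e 0 0 1 \<and> P f 1 0 0" for k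
  proof (induction k)
    case 0
    obtain h e f where "P h 0 1 0" "P e 0 0 1" "P f 1 0 0" using U M N P_def by metis
    then show ?case using D(1) by blast
  next
    case (Suc k)
    then obtain h e f where hef: "h \<in> D k" "e \<in> D k" "f \<in> D k"
      and P: "P h 0 1 0" "P e 0 0 1" "P f 1 0 0" by blast
    \<comment> \<open>In these coordinates [e, f], [h, e], [h, f] read \<open>- h\<close>,
      \<open>2 e\<close>, \<open>- 2 f\<close>; the scalars restore the triple one level further
      down the series.\<close>
    have "- br e f \<in> D (Suc k)" "(1/2) *s br h e \<in> D (Suc k)" "(-1/2) *s br h f \<in> D (Suc k)"
      by (intro vec.subspace_scale vec.subspace_neg D hef)+
    moreover have "P (- br e f) 0 1 0" "P ((1/2) *s br h e) 0 0 1" "P ((-1/2) *s br h f) 1 0 0"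
      using P by (simp_all add: P_def B_minus(1) B_scale1 B_br_skew act)
        (simp_all add: bilin)
    ultimately show ?case by blast
  qed
  from this[of K] obtain h where "h \<in> D K" "P h 0 1 0" by blast
  then show False using K by (simp add: bilin P_def)
qed


text \<open>The factor \<open>c\<close> is the price for normalizing an eigenvalue of
  \<open>ad v\<close> to -1. With a larger center no eigenvalue is normalized and \<open>Z3\<close>
  can be \<open>z\<close> itself.\<close>

theorem quadratic_lie_dim6:
  assumes z: "central z" "z \<noteq> 0"
  shows "(\<exists>e. realizes table61 e \<and> e Z3 = z) \<or>
    (\<exists>c l e. c \<noteq> 0 \<and> l \<noteq> 0 \<and> realizes (table62 l) e \<and> e Z3 = c *s z) \<or>
    (\<exists>c e. c \<noteq> 0 \<and> realizes table63 e \<and> e Z3 = c *s z)"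
proof (cases "\<exists>k. central k \<and> (\<forall>c. k \<noteq> c *s z)")
  case True
  then obtain k where "central k" "\<And>c. k \<noteq> c *s z" by blast
  from two_dim_center(1)[OF z this] show ?thesis by blast
next
  case False
  then have Z: "\<forall>k. central k \<longrightarrow> (\<exists>c. k = c *s z)" by blast
  obtain c v q where c: "c \<noteq> 0" "hyp (c *s z) v" "q \<noteq> 0" "br v q = - q"
    by (rule center_dim1_normalize[OF z Z])
  have "central (c *s z)" using z by (simp add: central_def bilin)
  moreover have "\<forall>k. central k \<longrightarrow> (\<exists>d. k = d *s (c *s z))"
  proof (intro allI impI)
    fix k assume "central k"
    then obtain d where "k = d *s z" using Z by blast
    then have "k = (d / c) *s (c *s z)" using c by simp
    then show "\<exists>d. k = d *s (c *s z)" by blast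
  qed
  ultimately have "(\<exists>l e. l \<noteq> 0 \<and> realizes (table62 l) e \<and> e Z3 = c *s z \<and> e X3 = v \<and> e X1 = q) \<or>
      (\<exists>e. realizes table63 e \<and> e Z3 = c *s z \<and> e X3 = v \<and> e X2 = q)"
    by (rule center_dim1_classification) (use c in auto)
  then show ?thesis using c(1) by blast
qed

text \<open>For \<open>v\<close> dual to \<open>a\<close>, the rule for \<open>br x b\<close> gives
  \<open>br v b = 2 (B v b a - b)\<close>, so \<open>q = b - B v b a\<close> is an eigenvector for
  -2. The center is the line of \<open>a\<close>, since otherwise \<open>br v q\<close>, and with it
  \<open>q\<close>, would be central. Passing to \<open>2 a\<close> and \<open>v / 2\<close> changes
  the eigenvalue to -1.\<close>

theorem quadratic_lie_dim6_eigenvector: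
  assumes a: "central a" and b: "\<And>x. br x b = 2 *s (B x b *s a - B x a *s b)"
    and ab: "a \<noteq> 0" "\<And>c. b \<noteq> c *s a"
  shows "\<exists>t. (\<exists>l e. l \<noteq> 0 \<and> realizes (table62 l) e \<and> e Z3 = 2 *s a \<and> e X1 = b + t *s a) \<or>
    (\<exists>e. realizes table63 e \<and> e Z3 = 2 *s a \<and> e X2 = b + t *s a)"
proof -
  obtain v where av: "hyp a v"
    using nondeg_partner[OF nondeg_UNIV] ab a central_orthogonal by blast
  define t where "t = - B v b"
  define q where "q = b + t *s a"
  have q0: "q \<noteq> 0"
  proof
    assume "q = 0"
    then have "b = (- t) *s a" by (simp add: q_def eq_neg_iff_add_eq_0)
    then show False using ab by blast
  qed
  have vq: "br v q = - 2 *s q"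
    using central_right[OF a, of v] av by (simp add: q_def t_def bilin b hyp_def algebra_simps vec_eq_iff)
  have Z: "\<exists>c. k = c *s a" if "central k" for k
  proof (rule ccontr)
    assume "\<not> ?thesis"
    then have "central (br v q)" using two_dim_center(2)[OF a ab(1) that] by blast
    then have "central ((- 1/2) *s br v q)" by (simp add: central_def bilin)
    then have "central q" by (simp add: vq)
    then show False using vq q0 central_right[of q v] by simp
  qed
  have "central (2 *s a)" using a by (simp add: central_def bilin)
  moreover have "\<forall>k. central k \<longrightarrow> (\<exists>d. k = d *s (2 *s a))"
  proof (intro allI impI)
    fix k assume "central k"
    then obtain d where "k = d *s a" using Z by blast
    then have "k = (d / 2) *s (2 *s a)" by simp
    then show "\<exists>d. k = d *s (2 *s a)" by blast
  qed
  moreover have "hyp (2 *s a) ((1/2) *s v)" using av by (simp add: hyp_def bilin)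
  moreover have "br ((1/2) *s v) q = - q" using vq by (simp add: bilin)
  ultimately show ?thesis
    using center_dim1_classification[of "2 *s a" "(1/2) *s v" q] q0 unfolding q_def by blast
qed

end

section \<open>Models given by bracket tables\<close>

definition coord_space :: "gen set \<Rightarrow> vec8 set" where
  "coord_space S = {x. \<forall>i. i \<notin> S \<longrightarrow> x $ i = 0}"

lemma coord_expand:
  assumes "x \<in> coord_space S"
  shows "x = (\<Sum>i\<in>S. x $ i *s bv i)"
  using assms
  by (auto simp: vec_eq_iff coord_space_def axis_def if_distrib cong: if_cong)

lemma coord_space_subspace: "vec.subspace (coord_space S)"
  by (auto simp: vec.subspace_def coord_space_def)

lemma coord_space_span: "coord_space S = vec.span (bv ` S)"
proof (rule equalityI)
  show "vec.span (bv ` S) \<subseteq> coord_space S"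
    by (rule vec.span_minimal[OF _ coord_space_subspace]) (auto simp: coord_space_def axis_def)
  show "coord_space S \<subseteq> vec.span (bv ` S)"
  proof
    fix x assume "x \<in> coord_space S"
    then have "x = (\<Sum>i\<in>S. x $ i *s bv i)" by (rule coord_expand)
    also have "\<dots> \<in> vec.span (bv ` S)"
      by (intro vec.span_sum vec.span_scale vec.span_base) auto
    finally show "x \<in> vec.span (bv ` S)" .
  qed
qed

lemma even_space_coord: "even_space = coord_space even_gens"
  by (simp add: coord_space_span even_space_def even_gens_def)

lemma odd_space_coord: "odd_space = coord_space (UNIV - even_gens)"
proof -
  have "UNIV - even_gens = {Y1, T1}" by (auto simp: even_gens_def UNIV_gen)
  then show ?thesis by (simp add: coord_space_span odd_space_def)
qed

lemma table_brk_linear1: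
  "table_brk L (x + y) w = table_brk L x w + table_brk L y w"
  "table_brk L (c *s x) w = c *s table_brk L x w"
  by (induction L) (auto simp: table_brk_def algebra_simps vec_eq_iff)

lemma table_brk_linear2:
  "table_brk L w (x + y) = table_brk L w x + table_brk L w y"
  "table_brk L w (c *s x) = c *s table_brk L w x"
  by (induction L) (auto simp: table_brk_def algebra_simps vec_eq_iff)

lemma std_form_linear:
  "std_form (x + y) w = std_form x w + std_form y w"
  "std_form (c *s x) w = c * std_form x w"
  "std_form w (x + y) = std_form w x + std_form w y"
  "std_form w (c *s x) = c * std_form w x"
  by (simp_all add: std_form_def algebra_simps)

lemma std_form_nondegenerate:
  assumes "\<And>i. std_form x (bv i) = 0"
  shows "x = 0"
proof -
  have "x $ i = 0" for i
    using assms[of Z1] assms[of Z2] assms[of Z3] assms[of X1] assms[of X2] assms[of X3] assms[of Y1] assms[of T1]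
    by (cases i) (simp_all add: std_form_def axis_def)
  then show ?thesis by (simp add: vec_eq_iff)
qed

text \<open>A choice of basis vectors naturally gives a map from the model to \<open>G\<close>,
  opposite to the direction of \<open>i_isomorphic\<close>.\<close>

lemma i_isomorphic_inverse:
  assumes bij: "bij_betw f (whole H) (whole G)"
    and parts: "f ` even_part H = even_part G" "f ` odd_part H = odd_part G"
    and closed: "\<And>x y. x \<in> whole H \<Longrightarrow> y \<in> whole H \<Longrightarrow> x + y \<in> whole H"
      "\<And>c x. x \<in> whole H \<Longrightarrow> scal H c x \<in> whole H"
      "\<And>x y. x \<in> whole H \<Longrightarrow> y \<in> whole H \<Longrightarrow> brk H x y \<in> whole H"
    and sub: "even_part H \<subseteq> whole H" "odd_part H \<subseteq> whole H"
    and hom: "\<And>x y. x \<in> whole H \<Longrightarrow> y \<in> whole H \<Longrightarrow> f (x + y) = f x + f y"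
      "\<And>c x. x \<in> whole H \<Longrightarrow> f (scal H c x) = scal G c (f x)"
      "\<And>x y. x \<in> whole H \<Longrightarrow> y \<in> whole H \<Longrightarrow> f (brk H x y) = brk G (f x) (f y)"
      "\<And>x y. x \<in> whole H \<Longrightarrow> y \<in> whole H \<Longrightarrow> form G (f x) (f y) = form H x y"
  shows "i_isomorphic G H"
proof -
  define g where "g = inv_into (whole H) f"
  have gf: "g (f x) = x" if "x \<in> whole H" for x
    using that bij by (simp add: g_def bij_betw_inv_into_left)
  have fin: "f x \<in> whole G" if "x \<in> whole H" for x
    using that bij by (rule bij_betwE[rule_format, rotated])
  have sur: "\<exists>x\<in>whole H. y = f x" if "y \<in> whole G" for y
    using that bij by (auto simp: bij_betw_def)
  have img: "g ` f ` A = A" if "A \<subseteq> whole H" for A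
  proof -
    have "(\<lambda>x. g (f x)) ` A = (\<lambda>x. x) ` A"
      by (rule image_cong) (use that gf in auto)
    then show ?thesis by (simp add: image_image)
  qed
  have "i_isomorphism G H g"
    unfolding i_isomorphism_def
  proof (intro conjI ballI allI)
    show "bij_betw g (whole G) (whole H)" using bij unfolding g_def by (rule bij_betw_inv_into)
    show "g ` even_part G = even_part H" "g ` odd_part G = odd_part H"
      using img[OF sub(1)] img[OF sub(2)] parts by auto
  next
    fix c x assume "x \<in> whole G"
    then obtain x' where x': "x' \<in> whole H" "x = f x'" using sur by blast
    have "g (f (scal H c x')) = scal H c x'" using closed(2) x' by (intro gf) auto
    then show "g (scal G c x) = scal H c (g x)" using hom(2) gf x' by simp
  next
    fix x y assume "x \<in> whole G" "y \<in> whole G"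
    then obtain x' y' where x': "x' \<in> whole H" "x = f x'" "y' \<in> whole H" "y = f y'" using sur by metis
    have "g (f (x' + y')) = x' + y'" using closed(1) x' by (intro gf) auto
    then show "g (x + y) = g x + g y" using hom(1) gf x' by simp
    have "g (f (brk H x' y')) = brk H x' y'" using closed(3) x' by (intro gf) auto
    then show "g (brk G x y) = brk H (g x) (g y)" using hom(3) gf x' by simp
    show "form H (g x) (g y) = form G x y" using hom(4) gf x' by simp
  qed
  then show ?thesis unfolding i_isomorphic_def by blast
qed

text \<open>The scaling \<open>s\<close> of the target is left arbitrary, so that the lemma serves
  for brackets with values in \<open>G\<close> and for forms with complex values.\<close>

lemma vec8_linear_eq:
  assumes f: "\<And>x y. f (x + y) = f x + f y" "\<And>c x. f (c *s x) = s c (f x)"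
    and g: "\<And>x y. g (x + y) = g x + g y" "\<And>c x. g (c *s x) = s c (g x)"
    and eq: "\<And>i. i \<in> S \<Longrightarrow> f (bv i) = g (bv i)" and x: "x \<in> coord_space S"
  shows "f x = (g x :: 'b::ab_group_add)"
proof -
  have 0: "f 0 = 0" "g 0 = 0" using f(1)[of 0 0] g(1)[of 0 0] by auto
  have "f (\<Sum>i\<in>K. x $ i *s bv i) = g (\<Sum>i\<in>K. x $ i *s bv i)" if "K \<subseteq> S" for K
    using finite[of K] that
  proof (induction K rule: finite_induct)
    case (insert k K)
    have "f (\<Sum>i\<in>insert k K. x $ i *s bv i) = s (x $ k) (f (bv k)) + f (\<Sum>i\<in>K. x $ i *s bv i)"
      using insert.hyps by (simp add: f)
    also have "\<dots> = s (x $ k) (g (bv k)) + g (\<Sum>i\<in>K. x $ i *s bv i)"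
      using insert eq by simp
    also have "\<dots> = g (\<Sum>i\<in>insert k K. x $ i *s bv i)"
      using insert.hyps by (simp add: g)
    finally show ?case .
  qed (simp add: 0)
  from this[of S] show ?thesis using coord_expand[OF x] by simp
qed

section \<open>The axioms on homogeneous vectors, and comparison with a model\<close>

context quadratic_lie_superalgebra
begin

abbreviation smul (infixr "\<cdot>" 75) where "c \<cdot> x \<equiv> scal G c x"
abbreviation Ev where "Ev \<equiv> even_part G"
abbreviation Od where "Od \<equiv> odd_part G"
abbreviation W where "W \<equiv> whole G"

lemma even_whole: "x \<in> Ev \<Longrightarrow> x \<in> W"
  using subspace_0[OF odd_subspace] by (force simp: whole_def)

lemma odd_whole: "x \<in> Od \<Longrightarrow> x \<in> W"
  using subspace_0[OF even_subspace] by (force simp: whole_def)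

lemma whole_subspace: "subspace W"
  using subspace_sums[OF even_subspace odd_subspace] by (simp add: whole_def)

lemmas W_closed = subspace_add[OF whole_subspace] subspace_scale[OF whole_subspace]
  subspace_neg[OF whole_subspace] subspace_0[OF whole_subspace] subspace_diff[OF whole_subspace]
lemmas Ev_closed = subspace_add[OF even_subspace] subspace_scale[OF even_subspace]
  subspace_neg[OF even_subspace] subspace_0[OF even_subspace] subspace_diff[OF even_subspace]
lemmas Od_closed = subspace_add[OF odd_subspace] subspace_scale[OF odd_subspace]
  subspace_neg[OF odd_subspace] subspace_0[OF odd_subspace] subspace_diff[OF odd_subspace]

lemma brk_even_even: "x \<in> Ev \<Longrightarrow> y \<in> Ev \<Longrightarrow> brk G x y \<in> Ev"
  using brk_graded[of x 0 y 0] by (simp add: hpart_def)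
lemma brk_even_odd: "x \<in> Ev \<Longrightarrow> y \<in> Od \<Longrightarrow> brk G x y \<in> Od"
  using brk_graded[of x 0 y 1] by (simp add: hpart_def)
lemma brk_odd_even: "x \<in> Od \<Longrightarrow> y \<in> Ev \<Longrightarrow> brk G x y \<in> Od"
  using brk_graded[of x 1 y 0] by (simp add: hpart_def)
lemma brk_odd_odd: "x \<in> Od \<Longrightarrow> y \<in> Od \<Longrightarrow> brk G x y \<in> Ev"
  using brk_graded[of x 1 y 1] by (simp add: hpart_def)

lemma skew_even: "x \<in> Ev \<Longrightarrow> y \<in> Ev \<Longrightarrow> brk G x y = - brk G y x"
  using brk_skew[of x 0 y 0] by (simp add: hpart_def)
lemma skew_even_odd: "x \<in> Ev \<Longrightarrow> y \<in> Od \<Longrightarrow> brk G y x = - brk G x y"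
  using brk_skew[of y 1 x 0] by (simp add: hpart_def)
lemma sym_odd: "x \<in> Od \<Longrightarrow> y \<in> Od \<Longrightarrow> brk G x y = brk G y x"
  using brk_skew[of x 1 y 1] by (simp add: hpart_def)

lemma jacobi_even: "x \<in> Ev \<Longrightarrow> y \<in> Ev \<Longrightarrow> z \<in> Ev \<Longrightarrow>
    brk G x (brk G y z) = brk G (brk G x y) z + brk G y (brk G x z)"
  using jacobi[of x 0 y 0 z 0] by (simp add: hpart_def)
lemma jacobi_odd: "x \<in> Ev \<Longrightarrow> y \<in> Od \<Longrightarrow> z \<in> Od \<Longrightarrow>
    brk G x (brk G y z) = brk G (brk G x y) z + brk G y (brk G x z)"
  using jacobi[of x 0 y 1 z 1] by (simp add: hpart_def)

lemma form_even_sym: "x \<in> Ev \<Longrightarrow> y \<in> Ev \<Longrightarrow> form G x y = form G y x"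
  using form_supersym[of x 0 y 0] by (simp add: hpart_def)
lemma form_odd_skew: "x \<in> Od \<Longrightarrow> y \<in> Od \<Longrightarrow> form G x y = - form G y x"
  using form_supersym[of x 1 y 1] by (simp add: hpart_def)
lemma form_odd_self: "x \<in> Od \<Longrightarrow> form G x x = 0"
  using form_odd_skew[of x x] by simp
lemma form_odd_even: "x \<in> Od \<Longrightarrow> y \<in> Ev \<Longrightarrow> form G x y = 0"
  using form_supersym[of x 1 y 0] form_even by (simp add: hpart_def)

lemma brk_zero: "x \<in> W \<Longrightarrow> brk G x 0 = 0" "x \<in> W \<Longrightarrow> brk G 0 x = 0"
  using brk_scal_left[of x x 0] brk_scal_right[of x x 0] by simp_all

lemma brk_neg: "x \<in> W \<Longrightarrow> y \<in> W \<Longrightarrow> brk G (- x) y = - brk G x y"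
    "x \<in> W \<Longrightarrow> y \<in> W \<Longrightarrow> brk G x (- y) = - brk G x y"
  using brk_scal_left[of x y "-1"] brk_scal_right[of x y "-1"] by simp_all

lemma brk_sub: "x \<in> W \<Longrightarrow> y \<in> W \<Longrightarrow> z \<in> W \<Longrightarrow> brk G (x - y) z = brk G x z - brk G y z"
    "x \<in> W \<Longrightarrow> y \<in> W \<Longrightarrow> z \<in> W \<Longrightarrow> brk G z (x - y) = brk G z x - brk G z y"
  using brk_add_left[of x "- y" z] brk_add_right[of z x "- y"] by (simp_all add: W_closed brk_neg)

lemma form_zero: "x \<in> W \<Longrightarrow> form G x 0 = 0" "x \<in> W \<Longrightarrow> form G 0 x = 0"
  using form_scal_left[of x x 0] form_scal_right[of x x 0] by simp_all

lemma form_neg: "x \<in> W \<Longrightarrow> y \<in> W \<Longrightarrow> form G (- x) y = - form G x y"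
    "x \<in> W \<Longrightarrow> y \<in> W \<Longrightarrow> form G x (- y) = - form G x y"
  using form_scal_left[of x y "-1"] form_scal_right[of x y "-1"] by simp_all

lemma form_sub: "x \<in> W \<Longrightarrow> y \<in> W \<Longrightarrow> z \<in> W \<Longrightarrow> form G (x - y) z = form G x z - form G y z"
    "x \<in> W \<Longrightarrow> y \<in> W \<Longrightarrow> z \<in> W \<Longrightarrow> form G z (x - y) = form G z x - form G z y"
  using form_add_left[of x "- y" z] form_add_right[of z x "- y"] by (simp_all add: W_closed form_neg)

lemmas bilinear_simps = brk_add_left brk_add_right brk_scal_left brk_scal_right brk_zero brk_neg brk_sub
  form_add_left form_add_right form_scal_left form_scal_right form_zero form_neg form_sub
  even_whole odd_whole W_closed Ev_closed Od_closed
  brk_even_even brk_even_odd brk_odd_even brk_odd_odd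

lemma whole_split: "x \<in> W \<Longrightarrow> \<exists>a\<in>Ev. \<exists>b\<in>Od. x = a + b"
  by (auto simp: whole_def)

lemma nondegenerate_even:
  assumes "x \<in> Ev" "\<And>y. y \<in> Ev \<Longrightarrow> form G x y = 0"
  shows "x = 0"
proof -
  have "form G x y = 0" if "y \<in> W" for y
    using whole_split[OF that] assms by (auto simp: bilinear_simps form_even)
  then show ?thesis using form_nondegenerate assms(1) even_whole by (auto simp: nondegenerate_on_def)
qed

lemma nondegenerate_odd:
  assumes "x \<in> Od" "\<And>y. y \<in> Od \<Longrightarrow> form G x y = 0"
  shows "x = 0"
proof -
  have "form G x y = 0" if "y \<in> W" for y
    using whole_split[OF that] assms by (auto simp: bilinear_simps form_odd_even)
  then show ?thesis using form_nondegenerate assms(1) odd_whole by (auto simp: nondegenerate_on_def)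
qed

lemma whole_even_algebra: "whole (even_algebra G) = Ev"
  by (auto simp: whole_def even_algebra_def)

lemma even_algebra_quadratic: "quadratic_lie_superalgebra (even_algebra G)"
proof -
  have sel: "scal (even_algebra G) = scal G" "even_part (even_algebra G) = Ev" "odd_part (even_algebra G) = {0}"
    "brk (even_algebra G) = brk G" "form (even_algebra G) = form G"
    by (simp_all add: even_algebra_def)
  have hp: "x \<in> hpart G p" if "x \<in> hpart (even_algebra G) p" for x p
    using that by (auto simp: hpart_def sel Od_closed split: if_splits)
  have hb: "brk G x y \<in> hpart (even_algebra G) (p + q)"
    if "x \<in> hpart (even_algebra G) p" "y \<in> hpart (even_algebra G) q" for x y p q
    using that by (auto simp: hpart_def sel bilinear_simps split: if_splits)
  obtain C where C: "C \<subseteq> Ev" "independent C" "Ev \<subseteq> span C"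
    by (rule basis_exists)
  obtain S where S: "finite S" "span S = W" using finite_dim by blast
  have "C \<subseteq> span S" using C S even_whole by blast
  then have "finite C" using independent_span_bound[OF S(1) C(2)] by simp
  moreover have "span C = Ev" using C span_minimal[OF C(1) even_subspace] by blast
  ultimately have fin: "\<exists>S. finite S \<and> span S = Ev" by blast
  show ?thesis
    unfolding quadratic_lie_superalgebra_def quadratic_lie_superalgebra_axioms_def sel whole_even_algebra
  proof (intro conjI allI impI)
    show "vector_space (scal G)" by (rule vector_space_axioms)
    show "nondegenerate_on (even_algebra G) Ev"
      unfolding nondegenerate_on_def sel using nondegenerate_even by blast
  qed ((rule even_subspace fin subspace_single_0 | (rule hb; assumption)
      | (rule brk_skew jacobi form_supersym; rule hp; assumption)
      | simp add: bilinear_simps form_invariant)+)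
qed

definition comb :: "(gen \<Rightarrow> 'a) \<Rightarrow> vec8 \<Rightarrow> 'a" where
  "comb e x = (\<Sum>i\<in>UNIV. (x $ i) \<cdot> e i)"

lemma comb_linear: "comb e (x + y) = comb e x + comb e y" "comb e (c *s x) = c \<cdot> comb e x"
  by (simp_all add: comb_def scale_left_distrib sum.distrib scale_sum_right)

lemma comb_bv: "comb e (bv i) = e i"
  by (simp add: comb_def axis_def if_distrib[of "\<lambda>c. c \<cdot> _"] cong: if_cong)

lemma comb_coord:
  assumes "x \<in> coord_space S"
  shows "comb e x = (\<Sum>i\<in>S. (x $ i) \<cdot> e i)"
  unfolding comb_def using assms by (intro sum.mono_neutral_right) (auto simp: coord_space_def)

text \<open>\<open>S\<close> is \<open>even_gens\<close> for the six-dimensional models and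
  \<open>UNIV\<close> for the eight-dimensional ones. Independence of the vectors \<open>e i\<close>
  is not checked separately: the map preserves the forms, so a vector in its kernel is orthogonal to
  every \<open>bv i\<close> and vanishes by \<open>nondeg\<close>.\<close>

lemma i_isomorphic_model:
  fixes e :: "gen \<Rightarrow> 'a"
  assumes H: "scal H = (*s)" "brk H = table_brk L" "form H = std_form"
      "even_part H = coord_space even_gens" "odd_part H = coord_space (S - even_gens)" "even_gens \<subseteq> S"
    and e: "\<And>i. i \<in> even_gens \<Longrightarrow> e i \<in> Ev" "\<And>i. i \<in> S - even_gens \<Longrightarrow> e i \<in> Od" "\<And>i. i \<notin> S \<Longrightarrow> e i = 0"
    and span_even: "\<And>x. x \<in> Ev \<Longrightarrow> \<exists>c. x = (\<Sum>i\<in>even_gens. c i \<cdot> e i)"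
    and span_odd: "\<And>x. x \<in> Od \<Longrightarrow> \<exists>c. x = (\<Sum>i\<in>S - even_gens. c i \<cdot> e i)"
    and form: "\<And>i j. i \<in> S \<Longrightarrow> j \<in> S \<Longrightarrow> form G (e i) (e j) = std_form (bv i) (bv j)"
    and brk: "\<And>i j. i \<in> S \<Longrightarrow> j \<in> S \<Longrightarrow> brk G (e i) (e j) = comb e (table_brk L (bv i) (bv j))"
    and closed: "\<And>x y. x \<in> coord_space S \<Longrightarrow> y \<in> coord_space S \<Longrightarrow> table_brk L x y \<in> coord_space S"
    and nondeg: "\<And>x. x \<in> coord_space S \<Longrightarrow> (\<And>i. i \<in> S \<Longrightarrow> std_form x (bv i) = 0) \<Longrightarrow> x = 0"
  shows "i_isomorphic G H"
proof -
  let ?f = "comb e"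
  note VS = coord_space_subspace
  have eW: "e i \<in> W" for i
    using e by (cases "i \<in> S"; cases "i \<in> even_gens") (auto simp: bilinear_simps)
  have fW: "?f x \<in> W" for x
    unfolding comb_def by (intro subspace_sum[OF whole_subspace] subspace_scale[OF whole_subspace] eW)
  have nS: "i \<notin> even_gens" if "i \<notin> S" for i using H(6) that by blast
  have wH: "whole H = coord_space S"
  proof (intro equalityI subsetI)
    fix x assume "x \<in> whole H"
    then show "x \<in> coord_space S" by (auto simp: whole_def H coord_space_def nS)
  next
    fix x assume x: "x \<in> coord_space S"
    define a b where "a = (\<chi> i. if i \<in> even_gens then x $ i else 0)" and "b = (\<chi> i. if i \<in> even_gens then 0 else x $ i)"
    have "x = a + b" by (simp add: a_def b_def vec_eq_iff)
    moreover have "a \<in> coord_space even_gens" "b \<in> coord_space (S - even_gens)"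
      using x by (auto simp: a_def b_def coord_space_def)
    ultimately show "x \<in> whole H" unfolding whole_def H by blast
  qed
  have fform: "form G (?f x) (?f y) = std_form x y" if "x \<in> coord_space S" "y \<in> coord_space S" for x y
  proof (rule vec8_linear_eq[where s = "(*)" and f = "\<lambda>x. form G (?f x) (?f y)" and g = "\<lambda>x. std_form x y", OF _ _ _ _ _ that(1)])
    fix i assume "i \<in> S"
    then show "form G (?f (bv i)) (?f y) = std_form (bv i) y"
      by (intro vec8_linear_eq[where s = "(*)" and f = "\<lambda>y. form G (?f (bv i)) (?f y)" and g = "\<lambda>y. std_form (bv i) y", OF _ _ _ _ _ that(2)])
        (simp_all add: comb_linear bilinear_simps fW std_form_linear comb_bv eW form)
  qed (simp_all add: comb_linear bilinear_simps fW std_form_linear)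
  have fbrk: "?f (table_brk L x y) = brk G (?f x) (?f y)" if "x \<in> coord_space S" "y \<in> coord_space S" for x y
  proof (rule vec8_linear_eq[where s = "scal G" and g = "\<lambda>x. brk G (?f x) (?f y)" and f = "\<lambda>x. ?f (table_brk L x y)", OF _ _ _ _ _ that(1)])
    fix i assume "i \<in> S"
    then show "?f (table_brk L (bv i) y) = brk G (?f (bv i)) (?f y)"
      by (intro vec8_linear_eq[where s = "scal G" and g = "\<lambda>y. brk G (?f (bv i)) (?f y)" and f = "\<lambda>y. ?f (table_brk L (bv i) y)", OF _ _ _ _ _ that(2)])
        (simp_all add: comb_linear bilinear_simps fW table_brk_linear2 comb_bv eW brk)
  qed (simp_all add: comb_linear bilinear_simps fW table_brk_linear1)
  have imgs: "?f ` coord_space K = V"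
    if K: "\<And>i. i \<in> K \<Longrightarrow> e i \<in> V" and V: "subspace V" and sp: "\<And>x. x \<in> V \<Longrightarrow> \<exists>c. x = (\<Sum>i\<in>K. c i \<cdot> e i)" for K V
  proof (intro equalityI subsetI)
    fix x assume "x \<in> ?f ` coord_space K"
    then show "x \<in> V" using K V by (auto simp: comb_coord intro!: subspace_sum subspace_scale)
  next
    fix x assume "x \<in> V"
    then obtain c where c: "x = (\<Sum>i\<in>K. c i \<cdot> e i)" using sp by blast
    let ?y = "(\<chi> i. if i \<in> K then c i else 0)"
    have y: "?y \<in> coord_space K" by (simp add: coord_space_def)
    then have "x = ?f ?y" by (simp add: comb_coord c)
    then show "x \<in> ?f ` coord_space K" using y by blast
  qed
  have ev: "?f ` coord_space even_gens = Ev" by (rule imgs[OF e(1) even_subspace span_even])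
  have od: "?f ` coord_space (S - even_gens) = Od" by (rule imgs[OF e(2) odd_subspace span_odd])
  have fdiff: "?f (x - y) = ?f x - ?f y" for x y
    using comb_linear(1)[of e "x - y" y] by (simp add: algebra_simps)
  have inj: "inj_on ?f (coord_space S)"
  proof (rule inj_onI)
    fix x y assume xy: "x \<in> coord_space S" "y \<in> coord_space S" "?f x = ?f y"
    then have d: "x - y \<in> coord_space S" by (simp add: vec.subspace_diff[OF VS])
    have "std_form (x - y) (bv i) = 0" if "i \<in> S" for i
    proof -
      have "bv i \<in> coord_space S" using that by (auto simp: coord_space_def axis_def)
      then have "std_form (x - y) (bv i) = form G (?f (x - y)) (?f (bv i))" using fform d by simp
      then show ?thesis using xy by (simp add: fdiff form_zero fW)
    qed
    then have "x - y = 0" using nondeg d by blast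
    then show "x = y" by simp
  qed
  have "?f ` coord_space S = W"
  proof (intro equalityI subsetI)
    fix x assume "x \<in> W"
    then obtain a b where ab: "a \<in> Ev" "b \<in> Od" "x = a + b" using whole_split by blast
    then obtain p q where "p \<in> coord_space even_gens" "a = ?f p" "q \<in> coord_space (S - even_gens)" "b = ?f q"
      using ev od by blast
    then have "p + q \<in> whole H" "x = ?f (p + q)" using ab by (auto simp: whole_def H comb_linear)
    then show "x \<in> ?f ` coord_space S" using wH by blast
  qed (use fW in auto)
  then have bij: "bij_betw ?f (whole H) W" using inj by (simp add: wH bij_betw_def)
  show ?thesis
  proof (rule i_isomorphic_inverse[OF bij])
    show "?f ` even_part H = Ev" "?f ` odd_part H = Od" using ev od by (simp_all add: H)
    show "even_part H \<subseteq> whole H" "odd_part H \<subseteq> whole H" by (auto simp: H wH coord_space_def nS)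
  qed (simp_all add: wH H closed fform fbrk comb_linear vec.subspace_add[OF VS] vec.subspace_scale[OF VS])
qed

end

section \<open>Dimensions and coordinates of subspaces\<close>

context vector_space
begin

lemma dim_direct_sum:
  assumes S: "subspace S" and T: "subspace T" and ST: "S \<inter> T = {0}"
    and F: "finite F" "span F = {x + y | x y. x \<in> S \<and> y \<in> T}"
  shows "dim {x + y | x y. x \<in> S \<and> y \<in> T} = dim S + dim T"
proof -
  let ?V = "{x + y | x y. x \<in> S \<and> y \<in> T}"
  obtain A where A: "A \<subseteq> S" "independent A" "S \<subseteq> span A" "card A = dim S" by (rule basis_exists)
  obtain C where C: "C \<subseteq> T" "independent C" "T \<subseteq> span C" "card C = dim T" by (rule basis_exists)
  have SV: "S \<subseteq> ?V" "T \<subseteq> ?V" using subspace_0[OF S] subspace_0[OF T] by force+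
  have "A \<subseteq> span F" "C \<subseteq> span F" using A(1) C(1) SV F(2) by auto
  then have fin: "finite A" "finite C"
    using independent_span_bound[OF F(1)] A(2) C(2) by auto
  have "0 \<notin> A" using A(2) dependent_zero by metis
  moreover have "A \<inter> C \<subseteq> {0}" using A(1) C(1) ST by (metis Int_mono)
  ultimately have disj: "A \<inter> C = {}" by auto
  have "independent (A \<union> C)"
  proof
    assume "dependent (A \<union> C)"
    then obtain u where u: "\<exists>v\<in>A \<union> C. u v \<noteq> 0" "(\<Sum>v\<in>A \<union> C. scale (u v) v) = 0"
      using dependent_finite[of "A \<union> C"] fin by auto
    let ?a = "\<Sum>v\<in>A. scale (u v) v" and ?c = "\<Sum>v\<in>C. scale (u v) v"
    have ac: "?a + ?c = 0" using u(2) fin disj by (simp add: sum.union_disjoint)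
    have a: "?a \<in> S" using A(1) S by (intro subspace_sum subspace_scale) auto
    have c: "?c \<in> T" using C(1) T by (intro subspace_sum subspace_scale) auto
    have "?a = - ?c" using ac by (simp add: eq_neg_iff_add_eq_0)
    then have "?a \<in> T" using subspace_neg[OF T c] by simp
    then have "?a = 0" using a ST by blast
    moreover from this have "?c = 0" using ac by simp
    ultimately show False
      using u(1) A(2) C(2) dependent_finite[OF fin(1)] dependent_finite[OF fin(2)] by blast
  qed
  moreover have "A \<union> C \<subseteq> ?V" using A(1) C(1) SV by blast
  moreover have "?V \<subseteq> span (A \<union> C)"
    using A(3) C(3) span_mono[of A "A \<union> C"] span_mono[of C "A \<union> C"] by (auto intro!: span_add)
  moreover have "card (A \<union> C) = dim S + dim T"
    using fin disj A(4) C(4) by (simp add: card_Un_disjoint)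
  ultimately show ?thesis by (intro dim_unique)
qed

text \<open>Used to move the even part from a subspace of the ambient type to a full type, where
  \<open>quadratic_lie\<close> is formulated.\<close>

lemma coordinates_exist:
  assumes V: "subspace V" and dim: "dim V = CARD('n::finite)"
  shows "\<exists>\<phi> :: 'a^'n \<Rightarrow> 'b. (\<forall>x y. \<phi> (x + y) = \<phi> x + \<phi> y) \<and> (\<forall>c x. \<phi> (c *s x) = scale c (\<phi> x))
    \<and> inj \<phi> \<and> range \<phi> = V"
proof -
  obtain A where A: "A \<subseteq> V" "independent A" "V \<subseteq> span A" "card A = dim V" by (rule basis_exists)
  \<comment> \<open>An infinite set has \<open>card\<close> 0, so positivity yields
    finiteness.\<close>
  have "card A > 0" using A(4) dim by simp
  then have fin: "finite A" using card_ge_0_finite by blast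
  then obtain h where h: "bij_betw h (UNIV :: 'n set) A"
    using finite_same_card_bij[of "UNIV :: 'n set" A] A(4) dim by auto
  define \<phi> where "\<phi> x = (\<Sum>i\<in>UNIV. scale (x $ i) (h i))" for x :: "'a^'n"
  have add: "\<phi> (x + y) = \<phi> x + \<phi> y" and scale: "\<phi> (c *s x) = scale c (\<phi> x)" for x y c
    by (simp_all add: \<phi>_def scale_left_distrib sum.distrib scale_sum_right)
  have hA: "h i \<in> A" for i using h by (auto simp: bij_betw_def)
  have reix: "(\<Sum>v\<in>A. scale (u v) v) = \<phi> (\<chi> i. u (h i))" for u
    unfolding \<phi>_def using sum.reindex_bij_betw[OF h, of "\<lambda>v. scale (u v) v"] by simp
  have "inj \<phi>"
  proof (rule injI)
    fix x y assume "\<phi> x = \<phi> y"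
    then have 0: "\<phi> (x - y) = 0" using add[of "x - y" y] by simp
    define u where "u v = (x - y) $ inv_into UNIV h v" for v
    have uh: "u (h i) = (x - y) $ i" for i
      using h by (simp add: u_def bij_betw_def)
    have "(\<chi> i. u (h i)) = x - y" by (simp add: vec_eq_iff uh)
    then have "(\<Sum>v\<in>A. scale (u v) v) = 0" using reix[of u] 0 by simp
    then have "u v = 0" if "v \<in> A" for v using A(2) dependent_finite[OF fin] that by blast
    then have "(x - y) $ i = 0" for i using uh hA by metis
    then show "x = y" by (simp add: vec_eq_iff)
  qed
  moreover have "range \<phi> = V"
  proof (intro equalityI subsetI)
    fix v assume "v \<in> range \<phi>"
    then show "v \<in> V" using A(1) hA V by (auto simp: \<phi>_def intro!: subspace_sum subspace_scale)
  next
    fix v assume "v \<in> V"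
    then obtain u where "v = (\<Sum>w\<in>A. scale (u w) w)" using A(3) span_finite[OF fin] by auto
    then show "v \<in> range \<phi>" using reix by simp
  qed
  ultimately show ?thesis using add scale by blast
qed

end

section \<open>The odd plane and the even action on it\<close>

context quadratic_lie_superalgebra
begin

lemma sdim_odd:
  assumes "sdim G W = 8" "sdim G Ev = 6"
  shows "sdim G Od = 2"
proof -
  obtain F where F: "finite F" "span F = W" using finite_dim by blast
  have "dim W = dim Ev + dim Od"
    using dim_direct_sum[OF even_subspace odd_subspace direct F(1)] F(2) unfolding whole_def by simp
  then show ?thesis using assms by (simp add: sdim_def)
qed

text \<open>The difference of the two sides is alternating and trilinear in three vectors of a
  plane, hence zero. With two of them forming a symplectic basis it yields the coordinates of the
  third.\<close>

lemma odd_plane_identity: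
  assumes "sdim G Od = 2" "x \<in> Od" "y \<in> Od" "y' \<in> Od"
  shows "form G y y' \<cdot> x = form G x y' \<cdot> y - form G x y \<cdot> y'"
proof -
  have d2: "dim Od = CARD(2)" using assms(1) by (simp add: sdim_def)
  obtain f :: "complex^2 \<Rightarrow> 'a" where f: "\<And>x y. f (x + y) = f x + f y" "\<And>c x. f (c *s x) = c \<cdot> f x"
    "range f = Od"
    using coordinates_exist[OF odd_subspace d2] by blast
  define h k where "h = f (axis 1 1)" and "k = f (axis 2 1)"
  have hk: "h \<in> Od" "k \<in> Od" using f(3) by (auto simp: h_def k_def)
  have ex: "\<exists>a b. x = a \<cdot> h + b \<cdot> k" if x: "x \<in> Od" for x
  proof -
    obtain v where "x = f v" using x f(3) by blast
    moreover have "v = v $ 1 *s axis 1 1 + v $ 2 *s axis 2 1"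
      by (auto simp: vec_eq_iff axis_def forall_2)
    ultimately have "x = v $ 1 \<cdot> h + v $ 2 \<cdot> k" unfolding h_def k_def by (metis f(1,2))
    then show ?thesis by blast
  qed
  obtain a b where x: "x = a \<cdot> h + b \<cdot> k" using ex assms by blast
  obtain c d where y: "y = c \<cdot> h + d \<cdot> k" using ex assms by blast
  obtain c' d' where y': "y' = c' \<cdot> h + d' \<cdot> k" using ex assms by blast
  have kh: "form G k h = - form G h k" "form G h h = 0" "form G k k = 0"
    using form_odd_skew[OF hk(2,1)] form_odd_self[OF hk(1)] form_odd_self[OF hk(2)] by simp_all
  show ?thesis
    unfolding x y y'
    using hk by (simp add: bilinear_simps kh algebra_simps)
qed

lemma odd_basis:
  assumes "sdim G Od = 2"
  obtains u w where "u \<in> Od" "w \<in> Od" "form G u w = 1"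
proof -
  have "\<not> Od \<subseteq> {0}"
  proof
    assume "Od \<subseteq> {0}"
    then have "dim Od \<le> card ({} :: 'a set)" by (intro dim_le_card) auto
    then show False using assms by (simp add: sdim_def)
  qed
  then obtain u where u: "u \<in> Od" "u \<noteq> 0" by blast
  then obtain w where w: "w \<in> Od" "form G u w \<noteq> 0" using nondegenerate_odd by blast
  show ?thesis
    by (rule that[of u "(1 / form G u w) \<cdot> w"]) (use u w in \<open>simp_all add: bilinear_simps\<close>)
qed

text \<open>By invariance, the coordinates of \<open>brk G x u\<close> and \<open>brk G x w\<close>
  in the symplectic basis are pairings of \<open>x\<close> with brackets of odd vectors.\<close>

lemma odd_action:
  assumes d: "sdim G Od = 2" and u: "u \<in> Od" "w \<in> Od" "form G u w = 1" and x: "x \<in> Ev"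
  shows "brk G x u = form G x (brk G u w) \<cdot> u - form G x (brk G u u) \<cdot> w"
    "brk G x w = form G x (brk G w w) \<cdot> u - form G x (brk G u w) \<cdot> w"
proof -
  have inv: "form G (brk G x y) y' = form G x (brk G y y')" if "y \<in> Od" "y' \<in> Od" for y y'
    using that x by (simp add: form_invariant bilinear_simps)
  have "brk G x y = form G (brk G x y) w \<cdot> u - form G (brk G x y) u \<cdot> w" if "y \<in> Od" for y
    using odd_plane_identity[OF d brk_even_odd[OF x that] u(1,2)] u(3) by simp
  from this[OF u(1)] this[OF u(2)] inv[OF u(1) u(1)] inv[OF u(1) u(2)] inv[OF u(2) u(1)] inv[OF u(2) u(2)] sym_odd[OF u(2) u(1)]
  show "brk G x u = form G x (brk G u w) \<cdot> u - form G x (brk G u u) \<cdot> w"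
    "brk G x w = form G x (brk G w w) \<cdot> u - form G x (brk G u w) \<cdot> w"
    by simp_all
qed

text \<open>By the Jacobi identity the even part acts on brackets of odd vectors as on the symmetric
  square of the odd plane; \<open>odd_action\<close> supplies the coefficients.\<close>

lemma even_action_on_squares:
  assumes d: "sdim G Od = 2" and u: "u \<in> Od" "w \<in> Od" "form G u w = 1" and x: "x \<in> Ev"
  shows "brk G x (brk G u u) = 2 \<cdot> (form G x (brk G u w) \<cdot> brk G u u - form G x (brk G u u) \<cdot> brk G u w)"
    "brk G x (brk G u w) = form G x (brk G w w) \<cdot> brk G u u - form G x (brk G u u) \<cdot> brk G w w"
    "brk G x (brk G w w) = 2 \<cdot> (form G x (brk G w w) \<cdot> brk G u w - form G x (brk G u w) \<cdot> brk G w w)"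
proof -
  have two: "(2 * c) \<cdot> v = c \<cdot> v + c \<cdot> v" for c v using scale_left_distrib[of c c v] by simp
  have wu: "brk G w u = brk G u w" using sym_odd u by blast
  show "brk G x (brk G u u) = 2 \<cdot> (form G x (brk G u w) \<cdot> brk G u u - form G x (brk G u u) \<cdot> brk G u w)"
    "brk G x (brk G u w) = form G x (brk G w w) \<cdot> brk G u u - form G x (brk G u u) \<cdot> brk G w w"
    "brk G x (brk G w w) = 2 \<cdot> (form G x (brk G w w) \<cdot> brk G u w - form G x (brk G u w) \<cdot> brk G w w)"
    using u x by (simp_all add: jacobi_odd odd_action[OF d u x] bilinear_simps wu two algebra_simps)
qed

lemma central_isotropic:
  assumes dE: "sdim G Ev = 6" and ind: "indecomposable (even_algebra G)"
    and u: "u \<in> Ev" "\<And>y. y \<in> Ev \<Longrightarrow> brk G u y = 0"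
  shows "form G u u = 0"
proof (rule ccontr)
  assume nz: "form G u u \<noteq> 0"
  let ?I = "span {u}"
  have I: "x \<in> ?I \<longleftrightarrow> (\<exists>c. x = c \<cdot> u)" for x by (auto simp: span_singleton)
  have sel: "scal (even_algebra G) = scal G" "even_part (even_algebra G) = Ev" "odd_part (even_algebra G) = {0}"
    "brk (even_algebra G) = brk G" "form (even_algebra G) = form G"
    by (simp_all add: even_algebra_def)
  have yu: "brk G y u = 0" if "y \<in> Ev" for y using skew_even[OF that u(1)] u(2)[OF that] by simp
  have "graded_ideal (even_algebra G) ?I"
    unfolding graded_ideal_def sel whole_even_algebra
  proof (intro conjI ballI)
    show "subspace ?I" by (rule subspace_span)
    show "?I \<subseteq> Ev" using u(1) by (intro span_minimal even_subspace) auto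
    fix x assume "x \<in> ?I"
    then show "\<exists>a\<in>?I \<inter> Ev. \<exists>b\<in>?I \<inter> {0}. x = a + b"
      using u(1) by (intro bexI[of _ x] bexI[of _ 0]) (auto simp: span_zero I Ev_closed)
  next
    fix x y assume "x \<in> Ev" "y \<in> ?I"
    then obtain c where "y = c \<cdot> u" using I by blast
    then have "brk G x y = 0" "brk G y x = 0" using \<open>x \<in> Ev\<close> u yu by (simp_all add: bilinear_simps)
    then show "brk G x y \<in> ?I" "brk G y x \<in> ?I" by (simp_all add: span_zero)
  qed
  moreover have "nondegenerate_on (even_algebra G) ?I"
    unfolding nondegenerate_on_def sel
  proof (intro ballI impI)
    fix x assume x: "x \<in> ?I" "\<forall>y\<in>?I. form G x y = 0"
    then obtain c where c: "x = c \<cdot> u" using I by blast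
    have "form G x u = 0" using x span_base[of u "{u}"] by blast
    then show "x = 0" using nz u(1) by (simp add: c bilinear_simps)
  qed
  moreover have "?I \<noteq> {0}"
  proof
    assume "?I = {0}"
    then have "u = 0" using span_base[of u "{u}"] by blast
    then show False using nz u(1) by (simp add: bilinear_simps)
  qed
  moreover have "?I \<noteq> whole (even_algebra G)"
  proof
    assume "?I = whole (even_algebra G)"
    then have "dim Ev \<le> card {u}" by (intro dim_le_card) (auto simp: whole_even_algebra)
    then show False using dE by (simp add: sdim_def)
  qed
  ultimately show False using ind by (auto simp: decomposable_def)
qed

end

section \<open>The even part in coordinates\<close>

text \<open>Transport of structure along \<open>\<phi>\<close>; the sublocale \<open>lie\<close>
  below makes the six-dimensional theory available for the even part.\<close>

locale even_coordinates = quadratic_lie_superalgebra G for G :: "'a::ab_group_add qsuper" +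
  fixes \<phi> :: "complex^6 \<Rightarrow> 'a"
  assumes phi_add: "\<phi> (x + y) = \<phi> x + \<phi> y" and phi_scale: "\<phi> (c *s x) = c \<cdot> \<phi> x"
    and phi_inj: "inj \<phi>" and phi_range: "range \<phi> = Ev"
    and dim_even: "sdim G Ev = 6" and dim_odd: "sdim G Od = 2"
    and even_indecomposable: "indecomposable (even_algebra G)"
begin

definition \<psi> where "\<psi> = inv \<phi>"

lemma phi_even: "\<phi> x \<in> Ev" using phi_range by blast
lemma phi_psi: "x \<in> Ev \<Longrightarrow> \<phi> (\<psi> x) = x" using phi_range by (simp add: \<psi>_def f_inv_into_f)
lemma psi_phi: "\<psi> (\<phi> x) = x" using phi_inj by (simp add: \<psi>_def)
lemma phi_eq: "\<phi> x = \<phi> y \<longleftrightarrow> x = y" using phi_inj by (simp add: inj_eq)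
lemma phi_zero: "\<phi> 0 = 0" using phi_scale[of 0 0] by simp
lemma phi_uminus: "\<phi> (- x) = - \<phi> x" using phi_scale[of "-1" x] by (simp flip: vector_sneg_minus1)
lemma phi_diff: "\<phi> (x - y) = \<phi> x - \<phi> y" using phi_add[of x "- y"] by (simp add: phi_uminus)
lemmas phi_simps = phi_add phi_scale phi_zero phi_uminus phi_diff

abbreviation "ebr x y \<equiv> \<psi> (brk G (\<phi> x) (\<phi> y))"
abbreviation "eform x y \<equiv> form G (\<phi> x) (\<phi> y)"

lemma phi_ebr: "\<phi> (ebr x y) = brk G (\<phi> x) (\<phi> y)"
  by (simp add: phi_psi brk_even_even phi_even)

sublocale lie: quadratic_lie ebr eform
proof
  fix x y w :: "complex^6" and c
  show "ebr (x + y) w = ebr x w + ebr y w" "ebr (c *s x) w = c *s ebr x w"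
    by (rule phi_eq[THEN iffD1]; simp add: phi_simps phi_psi phi_even bilinear_simps)+
  show "ebr x y = - ebr y x"
    by (rule phi_eq[THEN iffD1]) (unfold phi_simps phi_ebr, rule skew_even[OF phi_even phi_even])
  show "ebr x (ebr y w) = ebr (ebr x y) w + ebr y (ebr x w)"
  proof (rule phi_eq[THEN iffD1])
    have "\<phi> (ebr x (ebr y w)) = brk G (\<phi> x) (brk G (\<phi> y) (\<phi> w))"
      by (simp add: phi_psi brk_even_even phi_even)
    also have "\<dots> = brk G (brk G (\<phi> x) (\<phi> y)) (\<phi> w) + brk G (\<phi> y) (brk G (\<phi> x) (\<phi> w))"
      by (rule jacobi_even[OF phi_even phi_even phi_even])
    also have "\<dots> = \<phi> (ebr (ebr x y) w + ebr y (ebr x w))"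
      by (simp add: phi_psi phi_add brk_even_even phi_even)
    finally show "\<phi> (ebr x (ebr y w)) = \<phi> (ebr (ebr x y) w + ebr y (ebr x w))" .
  qed
  show "eform (x + y) w = eform x w + eform y w" "eform (c *s x) w = c * eform x w"
    by (simp_all add: phi_simps phi_even bilinear_simps)
  show "eform x y = eform y x" by (rule form_even_sym[OF phi_even phi_even])
  show "eform (ebr x y) w = eform x (ebr y w)"
    by (simp add: phi_ebr form_invariant even_whole phi_even)
next
  fix x assume "\<And>y. eform x y = 0"
  then have "form G (\<phi> x) y = 0" if "y \<in> Ev" for y using phi_psi[OF that] by metis
  then have "\<phi> x = 0" by (rule nondegenerate_even[OF phi_even])
  then show "x = 0" using phi_eq[of x 0] by (simp add: phi_zero)
next
  fix x assume x: "\<And>y. ebr x y = 0"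
  show "eform x x = 0"
  proof (rule central_isotropic[OF dim_even even_indecomposable phi_even])
    fix y assume "y \<in> Ev"
    then have "brk G (\<phi> x) y = \<phi> (ebr x (\<psi> y))" by (simp add: phi_psi brk_even_even phi_even)
    then show "brk G (\<phi> x) y = 0" using x by (simp add: phi_zero)
  qed
qed simp

end

section \<open>Bracket tables with odd entries\<close>

lemma (in quadratic_lie) realizes_expand:
  assumes "realizes L e"
  shows "\<exists>c. x = (\<Sum>k\<in>even_gens. c k *s e k)"
proof -
  have v: "B (e i) (e j) = std_form (bv i) (bv j)" if "i \<in> even_gens" "j \<in> even_gens" for i j
    using assms that by (simp add: realizes_def)
  \<comment> \<open>The Gram matrix prescribed by \<open>std_form\<close> makes each
    \<open>Z\<close> generator and its \<open>X\<close> generator a hyperbolic pair, so coefficients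
    are pairings with the dual generator.\<close>
  have hb: "hbasis (e Z3) (e X3) (e Z1) (e X1) (e Z2) (e X2)"
    by (simp add: hbasis_def hyp_def perp2_def v even_gens_def std_form_def axis_def)
  let ?c = "\<lambda>k. case k of Z1 \<Rightarrow> B x (e X1) | Z2 \<Rightarrow> B x (e X2) | Z3 \<Rightarrow> B x (e X3)
    | X1 \<Rightarrow> B x (e Z1) | X2 \<Rightarrow> B x (e Z2) | X3 \<Rightarrow> B x (e Z3)"
  have "x = (\<Sum>k\<in>even_gens. ?c k *s e k)"
    by (rule hbasis_eqI[OF hb]; simp add: even_gens_def bilin hbasis_values[OF hb])
  then show ?thesis by blast
qed

text \<open>Links two kinds of sums: \<open>realizes\<close> expands a bracket over the even
  generators, \<open>comb\<close> over all of them.\<close>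

definition even_valued :: "(gen \<times> gen \<times> vec8) list \<Rightarrow> bool" where
  "even_valued L \<longleftrightarrow> (\<forall>(i, j, v)\<in>set L. v \<in> coord_space even_gens)"

lemma table_brk_even_valued:
  assumes "even_valued L"
  shows "table_brk L x y \<in> coord_space even_gens"
  using assms
proof (induction L)
  case Nil
  then show ?case by (simp add: table_brk_def vec.subspace_0[OF coord_space_subspace])
next
  case (Cons t L)
  obtain i j v where t: "t = (i, j, v)" by (cases t)
  have "v \<in> coord_space even_gens" "table_brk L x y \<in> coord_space even_gens"
    using Cons by (auto simp: t even_valued_def)
  moreover have "table_brk (t # L) x y = (x $ i * y $ j -
      (if i = j then 0 else (-1) ^ (gdeg i * gdeg j) * (x $ j * y $ i))) *s v + table_brk L x y"
    by (simp add: t table_brk_def)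
  ultimately show ?case
    by (metis coord_space_subspace vec.subspace_add vec.subspace_scale)
qed

lemma even_valued_tables: "even_valued table61" "even_valued (table62 l)" "even_valued table63"
  by (auto simp: even_valued_def table61_def table62_def table63_def coord_space_def even_gens_def axis_def)

lemma table_brk_append: "table_brk (L @ M) x y = table_brk L x y + table_brk M x y"
  by (simp add: table_brk_def)

text \<open>The table \<open>M\<close> lists the brackets with odd entries determined by \<open>[Y, Y] = 0\<close>,
  \<open>[Y, T] = a\<close>, \<open>[T, T] = b\<close> and invariance of the form.\<close>

definition odd_extension :: "(gen \<times> gen \<times> vec8) list \<Rightarrow> (gen \<times> gen \<times> vec8) list \<Rightarrow> vec8 \<Rightarrow> vec8 \<Rightarrow> bool" where
  "odd_extension L M a b \<longleftrightarrow>
    (\<forall>i\<in>even_gens. (\<forall>j\<in>even_gens. table_brk M (bv i) (bv j) = 0) \<and>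
      table_brk (L @ M) (bv i) (bv Y1) = std_form (bv i) a *s bv Y1 \<and>
      table_brk (L @ M) (bv Y1) (bv i) = - std_form (bv i) a *s bv Y1 \<and>
      table_brk (L @ M) (bv i) (bv T1) = std_form (bv i) b *s bv Y1 + (- std_form (bv i) a) *s bv T1 \<and>
      table_brk (L @ M) (bv T1) (bv i) = (- std_form (bv i) b) *s bv Y1 + std_form (bv i) a *s bv T1) \<and>
    table_brk (L @ M) (bv Y1) (bv Y1) = 0 \<and> table_brk (L @ M) (bv Y1) (bv T1) = a \<and>
    table_brk (L @ M) (bv T1) (bv Y1) = a \<and> table_brk (L @ M) (bv T1) (bv T1) = b \<and>
    a \<in> coord_space even_gens \<and> b \<in> coord_space even_gens"

lemmas odd_extension_simps = odd_extension_def even_gens_def table61_def table62_def table63_def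
  table_brk_def std_form_def axis_def coord_space_def vec_eq_iff

text \<open>The lists repeat the definitions of the models literally, including entries with
  coefficient 0, so that unfolding a model produces exactly the list used here.\<close>

lemma odd_extensions:
  "odd_extension table61 [(X1, Y1, 0 *s bv Y1), (X1, T1, - (0 *s bv T1)), (X2, Y1, 0 *s bv Y1), (X2, T1, - (0 *s bv T1)),
      (X3, Y1, n *s bv Y1), (X3, T1, - (n *s bv T1)), (Y1, T1, 0 *s bv Z1 + 0 *s bv Z2 + n *s bv Z3)] (n *s bv Z3) 0"
  "odd_extension table61 [(X1, T1, 0 *s bv Y1), (X2, T1, 0 *s bv Y1), (X3, T1, bv Y1),
      (T1, T1, 0 *s bv Z1 + 0 *s bv Z2 + bv Z3)] 0 (bv Z3)"
  "odd_extension (table62 l) [(X3, T1, bv Y1), (T1, T1, bv Z3)] 0 (bv Z3)"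
  "odd_extension (table62 l) [(X3, Y1, n *s bv Y1), (X3, T1, - (n *s bv T1)), (Y1, T1, n *s bv Z3)] (n *s bv Z3) 0"
  "odd_extension (table62 l) [(X3, Y1, (1/2) *s bv Y1), (X3, T1, - ((1/2) *s bv T1)), (Z1, T1, bv Y1),
      (Y1, T1, (1/2) *s bv Z3), (T1, T1, bv X1)] ((1/2) *s bv Z3) (bv X1)"
  "odd_extension table63 [(X3, T1, bv Y1), (T1, T1, bv Z3)] 0 (bv Z3)"
  "odd_extension table63 [(X3, Y1, n *s bv Y1), (X3, T1, - (n *s bv T1)), (Y1, T1, n *s bv Z3)] (n *s bv Z3) 0"
  "odd_extension table63 [(X3, Y1, (1/2) *s bv Y1), (X3, T1, - ((1/2) *s bv T1)), (Z2, T1, bv Y1),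
      (Y1, T1, (1/2) *s bv Z3), (T1, T1, bv X2)] ((1/2) *s bv Z3) (bv X2)"
  by (simp_all add: odd_extension_simps)

context even_coordinates
begin

lemma phi_sum: "\<phi> (\<Sum>k\<in>K. c k *s e k) = (\<Sum>k\<in>K. c k \<cdot> \<phi> (e k))"
  by (induction K rule: infinite_finite_induct) (simp_all add: phi_simps)

lemma form_comb:
  assumes e: "lie.realizes L e" and i: "i \<in> even_gens" and a: "a \<in> coord_space even_gens"
  shows "form G (\<phi> (e i)) (\<phi> (\<Sum>k\<in>even_gens. a $ k *s e k)) = std_form (bv i) a"
proof (rule vec8_linear_eq[where s = "(*)" and g = "\<lambda>a. std_form (bv i) a"
      and f = "\<lambda>a. form G (\<phi> (e i)) (\<phi> (\<Sum>k\<in>even_gens. a $ k *s e k))", OF _ _ _ _ _ a])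
  fix x y :: vec8 and c :: complex
  have 1: "(\<Sum>k\<in>even_gens. (x + y) $ k *s e k) = (\<Sum>k\<in>even_gens. x $ k *s e k) + (\<Sum>k\<in>even_gens. y $ k *s e k)"
    by (simp add: vec.scale_left_distrib sum.distrib)
  have 2: "(\<Sum>k\<in>even_gens. (c *s x) $ k *s e k) = c *s (\<Sum>k\<in>even_gens. x $ k *s e k)"
    by (simp add: vec.scale_sum_right)
  show "form G (\<phi> (e i)) (\<phi> (\<Sum>k\<in>even_gens. (x + y) $ k *s e k)) =
      form G (\<phi> (e i)) (\<phi> (\<Sum>k\<in>even_gens. x $ k *s e k)) + form G (\<phi> (e i)) (\<phi> (\<Sum>k\<in>even_gens. y $ k *s e k))"
    unfolding 1 by (rule lie.B_add2)
  show "form G (\<phi> (e i)) (\<phi> (\<Sum>k\<in>even_gens. (c *s x) $ k *s e k)) =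
      c * form G (\<phi> (e i)) (\<phi> (\<Sum>k\<in>even_gens. x $ k *s e k))"
    unfolding 2 by (rule lie.B_scale2)
next
  fix j assume j: "j \<in> even_gens"
  have "(\<Sum>k\<in>even_gens. bv j $ k *s e k) = e j"
    using j by (simp add: axis_def if_distrib[of "\<lambda>c. c *s _"] cong: if_cong)
  then show "form G (\<phi> (e i)) (\<phi> (\<Sum>k\<in>even_gens. bv j $ k *s e k)) = std_form (bv i) (bv j)"
    using e i j by (simp add: lie.realizes_def)
qed (simp_all add: std_form_linear)

lemma realizes_span_even:
  assumes "lie.realizes L e" "x \<in> Ev"
  shows "\<exists>c. x = (\<Sum>k\<in>even_gens. c k \<cdot> \<phi> (e k))"
proof -
  obtain c where "\<psi> x = (\<Sum>k\<in>even_gens. c k *s e k)" using lie.realizes_expand[OF assms(1)] by blast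
  then have "x = \<phi> (\<Sum>k\<in>even_gens. c k *s e k)" using phi_psi[OF assms(2)] by simp
  then show ?thesis unfolding phi_sum by blast
qed

lemma realizes_brk:
  assumes e: "lie.realizes L e" and L: "even_valued L" and f: "\<And>i. i \<in> even_gens \<Longrightarrow> f i = \<phi> (e i)"
    and ij: "i \<in> even_gens" "j \<in> even_gens"
  shows "brk G (f i) (f j) = comb f (table_brk L (bv i) (bv j))"
proof -
  have "brk G (f i) (f j) = \<phi> (ebr (e i) (e j))" using ij by (simp add: f phi_psi brk_even_even phi_even)
  also have "\<dots> = \<phi> (\<Sum>k\<in>even_gens. table_brk L (bv i) (bv j) $ k *s e k)"
    using e ij by (simp add: lie.realizes_def)
  also have "\<dots> = comb f (table_brk L (bv i) (bv j))"
    by (simp add: phi_sum comb_coord[OF table_brk_even_valued[OF L]] f)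
  finally show ?thesis .
qed

lemma i_isomorphic_alg6:
  assumes e: "lie.realizes L e" and L: "even_valued L"
  shows "i_isomorphic (even_algebra G) (alg6 L)"
proof -
  interpret A: quadratic_lie_superalgebra "even_algebra G" by (rule even_algebra_quadratic)
  have sel: "scal (even_algebra G) = scal G" "even_part (even_algebra G) = Ev" "odd_part (even_algebra G) = {0}"
    "brk (even_algebra G) = brk G" "form (even_algebra G) = form G"
    by (simp_all add: even_algebra_def)
  have comb: "A.comb = comb" by (intro ext) (simp add: A.comb_def comb_def sel)
  define f where "f i = (if i \<in> even_gens then \<phi> (e i) else 0)" for i
  have zero: "coord_space {} = {0}" by (auto simp: coord_space_def vec_eq_iff)
  show ?thesis
  proof (rule A.i_isomorphic_model[where S = even_gens and L = L and e = f])
    show "\<And>x. x \<in> even_part (even_algebra G) \<Longrightarrow> \<exists>c. x = (\<Sum>i\<in>even_gens. scal (even_algebra G) (c i) (f i))"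
      using realizes_span_even[OF e] by (simp add: sel f_def)
    show "\<And>i j. i \<in> even_gens \<Longrightarrow> j \<in> even_gens \<Longrightarrow> form (even_algebra G) (f i) (f j) = std_form (bv i) (bv j)"
      using e by (simp add: sel f_def lie.realizes_def)
    show "\<And>i j. i \<in> even_gens \<Longrightarrow> j \<in> even_gens \<Longrightarrow>
        brk (even_algebra G) (f i) (f j) = A.comb f (table_brk L (bv i) (bv j))"
      unfolding sel comb by (rule realizes_brk[OF e L]) (simp_all add: f_def)
    show "\<And>x. x \<in> coord_space even_gens \<Longrightarrow> (\<And>i. i \<in> even_gens \<Longrightarrow> std_form x (bv i) = 0) \<Longrightarrow> x = 0"
    proof (rule std_form_nondegenerate)
      fix x i assume x: "x \<in> coord_space even_gens" "\<And>i. i \<in> even_gens \<Longrightarrow> std_form x (bv i) = 0"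
      show "std_form x (bv i) = 0"
      proof (cases "i \<in> even_gens")
        case False
        then have "i = Y1 \<or> i = T1" by (cases i) (auto simp: even_gens_def)
        then show ?thesis using x(1) by (auto simp: std_form_def axis_def coord_space_def even_gens_def)
      qed (use x in auto)
    qed
  qed (use table_brk_even_valued[OF L] phi_even
      in \<open>auto simp: alg6_def sel even_space_coord f_def zero\<close>)
qed

text \<open>\<open>odd_action\<close> recovers every bracket with one odd entry from
  \<open>[Y, Y] = 0\<close>, \<open>a\<close> and \<open>b\<close>, and \<open>odd_extension\<close>
  gives the table the same brackets. Hence a realization of the even table extends to the whole
  algebra.\<close>

lemma i_isomorphic_alg8:
  assumes e: "lie.realizes L e" and L: "even_valued L" and M: "odd_extension L M a b"
    and YT: "Y \<in> Od" "T \<in> Od" "form G Y T = 1" "brk G Y Y = 0"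
    and a: "brk G Y T = \<phi> (\<Sum>k\<in>even_gens. a $ k *s e k)"
    and b: "brk G T T = \<phi> (\<Sum>k\<in>even_gens. b $ k *s e k)"
  shows "i_isomorphic G (alg8 (L @ M))"
proof -
  define f where "f i = (if i = Y1 then Y else if i = T1 then T else \<phi> (e i))" for i
  have fe: "f i = \<phi> (e i)" if "i \<in> even_gens" for i using that by (auto simp: f_def even_gens_def)
  have fE: "f i \<in> Ev" if "i \<in> even_gens" for i using fe[OF that] phi_even by simp
  have fYT: "f Y1 = Y" "f T1 = T" by (simp_all add: f_def)
  have odd: "UNIV - even_gens = {Y1, T1}" by (auto simp: even_gens_def UNIV_gen)
  have cases: "i \<in> even_gens \<or> i = Y1 \<or> i = T1" for i using odd by blast
  note M = M[unfolded odd_extension_def]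
  have M1: "table_brk M (bv i) (bv j) = 0" if "i \<in> even_gens" "j \<in> even_gens" for i j using M that by blast
  have aE: "a \<in> coord_space even_gens" and bE: "b \<in> coord_space even_gens" using M by blast+
  have fa: "form G (f i) (brk G Y T) = std_form (bv i) a" if "i \<in> even_gens" for i
    unfolding a fe[OF that] by (rule form_comb[OF e that aE])
  have fb: "form G (f i) (brk G T T) = std_form (bv i) b" if "i \<in> even_gens" for i
    unfolding b fe[OF that] by (rule form_comb[OF e that bE])
  have act: "brk G (f i) Y = std_form (bv i) a \<cdot> Y" "brk G (f i) T = std_form (bv i) b \<cdot> Y - std_form (bv i) a \<cdot> T"
    if "i \<in> even_gens" for i
    using odd_action[OF dim_odd YT(1-3) fE[OF that]] fE[OF that] by (simp_all add: fa fb that YT(4) form_zero even_whole)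
  have act': "brk G Y (f i) = - (std_form (bv i) a \<cdot> Y)"
      "brk G T (f i) = - (std_form (bv i) b \<cdot> Y - std_form (bv i) a \<cdot> T)"
    if "i \<in> even_gens" for i
    using skew_even_odd[OF fE[OF that] YT(1)] skew_even_odd[OF fE[OF that] YT(2)] act[OF that] by simp_all
  have ca: "comb f a = brk G Y T" and cb: "comb f b = brk G T T"
    by (simp_all add: a b phi_sum comb_coord[OF aE] comb_coord[OF bE] fe)
  have TY: "brk G T Y = brk G Y T" using sym_odd YT by blast
  have comb0: "comb f 0 = 0" by (simp add: comb_def)
  show ?thesis
  proof (rule i_isomorphic_model[where S = UNIV and L = "L @ M" and e = f])
    show "\<exists>c. x = (\<Sum>i\<in>even_gens. c i \<cdot> f i)" if "x \<in> Ev" for x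
      using realizes_span_even[OF e that] by (simp add: fe)
    show "\<exists>c. x = (\<Sum>i\<in>UNIV - even_gens. c i \<cdot> f i)" if x: "x \<in> Od" for x
    proof -
      have "x = form G x T \<cdot> Y - form G x Y \<cdot> T"
        using odd_plane_identity[OF dim_odd x YT(1,2)] YT(3) by simp
      then have "x = (\<Sum>i\<in>UNIV - even_gens. (if i = Y1 then form G x T else - form G x Y) \<cdot> f i)"
        unfolding odd by (simp add: fYT)
      then show ?thesis by (intro exI[of _ "\<lambda>i. if i = Y1 then form G x T else - form G x Y"]) simp
    qed
    show "form G (f i) (f j) = std_form (bv i) (bv j)" for i j
    proof -
      have ee: "form G (f i) (f j) = std_form (bv i) (bv j)" if "i \<in> even_gens" "j \<in> even_gens"
        using e that by (simp add: fe lie.realizes_def)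
      have TYf: "form G T Y = - 1" using form_odd_skew[OF YT(2,1)] YT(3) by simp
      have eo: "std_form (bv i) (bv j) = 0" "std_form (bv j) (bv i) = 0"
        if "i \<in> even_gens" "j = Y1 \<or> j = T1" for i j
        using that by (auto simp: even_gens_def std_form_def axis_def)
      have oo: "std_form (bv Y1) (bv Y1) = 0" "std_form (bv Y1) (bv T1) = 1" "std_form (bv T1) (bv Y1) = - 1"
        "std_form (bv T1) (bv T1) = 0" by (simp_all add: std_form_def axis_def)
      show ?thesis
        using cases[of i] cases[of j]
        by (elim disjE) (simp_all add: ee eo oo fYT TYf YT form_odd_self form_even form_odd_even fE)
    qed
    show "brk G (f i) (f j) = comb f (table_brk (L @ M) (bv i) (bv j))" for i j
    proof -
      have ee: "brk G (f i) (f j) = comb f (table_brk (L @ M) (bv i) (bv j))" if "i \<in> even_gens" "j \<in> even_gens"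
        using realizes_brk[OF e L fe that] M1[OF that] by (simp add: table_brk_append)
      have eo: "brk G (f i) Y = comb f (table_brk (L @ M) (bv i) (bv Y1))"
        "brk G Y (f i) = comb f (table_brk (L @ M) (bv Y1) (bv i))"
        "brk G (f i) T = comb f (table_brk (L @ M) (bv i) (bv T1))"
        "brk G T (f i) = comb f (table_brk (L @ M) (bv T1) (bv i))"
        if i: "i \<in> even_gens" for i
      proof -
        have t: "table_brk (L @ M) (bv i) (bv Y1) = std_form (bv i) a *s bv Y1"
          "table_brk (L @ M) (bv Y1) (bv i) = - std_form (bv i) a *s bv Y1"
          "table_brk (L @ M) (bv i) (bv T1) = std_form (bv i) b *s bv Y1 + (- std_form (bv i) a) *s bv T1"
          "table_brk (L @ M) (bv T1) (bv i) = (- std_form (bv i) b) *s bv Y1 + std_form (bv i) a *s bv T1"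
          using M i by blast+
        show "brk G (f i) Y = comb f (table_brk (L @ M) (bv i) (bv Y1))"
          "brk G Y (f i) = comb f (table_brk (L @ M) (bv Y1) (bv i))"
          "brk G (f i) T = comb f (table_brk (L @ M) (bv i) (bv T1))"
          "brk G T (f i) = comb f (table_brk (L @ M) (bv T1) (bv i))"
          unfolding t comb_linear comb_bv fYT by (simp_all add: act[OF i] act'[OF i])
      qed
      have oo: "table_brk (L @ M) (bv Y1) (bv Y1) = 0" "table_brk (L @ M) (bv Y1) (bv T1) = a"
        "table_brk (L @ M) (bv T1) (bv Y1) = a" "table_brk (L @ M) (bv T1) (bv T1) = b"
        using M by blast+
      show ?thesis
        using cases[of i] cases[of j]
        by (elim disjE) (simp_all add: ee eo oo fYT YT TY ca cb comb0)
    qed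
    show "x = 0" if "\<And>i. i \<in> UNIV \<Longrightarrow> std_form x (bv i) = 0" for x
      using std_form_nondegenerate that by blast
  qed (use fE in \<open>auto simp: alg8_def even_space_coord odd_space_coord odd fYT YT coord_space_def\<close>)
qed

end

section \<open>Decomposability and solvability\<close>

context quadratic_lie_superalgebra
begin

lemma derived_power_subspace: "subspace ((derived G ^^ k) W)"
  by (cases k) (simp_all add: whole_subspace derived_def)

lemma brk_derived: "x \<in> V \<Longrightarrow> y \<in> V \<Longrightarrow> brk G x y \<in> derived G V"
  unfolding derived_def by (rule span_base) blast

lemma derived_power_brk:
  "x \<in> (derived G ^^ k) W \<Longrightarrow> y \<in> (derived G ^^ k) W \<Longrightarrow> brk G x y \<in> (derived G ^^ Suc k) W"
  by (simp add: brk_derived)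

text \<open>Nondegeneracy on \<open>I\<close> supplies an odd vector of \<open>I\<close> pairing
  nontrivially with \<open>y\<close>; the two span the odd plane by
  \<open>odd_plane_identity\<close>.\<close>

lemma odd_ideal_contains_odd:
  assumes d: "sdim G Od = 2" and I: "graded_ideal G I" "nondegenerate_on G I" and y: "y \<in> I" "y \<in> Od" "y \<noteq> 0"
  shows "Od \<subseteq> I"
proof
  fix x assume x: "x \<in> Od"
  note g = I(1)[unfolded graded_ideal_def]
  have sI: "subspace I" using g by blast
  obtain y0 where y0: "y0 \<in> I" "form G y y0 \<noteq> 0" using I(2) y unfolding nondegenerate_on_def by blast
  obtain a b where ab: "a \<in> I" "a \<in> Ev" "b \<in> I" "b \<in> Od" "y0 = a + b" using g y0(1) by blast
  have "form G y b \<noteq> 0" using y0(2) ab y by (simp add: bilinear_simps form_odd_even)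
  moreover have "form G y b \<cdot> x \<in> I"
    unfolding odd_plane_identity[OF d x y(2) ab(4)]
    by (intro subspace_diff[OF sI] subspace_scale[OF sI] y(1) ab(3))
  ultimately have "(1 / form G y b) \<cdot> (form G y b \<cdot> x) \<in> I" "form G y b \<noteq> 0"
    using subspace_scale[OF sI] by blast+
  then show "x \<in> I" by simp
qed

text \<open>A nondegenerate ideal \<open>I\<close> meets the even part in a nondegenerate ideal,
  hence in 0 or in everything. In the first case \<open>I\<close> contains the odd part, so brackets
  of odd vectors vanish, and invariance gives the claim. In the second case \<open>I\<close> has no
  nonzero odd vector, yet it contains \<open>brk G x y\<close>.\<close>

lemma decomposable_trivial_action:
  assumes d: "sdim G Od = 2" and ind: "indecomposable (even_algebra G)" and dec: "decomposable G"
    and x: "x \<in> Ev" and y: "y \<in> Od"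
  shows "brk G x y = 0"
proof -
  obtain I where I: "graded_ideal G I" "nondegenerate_on G I" "I \<noteq> {0}" "I \<noteq> W"
    using dec by (auto simp: decomposable_def)
  note g = I(1)[unfolded graded_ideal_def]
  have sI: "subspace I" and IW: "I \<subseteq> W" using g by blast+
  have split: "\<exists>a\<in>I \<inter> Ev. \<exists>b\<in>I \<inter> Od. v = a + b" if "v \<in> I" for v using g that by blast
  have idl: "brk G v w \<in> I" "brk G w v \<in> I" if "v \<in> W" "w \<in> I" for v w using g that by blast+
  have sel: "scal (even_algebra G) = scal G" "even_part (even_algebra G) = Ev" "odd_part (even_algebra G) = {0}"
    "brk (even_algebra G) = brk G" "form (even_algebra G) = form G"
    by (simp_all add: even_algebra_def)
  let ?I = "I \<inter> Ev"
  have "graded_ideal (even_algebra G) ?I"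
    unfolding graded_ideal_def sel whole_even_algebra
  proof (intro conjI ballI)
    show "subspace ?I" using sI even_subspace by (rule subspace_inter)
    show "?I \<subseteq> Ev" by blast
    fix v assume "v \<in> ?I"
    then show "\<exists>a\<in>?I \<inter> Ev. \<exists>b\<in>?I \<inter> {0}. v = a + b"
      by (intro bexI[of _ v] bexI[of _ 0]) (auto simp: subspace_0[OF sI] Ev_closed)
  next
    fix v w assume "v \<in> Ev" "w \<in> ?I"
    then show "brk G v w \<in> ?I" "brk G w v \<in> ?I" using idl even_whole brk_even_even by auto
  qed
  moreover have "nondegenerate_on (even_algebra G) ?I"
    unfolding nondegenerate_on_def sel
  proof (intro ballI impI)
    fix v assume v: "v \<in> ?I" "\<forall>w\<in>?I. form G v w = 0"
    have "form G v w = 0" if "w \<in> I" for w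
    proof -
      obtain a b where "a \<in> ?I" "b \<in> I \<inter> Od" "w = a + b" using split[OF \<open>w \<in> I\<close>] by blast
      then show ?thesis using v by (simp add: bilinear_simps form_even)
    qed
    then show "v = 0" using I(2) v(1) unfolding nondegenerate_on_def by blast
  qed
  ultimately consider "?I = {0}" | "?I = Ev"
    using ind by (auto simp: decomposable_def whole_even_algebra)
  then show ?thesis
  proof cases
    case 1
    obtain v where v: "v \<in> I" "v \<noteq> 0" using I(3) subspace_0[OF sI] by blast
    obtain a b where ab: "a \<in> ?I" "b \<in> I" "b \<in> Od" "v = a + b" using split[OF v(1)] by blast
    then have "b \<noteq> 0" using 1 v(2) by auto
    then have OI: "Od \<subseteq> I" using odd_ideal_contains_odd[OF d I(1,2) ab(2,3)] by blast
    have "form G (brk G x y) w = 0" if w: "w \<in> Od" for w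
    proof -
      have "brk G y w \<in> ?I" using idl(2)[OF odd_whole[OF w]] OI y w brk_odd_odd by auto
      then have "brk G y w = 0" using 1 by blast
      then show ?thesis using x y w by (simp add: form_invariant bilinear_simps)
    qed
    then show ?thesis by (rule nondegenerate_odd[OF brk_even_odd[OF x y]])
  next
    case 2
    have "v = 0" if "v \<in> I" "v \<in> Od" for v
    proof (rule ccontr)
      assume "v \<noteq> 0"
      then have "Od \<subseteq> I" using odd_ideal_contains_odd[OF d I(1,2) that] by blast
      then have "W \<subseteq> I" using 2 subspace_add[OF sI] by (auto simp: whole_def)
      then show False using I(4) IW by blast
    qed
    moreover have "brk G x y \<in> I" using idl(2)[OF odd_whole[OF y], of x] 2 x by blast
    ultimately show ?thesis using brk_even_odd[OF x y] by blast
  qed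
qed

lemma even_part_ideal:
  assumes 0: "\<And>x y. x \<in> Ev \<Longrightarrow> y \<in> Od \<Longrightarrow> brk G x y = 0"
  shows "graded_ideal G Ev"
  unfolding graded_ideal_def
proof (intro conjI ballI)
  fix x assume "x \<in> Ev"
  then show "\<exists>a\<in>Ev \<inter> Ev. \<exists>b\<in>Ev \<inter> Od. x = a + b"
    by (intro bexI[of _ x] bexI[of _ 0]) (auto simp: bilinear_simps)
next
  fix x y assume "x \<in> W" and y: "y \<in> Ev"
  then obtain a b where ab: "a \<in> Ev" "b \<in> Od" "x = a + b" using whole_split by blast
  then show "brk G x y \<in> Ev" "brk G y x \<in> Ev"
    using y 0 skew_even_odd[OF y ab(2)] by (simp_all add: bilinear_simps)
qed (use even_subspace even_whole in auto)

lemma trivial_action_decomposable: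
  assumes d: "sdim G Ev = 6" "sdim G Od = 2" and 0: "\<And>x y. x \<in> Ev \<Longrightarrow> y \<in> Od \<Longrightarrow> brk G x y = 0"
  shows "decomposable G"
proof -
  obtain u w where u: "u \<in> Od" "w \<in> Od" "form G u w = 1" by (rule odd_basis[OF d(2)])
  have "u \<noteq> 0" using u by (auto simp: bilinear_simps)
  then have "u \<notin> Ev" using u(1) direct by blast
  then have "Ev \<noteq> W" using odd_whole[OF u(1)] by blast
  moreover have "Ev \<noteq> {0}"
  proof
    assume "Ev = {0}"
    then have "dim Ev \<le> card ({} :: 'a set)" by (intro dim_le_card) auto
    then show False using d by (simp add: sdim_def)
  qed
  moreover have "nondegenerate_on G Ev" using nondegenerate_even by (auto simp: nondegenerate_on_def)
  ultimately show ?thesis using even_part_ideal[OF 0] by (auto simp: decomposable_def)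
qed

lemma orthogonal_sum_parts:
  assumes 0: "\<And>x y. x \<in> Ev \<Longrightarrow> y \<in> Od \<Longrightarrow> brk G x y = 0"
  shows "orthogonal_direct_sum G Ev Od"
proof -
  \<comment> \<open>By invariance the bracket of two odd vectors pairs with \<open>w\<close> through
    \<open>brk G w x\<close>, which is 0.\<close>
  have oo: "brk G x y = 0" if "x \<in> Od" "y \<in> Od" for x y
  proof (rule nondegenerate_even[OF brk_odd_odd[OF that]])
    fix w assume w: "w \<in> Ev"
    have "form G w (brk G x y) = form G (brk G w x) y" using w that by (simp add: form_invariant bilinear_simps)
    then show "form G (brk G x y) w = 0"
      using 0[OF w that(1)] form_even_sym[OF w brk_odd_odd[OF that]] that by (simp add: bilinear_simps)
  qed
  have "graded_ideal G Od"
    unfolding graded_ideal_def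
  proof (intro conjI ballI)
    fix x assume "x \<in> Od"
    then show "\<exists>a\<in>Od \<inter> Ev. \<exists>b\<in>Od \<inter> Od. x = a + b"
      by (intro bexI[of _ 0] bexI[of _ x]) (auto simp: bilinear_simps)
  next
    fix x y assume "x \<in> W" and y: "y \<in> Od"
    then obtain a b where ab: "a \<in> Ev" "b \<in> Od" "x = a + b" using whole_split by blast
    then show "brk G x y \<in> Od" "brk G y x \<in> Od"
      using y 0 oo skew_even_odd[OF ab(1) y] by (simp_all add: bilinear_simps)
  qed (use odd_subspace odd_whole in auto)
  then show ?thesis
    using even_part_ideal[OF 0] direct form_even form_odd_even
    by (simp add: orthogonal_direct_sum_def whole_def)
qed

lemma symplectic_odd: "symplectic_on G Od"
  unfolding symplectic_on_def nondegenerate_on_def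
  using odd_subspace nondegenerate_odd by (auto simp: bilinear_simps form_odd_self)

end

section \<open>Consequences of solvability and the final case distinction\<close>

context even_coordinates
begin

text \<open>The even trace of the derived series of the whole superalgebra. It may exceed the
  derived series of the even part, but it is a chain as required by \<open>center_nontrivial\<close>
  and \<open>solvable_dependent_triple\<close>.\<close>

definition D where "D k = {x. \<phi> x \<in> (derived G ^^ k) W}"

lemma pullback_derived:
  shows "D 0 = UNIV" "vec.subspace (D k)" "x \<in> D k \<Longrightarrow> y \<in> D k \<Longrightarrow> ebr x y \<in> D (Suc k)"
    "(derived G ^^ k) W = {0} \<Longrightarrow> D k = {0}"
proof -
  show "D 0 = UNIV" by (simp add: D_def even_whole phi_even)
  show "vec.subspace (D k)"
    unfolding vec.subspace_def D_def
    using derived_power_subspace[of k] by (auto simp: phi_simps subspace_def)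
  show "ebr x y \<in> D (Suc k)" if "x \<in> D k" "y \<in> D k"
    using derived_power_brk that by (simp add: D_def phi_psi brk_even_even phi_even del: funpow.simps)
  show "D k = {0}" if "(derived G ^^ k) W = {0}"
    using that phi_eq[of _ 0] by (auto simp: D_def phi_zero)
qed

lemma center_nontrivial_even:
  assumes "solvable G"
  obtains z where "z \<noteq> 0" "lie.central z"
proof -
  obtain K where K: "(derived G ^^ K) W = {0}" using assms by (auto simp: solvable_def)
  have "\<exists>z. z \<noteq> 0 \<and> lie.central z"
    using pullback_derived(1,2) pullback_derived(3) pullback_derived(4)[OF K]
    by (rule lie.center_nontrivial[of D])
  then show ?thesis using that by blast
qed

lemma odd_relation:
  assumes "solvable G" and u: "u \<in> Od" "w \<in> Od" "form G u w = 1"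
  shows "\<exists>c1 c2 c3. (c1, c2, c3) \<noteq> (0, 0, 0) \<and>
    c1 \<cdot> brk G u u + c2 \<cdot> brk G u w + c3 \<cdot> brk G w w = 0"
proof -
  obtain K where K: "(derived G ^^ K) W = {0}" using assms by (auto simp: solvable_def)
  have sq: "\<phi> (\<psi> (brk G u u)) = brk G u u" "\<phi> (\<psi> (brk G u w)) = brk G u w" "\<phi> (\<psi> (brk G w w)) = brk G w w"
    using u by (simp_all add: phi_psi brk_odd_odd)
  have ph: "x = y" if "\<phi> x = \<phi> y" for x y using that phi_eq by blast
  note act = even_action_on_squares[OF dim_odd u phi_even]
  have psi: "\<psi> (brk G (\<phi> x) (brk G u u)) = 2 *s (form G (\<phi> x) (brk G u w) *s \<psi> (brk G u u) - form G (\<phi> x) (brk G u u) *s \<psi> (brk G u w))"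
    "\<psi> (brk G (\<phi> x) (brk G u w)) = form G (\<phi> x) (brk G w w) *s \<psi> (brk G u u) - form G (\<phi> x) (brk G u u) *s \<psi> (brk G w w)"
    "\<psi> (brk G (\<phi> x) (brk G w w)) = 2 *s (form G (\<phi> x) (brk G w w) *s \<psi> (brk G u w) - form G (\<phi> x) (brk G u w) *s \<psi> (brk G w w))"
    for x
    unfolding act by (rule ph; simp add: phi_simps sq phi_psi bilinear_simps u scale_right_diff_distrib)+
  have "\<exists>c1 c2 c3. (c1, c2, c3) \<noteq> (0, 0, 0) \<and>
      c1 *s \<psi> (brk G u u) + c2 *s \<psi> (brk G u w) + c3 *s \<psi> (brk G w w) = 0"
    using psi pullback_derived(1,2) pullback_derived(3) pullback_derived(4)[OF K]
    by (rule lie.solvable_dependent_triple[of "\<psi> (brk G u u)" "\<psi> (brk G u w)" "\<psi> (brk G w w)" D K, unfolded sq])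
  then obtain c1 c2 c3 where c: "(c1, c2, c3) \<noteq> (0, 0, 0)"
      "c1 *s \<psi> (brk G u u) + c2 *s \<psi> (brk G u w) + c3 *s \<psi> (brk G w w) = 0" by blast
  have "\<phi> (c1 *s \<psi> (brk G u u) + c2 *s \<psi> (brk G u w) + c3 *s \<psi> (brk G w w)) = 0"
    using c(2) by (simp only: phi_zero)
  then have "c1 \<cdot> brk G u u + c2 \<cdot> brk G u w + c3 \<cdot> brk G w w = 0" by (simp add: phi_simps sq)
  then show ?thesis using c(1) by blast
qed

text \<open>The relation between the three brackets is a binary quadratic form; a factorization of it
  yields a vanishing bracket of two vectors.\<close>

lemma odd_commuting_pair:
  assumes "solvable G"
  obtains l l' where "l \<in> Od" "l' \<in> Od" "l \<noteq> 0" "l' \<noteq> 0" "brk G l l' = 0"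
proof -
  obtain u w where u: "u \<in> Od" "w \<in> Od" "form G u w = 1" by (rule odd_basis[OF dim_odd])
  obtain c1 c2 c3 where c: "(c1, c2, c3) \<noteq> (0, 0, 0)"
      "c1 \<cdot> brk G u u + c2 \<cdot> brk G u w + c3 \<cdot> brk G w w = 0" using odd_relation[OF assms u] by blast
  have wu: "brk G w u = brk G u w" using sym_odd u by blast
  have uW: "u \<in> W" "w \<in> W" using u odd_whole by auto
  have lin: "s \<cdot> u + t \<cdot> w \<in> Od" for s t using u by (simp add: bilinear_simps)
  have nz: "s \<cdot> u + t \<cdot> w \<noteq> 0" if "s \<noteq> 0 \<or> t \<noteq> 0" for s t
  proof
    assume 0: "s \<cdot> u + t \<cdot> w = 0"
    have "form G (s \<cdot> u + t \<cdot> w) w = s" "form G u (s \<cdot> u + t \<cdot> w) = t"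
      using u form_odd_self by (simp_all add: bilinear_simps)
    then show False using 0 that uW by (simp add: form_zero)
  qed
  have br: "brk G (s \<cdot> u + t \<cdot> w) (s' \<cdot> u + t' \<cdot> w) =
      (s * s') \<cdot> brk G u u + (s * t' + t * s') \<cdot> brk G u w + (t * t') \<cdot> brk G w w" for s t s' t'
    using u by (simp add: bilinear_simps wu scale_left_distrib algebra_simps)
  show ?thesis
  proof (cases "c1 = 0")
    case True
    show ?thesis
      by (rule that[of "0 \<cdot> u + 1 \<cdot> w" "c2 \<cdot> u + c3 \<cdot> w", OF lin lin nz nz])
        (use True c br[of 0 1 c2 c3] in auto)
  next
    case False
    \<comment> \<open>A square root of the discriminant: \<open>c1 X^2 + c2 X Y + c3 Y^2\<close> is
      the product of \<open>c1 X + (c2 + d)/2 Y\<close> and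
      \<open>X + (c2 - d)/(2 c1) Y\<close>.\<close>
    define d where "d = csqrt (c2\<^sup>2 - 4 * c1 * c3)"
    have d: "d * d = c2\<^sup>2 - 4 * c1 * c3" by (metis d_def power2_csqrt power2_eq_square)
    have e: "c1 * 1 = c1" "c1 * ((c2 - d) / (2 * c1)) + (c2 + d) / 2 * 1 = c2"
      using False by (simp_all add: field_simps)
    have e3: "(c2 + d) / 2 * ((c2 - d) / (2 * c1)) = c3"
      using False d by (simp add: field_simps power2_eq_square)
    show ?thesis
      by (rule that[of "c1 \<cdot> u + ((c2 + d) / 2) \<cdot> w" "1 \<cdot> u + ((c2 - d) / (2 * c1)) \<cdot> w", OF lin lin nz nz])
        (use False in simp, simp, unfold br e e3, rule c(2))
  qed
qed

text \<open>If the commuting vectors \<open>l\<close>, \<open>l'\<close> are proportional, then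
  \<open>[l, l] = 0\<close>. Otherwise \<open>[l, w] = 0\<close> for a multiple \<open>w\<close> of
  \<open>l'\<close>, and acting on this bracket shows that \<open>[l, l]\<close> and
  \<open>[w, w]\<close> are proportional. The square of \<open>l + t w\<close> is then
  \<open>(1 + c t^2) [l, l]\<close>, which vanishes for a suitable \<open>t\<close>.\<close>

lemma odd_isotropic:
  assumes "solvable G"
  obtains Y T where "Y \<in> Od" "T \<in> Od" "form G Y T = 1" "brk G Y Y = 0"
proof -
  have "\<exists>Y\<in>Od. Y \<noteq> 0 \<and> brk G Y Y = 0"
  proof -
    obtain l l' where l: "l \<in> Od" "l' \<in> Od" "l \<noteq> 0" "l' \<noteq> 0" "brk G l l' = 0"
      by (rule odd_commuting_pair[OF assms])
    show ?thesis
    proof (cases "form G l l' = 0")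
      case True
      obtain m where m: "m \<in> Od" "form G l m \<noteq> 0" using nondegenerate_odd l by blast
      have ml: "form G l m \<cdot> l' = form G l' m \<cdot> l"
        using odd_plane_identity[OF dim_odd l(2,1) m(1)] form_odd_skew[OF l(2,1)] True by simp
      have "form G l' m \<noteq> 0"
      proof
        assume "form G l' m = 0"
        then have "form G l m \<cdot> l' = 0" using ml by simp
        then show False using m l by simp
      qed
      moreover have "form G l' m \<cdot> brk G l l = form G l m \<cdot> brk G l l'"
        using arg_cong[OF ml, of "brk G l"] l by (simp add: bilinear_simps)
      ultimately show ?thesis using l by auto
    next
      case False
      define w where "w = (1 / form G l l') \<cdot> l'"
      have w: "w \<in> Od" "form G l w = 1" "brk G l w = 0" using l False by (simp_all add: w_def bilinear_simps)
      have w0: "w \<noteq> 0" using w l by (auto simp: bilinear_simps)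
      show ?thesis
      proof (cases "brk G l l = 0")
        case False
        then obtain x where x: "x \<in> Ev" "form G (brk G l l) x \<noteq> 0"
          using nondegenerate_even[OF brk_odd_odd[OF l(1) l(1)]] by blast
        then have x': "form G x (brk G l l) \<noteq> 0" using form_even_sym[OF x(1) brk_odd_odd[OF l(1) l(1)]] by simp
        have rel: "form G x (brk G w w) \<cdot> brk G l l = form G x (brk G l l) \<cdot> brk G w w"
          using even_action_on_squares(2)[OF dim_odd l(1) w(1,2) x(1)] w x by (simp add: bilinear_simps)
        define c where "c = form G x (brk G w w) / form G x (brk G l l)"
        have "c \<cdot> brk G l l = (1 / form G x (brk G l l)) \<cdot> (form G x (brk G w w) \<cdot> brk G l l)"
          by (simp add: c_def)
        then have N: "brk G w w = c \<cdot> brk G l l" unfolding rel using x' by simp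
        show ?thesis
        proof (cases "c = 0")
          case True
          then show ?thesis using N w w0 by auto
        next
          case False
          define t where "t = csqrt (- 1 / c)"
          have t: "t * t * c = - 1" using False by (metis t_def power2_csqrt power2_eq_square nonzero_divide_eq_eq)
          have lw: "brk G w l = 0" using sym_odd[OF w(1) l(1)] w by simp
          have "brk G (l + t \<cdot> w) (l + t \<cdot> w) = brk G l l + (t * t * c) \<cdot> brk G l l"
            using l w by (simp add: bilinear_simps lw N)
          then have "brk G (l + t \<cdot> w) (l + t \<cdot> w) = 0" unfolding t by simp
          moreover have "l + t \<cdot> w \<noteq> 0"
          proof
            assume 0: "l + t \<cdot> w = 0"
            have "form G (l + t \<cdot> w) w = 1" using l w form_odd_self by (simp add: bilinear_simps)
            then show False using 0 w by (simp add: bilinear_simps)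
          qed
          moreover have "l + t \<cdot> w \<in> Od" using l w by (simp add: bilinear_simps)
          ultimately show ?thesis by blast
        qed
      qed (use l in blast)
    qed
  qed
  then obtain Y where Y: "Y \<in> Od" "Y \<noteq> 0" "brk G Y Y = 0" by blast
  obtain T where T: "T \<in> Od" "form G Y T \<noteq> 0" using nondegenerate_odd Y by blast
  show ?thesis
    by (rule that[of Y "(1 / form G Y T) \<cdot> T"]) (use Y T in \<open>simp_all add: bilinear_simps\<close>)
qed

lemma even_classification:
  assumes "solvable G"
  shows "i_isomorphic (even_algebra G) g61 \<or>
    (\<exists>l. l \<noteq> 0 \<and> i_isomorphic (even_algebra G) (g62 l)) \<or> i_isomorphic (even_algebra G) g63"
proof -
  obtain z where z: "z \<noteq> 0" "lie.central z" by (rule center_nontrivial_even[OF assms])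
  note iso = i_isomorphic_alg6[OF _ even_valued_tables(1)] i_isomorphic_alg6[OF _ even_valued_tables(2)]
    i_isomorphic_alg6[OF _ even_valued_tables(3)]
  from lie.quadratic_lie_dim6[OF z(2,1)] show ?thesis
    unfolding g61_def g62_def g63_def using iso by blast
qed

lemma unit_comb: "(\<Sum>k\<in>even_gens. (c *s bv i) $ k *s e k) = (if i \<in> even_gens then c *s e i else 0)"
  by (simp add: axis_def if_distrib[of "\<lambda>c. c *s _"] if_distrib[of "\<lambda>x. _ * x"] cong: if_cong)

lemma indecomposable_classification:
  assumes YT: "Y \<in> Od" "T \<in> Od" "form G Y T = 1" "brk G Y Y = 0"
    and nz: "brk G Y T \<noteq> 0 \<or> brk G T T \<noteq> 0"
  shows "(\<exists>l m n. (l, m, n) \<noteq> (0, 0, 0) \<and> i_isomorphic G (g821 l m n)) \<or>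
            (\<exists>l m. i_isomorphic G (g822 l m)) \<or>
            (\<exists>l. l \<noteq> 0 \<and> i_isomorphic G (g823 l)) \<or>
            (\<exists>l m. l \<noteq> 0 \<and> m \<noteq> 0 \<and> i_isomorphic G (g824 l m)) \<or>
            (\<exists>l. l \<noteq> 0 \<and> i_isomorphic G (g825 l)) \<or>
            (\<exists>l m. l = 1 \<and> m \<noteq> 0 \<and> i_isomorphic G (g826 l m)) \<or>
            i_isomorphic G g827 \<or>
            (\<exists>l. l \<noteq> 0 \<and> i_isomorphic G (g828 l)) \<or>
            i_isomorphic G g829"
proof -
  define a b where "a = \<psi> (brk G Y T)" and "b = \<psi> (brk G T T)"
  have ab: "brk G Y T = \<phi> a" "brk G T T = \<phi> b"
    using YT by (simp_all add: a_def b_def phi_psi brk_odd_odd)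
  have TY: "brk G T Y = \<phi> a" using sym_odd YT ab by metis
  have ph: "x = y" if "\<phi> x = \<phi> y" for x y using that phi_eq by blast
  \<comment> \<open>Each term of the formula for \<open>[x, [Y, T]]\<close> contains
    \<open>[Y, Y]\<close>.\<close>
  have ca: "lie.central a"
    unfolding lie.central_def
  proof
    fix y
    have "brk G (\<phi> y) (\<phi> a) = 0"
      using even_action_on_squares(2)[OF dim_odd YT(1-3) phi_even[of y]] phi_even[of y]
      by (simp add: YT(4) ab bilinear_simps phi_even)
    then have "brk G (\<phi> a) (\<phi> y) = 0" using skew_even[OF phi_even phi_even, of a y] by simp
    then show "ebr a y = 0" using psi_phi[of 0] by (simp add: phi_zero)
  qed
  have bb: "ebr x b = 2 *s (eform x b *s a - eform x a *s b)" for x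
    by (rule ph) (use even_action_on_squares(3)[OF dim_odd YT(1-3) phi_even[of x]]
        in \<open>simp add: phi_psi phi_simps ab bilinear_simps phi_even scale_right_diff_distrib\<close>)
  \<comment> \<open>Replacing \<open>T\<close> by \<open>T + t Y\<close> preserves the symplectic
    basis and \<open>a\<close>, and adds \<open>2 t a\<close> to \<open>b\<close>.\<close>
  have br: "brk G Y (T + t \<cdot> Y) = \<phi> a" "brk G (T + t \<cdot> Y) (T + t \<cdot> Y) = \<phi> (b + (2 * t) *s a)"
    "T + t \<cdot> Y \<in> Od" "form G Y (T + t \<cdot> Y) = 1" for t
  proof -
    have two: "(2 * c) \<cdot> v = c \<cdot> v + c \<cdot> v" for c v using scale_left_distrib[of c c v] by simp
    show "brk G Y (T + t \<cdot> Y) = \<phi> a" "T + t \<cdot> Y \<in> Od" "form G Y (T + t \<cdot> Y) = 1"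
      using YT form_odd_self[OF YT(1)] by (simp_all add: bilinear_simps ab)
    show "brk G (T + t \<cdot> Y) (T + t \<cdot> Y) = \<phi> (b + (2 * t) *s a)"
      using YT by (simp add: bilinear_simps ab TY phi_simps two scale_right_distrib add_ac)
  qed
  note iso = i_isomorphic_alg8[OF _ even_valued_tables(1) odd_extensions(1)]
    i_isomorphic_alg8[OF _ even_valued_tables(1) odd_extensions(2)]
    i_isomorphic_alg8[OF _ even_valued_tables(2) odd_extensions(3)]
    i_isomorphic_alg8[OF _ even_valued_tables(2) odd_extensions(4)]
    i_isomorphic_alg8[OF _ even_valued_tables(2) odd_extensions(5)]
    i_isomorphic_alg8[OF _ even_valued_tables(3) odd_extensions(6)]
    i_isomorphic_alg8[OF _ even_valued_tables(3) odd_extensions(7)]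
    i_isomorphic_alg8[OF _ even_valued_tables(3) odd_extensions(8)]
  note defs = g821_def g822_def g823_def g824_def g825_def g827_def g828_def g829_def
  have zero_comb: "(\<Sum>k\<in>even_gens. (0::vec8) $ k *s e k) = 0" for e :: "gen \<Rightarrow> complex^6" by simp
  have gens: "Z3 \<in> even_gens" "X1 \<in> even_gens" "X2 \<in> even_gens" by (simp_all add: even_gens_def)
  have one_comb: "(\<Sum>k\<in>even_gens. bv i $ k *s e k) = e i" if "i \<in> even_gens" for i and e :: "gen \<Rightarrow> complex^6"
    using unit_comb[of 1 i e] that by simp
  show ?thesis
  proof (cases "a = 0")
    case True
    have b0: "b \<noteq> 0" using nz ab True by (auto simp: phi_zero)
    have "ebr b x = 0" for x
      using bb[of x] lie.br_skew[of b x] True by (simp add: phi_zero bilinear_simps phi_even)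
    then have cb: "lie.central b" by (simp add: lie.central_def)
    \<comment> \<open>The basis \<open>Y / s\<close>, \<open>s T\<close> with \<open>s^2 = c\<close>
      is again symplectic and multiplies \<open>b\<close> by \<open>c\<close>; this adapts
      \<open>b\<close> to the normalized \<open>Z3\<close>.\<close>
    have scaled: "\<exists>Y T. Y \<in> Od \<and> T \<in> Od \<and> form G Y T = 1 \<and> brk G Y Y = 0 \<and> brk G Y T = \<phi> 0 \<and> brk G T T = \<phi> (c *s b)"
      if "c \<noteq> 0" for c
    proof -
      define s where "s = csqrt c"
      have s: "s * s = c" by (metis s_def power2_csqrt power2_eq_square)
      then have "s \<noteq> 0" using that by auto
      then show ?thesis
        using YT s True
        by (intro exI[of _ "(1/s) \<cdot> Y"] exI[of _ "s \<cdot> T"]) (simp add: bilinear_simps ab phi_simps)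
    qed
    from lie.quadratic_lie_dim6[OF cb b0] show ?thesis
    proof (elim disjE exE conjE)
      fix e assume e: "lie.realizes table61 e" "e Z3 = b"
      obtain Y' T' where 1: "Y' \<in> Od" "T' \<in> Od" "form G Y' T' = 1" "brk G Y' Y' = 0" "brk G Y' T' = \<phi> 0" "brk G T' T' = \<phi> (1 *s b)"
        using scaled[of 1] by auto
      have "i_isomorphic G (g822 0 0)"
        unfolding defs by (rule iso(2)[OF e(1) 1(1-4)]) (simp_all only: 1(5,6) zero_comb one_comb gens e(2) vec.scale_one)
      then show ?thesis by blast
    next
      fix c l e assume e: "c \<noteq> 0" "l \<noteq> 0" "lie.realizes (table62 l) e" "e Z3 = c *s b"
      obtain Y' T' where 1: "Y' \<in> Od" "T' \<in> Od" "form G Y' T' = 1" "brk G Y' Y' = 0" "brk G Y' T' = \<phi> 0" "brk G T' T' = \<phi> (c *s b)"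
        using scaled[of c] e(1) by auto
      have "i_isomorphic G (g823 l)"
        unfolding defs by (rule iso(3)[OF e(3) 1(1-4)]) (simp_all only: 1(5,6) zero_comb one_comb gens e(4))
      then show ?thesis using e(2) by blast
    next
      fix c e assume e: "c \<noteq> 0" "lie.realizes table63 e" "e Z3 = c *s b"
      obtain Y' T' where 1: "Y' \<in> Od" "T' \<in> Od" "form G Y' T' = 1" "brk G Y' Y' = 0" "brk G Y' T' = \<phi> 0" "brk G T' T' = \<phi> (c *s b)"
        using scaled[of c] e(1) by auto
      have "i_isomorphic G g827"
        unfolding defs by (rule iso(6)[OF e(2) 1(1-4)]) (simp_all only: 1(5,6) zero_comb one_comb gens e(3))
      then show ?thesis by blast
    qed
  next
    case a0: False
    show ?thesis
    proof (cases "\<exists>c. b = c *s a")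
      case True
      then obtain c where c: "b = c *s a" by blast
      \<comment> \<open>This shift of \<open>T\<close> turns \<open>b = c a\<close> into 0.\<close>
      define T' where "T' = T + (- c / 2) \<cdot> Y"
      have 1: "T' \<in> Od" "form G Y T' = 1" "brk G Y T' = \<phi> a" "brk G T' T' = \<phi> 0"
        using br[of "- c / 2"] by (simp_all add: T'_def c)
      from lie.quadratic_lie_dim6[OF ca a0] show ?thesis
      proof (elim disjE exE conjE)
        fix e assume e: "lie.realizes table61 e" "e Z3 = a"
        have "i_isomorphic G (g821 0 0 1)"
          unfolding defs by (rule iso(1)[OF e(1) YT(1) 1(1,2) YT(4)])
            (simp_all only: 1(3,4) zero_comb unit_comb one_comb gens e(2) vec.scale_one if_True)
        then have "\<exists>l m n. (l, m, n) \<noteq> (0, 0, 0) \<and> i_isomorphic G (g821 l m n)"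
          by (intro exI[of _ 0] exI[of _ 0] exI[of _ 1]) simp
        then show ?thesis by (rule disjI1)
      next
        fix d l e assume e: "d \<noteq> 0" "l \<noteq> 0" "lie.realizes (table62 l) e" "e Z3 = d *s a"
        \<comment> \<open>The normalization of \<open>Z3\<close> leaves \<open>1 / d\<close> as the
          parameter of the model.\<close>
        have ad: "a = (1 / d) *s e Z3" using e by simp
        have "i_isomorphic G (g824 l (1 / d))"
          unfolding defs by (rule iso(4)[OF e(3) YT(1) 1(1,2) YT(4)])
            (simp_all only: 1(3,4) zero_comb unit_comb gens ad[symmetric] if_True)
        moreover have "1 / d \<noteq> 0" using e by simp
        ultimately show ?thesis using e(2) by blast
      next
        fix d e assume e: "d \<noteq> 0" "lie.realizes table63 e" "e Z3 = d *s a"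
        have ad: "a = (1 / d) *s e Z3" using e by simp
        have "i_isomorphic G (g828 (1 / d))"
          unfolding defs by (rule iso(7)[OF e(2) YT(1) 1(1,2) YT(4)])
            (simp_all only: 1(3,4) zero_comb unit_comb gens ad[symmetric] if_True)
        moreover have "1 / d \<noteq> 0" using e by simp
        ultimately show ?thesis by blast
      qed
    next
      case False
      then have ba: "\<And>c. b \<noteq> c *s a" by blast
      obtain t where t: "(\<exists>l e. l \<noteq> 0 \<and> lie.realizes (table62 l) e \<and> e Z3 = 2 *s a \<and> e X1 = b + t *s a) \<or>
          (\<exists>e. lie.realizes table63 e \<and> e Z3 = 2 *s a \<and> e X2 = b + t *s a)"
        using lie.quadratic_lie_dim6_eigenvector[OF ca bb a0 ba] by blast
      \<comment> \<open>Half of \<open>t\<close>, because the shift enters \<open>[T', T']\<close>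
        twice; the new bracket is the eigenvector used as a basis vector.\<close>
      define T' where "T' = T + (t / 2) \<cdot> Y"
      have 1: "T' \<in> Od" "form G Y T' = 1" "brk G Y T' = \<phi> a" "brk G T' T' = \<phi> (b + t *s a)"
        using br[of "t / 2"] by (simp_all add: T'_def)
      from t show ?thesis
      proof (elim disjE exE conjE)
        fix l e assume e: "l \<noteq> 0" "lie.realizes (table62 l) e" "e Z3 = 2 *s a" "e X1 = b + t *s a"
        have ad: "a = (1 / 2) *s e Z3" using e by simp
        have "i_isomorphic G (g825 l)"
          unfolding defs by (rule iso(5)[OF e(2) YT(1) 1(1,2) YT(4)])
            (simp_all only: 1(3,4) one_comb unit_comb gens ad[symmetric] e(4) if_True)
        then show ?thesis using e(1) by blast
      next
        fix e assume e: "lie.realizes table63 e" "e Z3 = 2 *s a" "e X2 = b + t *s a"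
        have ad: "a = (1 / 2) *s e Z3" using e by simp
        have "i_isomorphic G g829"
          unfolding defs by (rule iso(8)[OF e(1) YT(1) 1(1,2) YT(4)])
            (simp_all only: 1(3,4) one_comb unit_comb gens ad[symmetric] e(3) if_True)
        then show ?thesis by blast
      qed
    qed
  qed
qed

end

theorem theorem3p3p2:
  fixes G :: "'a::ab_group_add qsuper"
  assumes "quadratic_lie_superalgebra G"
    and "solvable G"
    and "sdim G (whole G) = 8"
    and "sdim G (even_part G) = 6"
    and "indecomposable (even_algebra G)"
  shows "(decomposable G \<longrightarrow>
            orthogonal_direct_sum G (even_part G) (odd_part G) \<and>
            (i_isomorphic (even_algebra G) g61 \<or>
             (\<exists>l. l \<noteq> 0 \<and> i_isomorphic (even_algebra G) (g62 l)) \<or>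
             i_isomorphic (even_algebra G) g63) \<and>
            symplectic_on G (odd_part G) \<and> sdim G (odd_part G) = 2 \<and>
            (\<forall>x\<in>even_part G. \<forall>y\<in>odd_part G. brk G x y = 0))
       \<and> (indecomposable G \<longrightarrow>
            (\<exists>l m n. (l, m, n) \<noteq> (0, 0, 0) \<and> i_isomorphic G (g821 l m n)) \<or>
            (\<exists>l m. i_isomorphic G (g822 l m)) \<or>
            (\<exists>l. l \<noteq> 0 \<and> i_isomorphic G (g823 l)) \<or>
            (\<exists>l m. l \<noteq> 0 \<and> m \<noteq> 0 \<and> i_isomorphic G (g824 l m)) \<or>
            (\<exists>l. l \<noteq> 0 \<and> i_isomorphic G (g825 l)) \<or>
            (\<exists>l m. l = 1 \<and> m \<noteq> 0 \<and> i_isomorphic G (g826 l m)) \<or>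
            i_isomorphic G g827 \<or>
            (\<exists>l. l \<noteq> 0 \<and> i_isomorphic G (g828 l)) \<or>
            i_isomorphic G g829)"
proof -
  interpret quadratic_lie_superalgebra G by fact
  have d2: "sdim G (odd_part G) = 2" by (rule sdim_odd) fact+
  have d6: "dim (even_part G) = CARD(6)" using assms(4) by (simp add: sdim_def)
  obtain \<phi> :: "complex^6 \<Rightarrow> 'a" where \<phi>: "\<And>x y. \<phi> (x + y) = \<phi> x + \<phi> y"
      "\<And>c x. \<phi> (c *s x) = scal G c (\<phi> x)" "inj \<phi>" "range \<phi> = even_part G"
    using coordinates_exist[OF even_subspace d6] by blast
  interpret even_coordinates G \<phi>
    by unfold_locales (fact \<phi> assms d2)+
  have triv: "brk G x y = 0" if "decomposable G" "x \<in> even_part G" "y \<in> odd_part G" for x y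
    using decomposable_trivial_action[OF d2 assms(5) that] .
  obtain Y T where YT: "Y \<in> odd_part G" "T \<in> odd_part G" "form G Y T = 1" "brk G Y Y = 0"
    by (rule odd_isotropic[OF assms(2)])
  \<comment> \<open>Together with \<open>[Y, Y] = 0\<close>, these equations annihilate the even
    action by \<open>odd_action\<close>, and the even part splits off.\<close>
  have "decomposable G" if 0: "brk G Y T = 0" "brk G T T = 0"
  proof (rule trivial_action_decomposable[OF assms(4) d2])
    fix x y assume x: "x \<in> even_part G" and y: "y \<in> odd_part G"
    have "brk G x Y = 0" "brk G x T = 0"
      using odd_action[OF d2 YT(1-3) x] x by (simp_all add: YT(4) 0 form_zero even_whole)
    moreover have "y = scal G (form G y T) Y - scal G (form G y Y) T"
      using odd_plane_identity[OF d2 y YT(1,2)] YT(3) by simp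
    ultimately show "brk G x y = 0"
      using x YT by (metis (no_types, lifting) brk_sub(2) brk_scal_right W_closed(2) even_whole odd_whole scale_zero_right diff_zero)
  qed
  then have "indecomposable G \<Longrightarrow> brk G Y T \<noteq> 0 \<or> brk G T T \<noteq> 0" by blast
  from indecomposable_classification[OF YT this]
  show ?thesis
    using orthogonal_sum_parts[OF triv] even_classification[OF assms(2)] symplectic_odd d2 triv
    by blast
qed

end
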